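(* For any $k\ge2$ and $n\ge1$ there is a $C^1$ open set of iterated function systems generated by $k$ diffeomorphisms $f_0,\ldots,f_{k-1}$ of the sphere $S^n$ such that each of them has the following properties: (1) the iterated function system is minimal, so that there is a stationary measure $m$ of full support; (2) $F_+$ has negative fiber Lyapunov exponents with respect to $\nu_+\times m$; (3) the conditional measures $\mu_\omega$ of the $F$-invariant measure $\mu$ associated with $m$ are delta measures for $\nu$-almost all $\omega$.
   Context: Each $f_i$ is chosen independently with fixed probability $p_i\in(0,1)$, $\sum p_i=1$. Minimal: for every $x$ some sequence $x_0=x$, $x_{j+1}=f_{i_j}(x_j)$ is dense. Stationary measure: probability measure $m$ with $m=\sum_ip_if_im$, $f_im=m\circ f_i^{-1}$. $\Sigma_+=\{0,\ldots,k-1\}^{\mathbb{N}}$, $\Sigma=\{0,\ldots,k-1\}^{\mathbb{Z}}$ with Bernoulli measures $\nu_+,\nu$ (weights $p_i$), $\sigma$ the left shift, $F_+(\omega,x)=(\sigma\omega,f_{\omega(0)}(x))$ on $\Sigma_+\times S^n$ and $F$ given by the same formula on $\Sigma\times S^n$. With $f^n_\omega=f_{\omega(n-1)}\circ\cdots\circ f_{\omega(0)}$, negative fiber Lyapunov exponents means $\lim_n\frac1n\ln\|Df^n_\omega(x)\|<0$ for $\nu_+\times m$-a.e. $(\omega,x)$. For $\nu$-a.e. $\omega$, the weak-star limit $\mu_\omega=\lim_{j\to\infty}f^j_{\sigma^{-j}\omega}m$ exists, and the measure $\mu$ on $\Sigma\times S^n$ with marginal $\nu$ and conditional measures $\mu_\omega$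 on the fibers $\{\omega\}\times S^n$ is $F$-invariant. $C^1$ open refers to $C^1$ perturbations of each generator. *)

theory Defs
  imports "HOL-Probability.Probability"
begin

text \<open>The sphere S^n is modelled as the unit sphere of a Euclidean space 'a with
  DIM('a) = n + 1.  A C^1 map of the sphere is (the restriction of) a map that is C^1
  on an open neighbourhood of the sphere; only derivatives along tangent vectors are used.\<close>

abbreviation Sph :: "'a::euclidean_space set" where
  "Sph \<equiv> sphere 0 1"

definition C1_near :: "'a::euclidean_space set \<Rightarrow> ('a \<Rightarrow> 'a) \<Rightarrow> bool" where
  "C1_near S f \<longleftrightarrow> (\<exists>T f'. open T \<and> S \<subseteq> T \<and>
      (\<forall>x\<in>T. (f has_derivative blinfun_apply (f' x)) (at x)) \<and> continuous_on T f')"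

definition sphere_diffeo :: "('a::euclidean_space \<Rightarrow> 'a) \<Rightarrow> bool" where
  "sphere_diffeo f \<longleftrightarrow> f ` Sph = Sph \<and> C1_near Sph f \<and>
     (\<exists>g. C1_near Sph g \<and> (\<forall>x\<in>Sph. g x \<in> Sph \<and> g (f x) = x \<and> f (g x) = x))"

definition tangent_opnorm :: "('a::euclidean_space \<Rightarrow> 'a) \<Rightarrow> 'a \<Rightarrow> real" where
  "tangent_opnorm L x = Sup ((\<lambda>v. norm (L v)) ` {v. inner v x = 0 \<and> norm v = 1})"

definition c1_dist :: "('a::euclidean_space \<Rightarrow> 'a) \<Rightarrow> ('a \<Rightarrow> 'a) \<Rightarrow> real" where
  "c1_dist f g = (SUP x\<in>Sph. norm (f x - g x)) +
     (SUP x\<in>Sph. tangent_opnorm (\<lambda>v. frechet_derivative f (at x) v - frechet_derivative g (at x) v) x)"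

definition c1_open_ifs :: "nat \<Rightarrow> ('a::euclidean_space \<Rightarrow> 'a) list set \<Rightarrow> bool" where
  "c1_open_ifs k U \<longleftrightarrow>
     (\<forall>fs\<in>U. length fs = k \<and> (\<forall>i<k. sphere_diffeo (fs ! i))) \<and>
     (\<forall>fs\<in>U. \<exists>\<epsilon>>0. \<forall>gs. length gs = k \<and> (\<forall>i<k. sphere_diffeo (gs ! i) \<and> c1_dist (fs ! i) (gs ! i) < \<epsilon>)
         \<longrightarrow> gs \<in> U)"

fun ifs_iter :: "('a \<Rightarrow> 'a) list \<Rightarrow> (nat \<Rightarrow> nat) \<Rightarrow> nat \<Rightarrow> 'a \<Rightarrow> 'a" where
  "ifs_iter fs \<omega> 0 = id"
| "ifs_iter fs \<omega> (Suc n) = (fs ! \<omega> n) \<circ> ifs_iter fs \<omega> n"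

text \<open>f^j_{\<sigma>^{-j}\<omega>} = f_{\<omega>(-1)} o ... o f_{\<omega>(-j)} for two-sided \<omega>.\<close>
definition back_iter :: "('a \<Rightarrow> 'a) list \<Rightarrow> (int \<Rightarrow> nat) \<Rightarrow> nat \<Rightarrow> 'a \<Rightarrow> 'a" where
  "back_iter fs \<omega> j = ifs_iter fs (\<lambda>i. \<omega> (int i - int j)) j"

definition minimal_ifs :: "('a::euclidean_space \<Rightarrow> 'a) list \<Rightarrow> bool" where
  "minimal_ifs fs \<longleftrightarrow> (\<forall>x\<in>Sph. \<exists>\<omega>. (\<forall>j. \<omega> j < length fs) \<and>
       Sph \<subseteq> closure (range (\<lambda>j. ifs_iter fs \<omega> j x)))"

definition sphere_borel :: "'a::euclidean_space measure" where
  "sphere_borel = restrict_space borel Sph"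

definition letter_measure :: "nat \<Rightarrow> (nat \<Rightarrow> real) \<Rightarrow> nat measure" where
  "letter_measure k p = point_measure {..<k} (\<lambda>i. ennreal (p i))"

definition nu_plus :: "nat \<Rightarrow> (nat \<Rightarrow> real) \<Rightarrow> (nat \<Rightarrow> nat) measure" where
  "nu_plus k p = PiM UNIV (\<lambda>_::nat. letter_measure k p)"

definition nu_two :: "nat \<Rightarrow> (nat \<Rightarrow> real) \<Rightarrow> (int \<Rightarrow> nat) measure" where
  "nu_two k p = PiM UNIV (\<lambda>_::int. letter_measure k p)"

definition stationary :: "('a::euclidean_space \<Rightarrow> 'a) list \<Rightarrow> (nat \<Rightarrow> real) \<Rightarrow> 'a measure \<Rightarrow> bool" where
  "stationary fs p m \<longleftrightarrow> prob_space m \<and> sets m = sets sphere_borel \<and>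
     (\<forall>A\<in>sets m. emeasure m A =
        (\<Sum>i<length fs. ennreal (p i) * emeasure (distr m sphere_borel (fs ! i)) A))"

definition full_support :: "'a::euclidean_space measure \<Rightarrow> bool" where
  "full_support m \<longleftrightarrow> (\<forall>x\<in>Sph. \<forall>e>0. emeasure m (ball x e \<inter> Sph) > 0)"

definition neg_lyap :: "('a::euclidean_space \<Rightarrow> 'a) list \<Rightarrow> (nat \<Rightarrow> real) \<Rightarrow> 'a measure \<Rightarrow> bool" where
  "neg_lyap fs p m \<longleftrightarrow>
     (AE z in nu_plus (length fs) p \<Otimes>\<^sub>M m. \<exists>L<0.
        (\<lambda>n. ln (tangent_opnorm (frechet_derivative (ifs_iter fs (fst z) n) (at (snd z))) (snd z)) / real n)
          \<longlonglongrightarrow> L)"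

definition weak_star_conv :: "(nat \<Rightarrow> 'a::euclidean_space measure) \<Rightarrow> 'a measure \<Rightarrow> bool" where
  "weak_star_conv \<mu>s \<mu> \<longleftrightarrow> (\<forall>g :: 'a \<Rightarrow> real. continuous_on Sph g \<longrightarrow>
      (\<lambda>j. integral\<^sup>L (\<mu>s j) g) \<longlonglongrightarrow> integral\<^sup>L \<mu> g)"

text \<open>For \<nu>-a.e. \<omega>, \<mu>_\<omega> = lim f^j_{\<sigma>^{-j}\<omega>} m exists and is a delta measure.\<close>
definition delta_conditionals :: "('a::euclidean_space \<Rightarrow> 'a) list \<Rightarrow> (nat \<Rightarrow> real) \<Rightarrow> 'a measure \<Rightarrow> bool" where
  "delta_conditionals fs p m \<longleftrightarrow>
     (AE \<omega> in nu_two (length fs) p. \<exists>y\<in>Sph.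
        weak_star_conv (\<lambda>j. distr m sphere_borel (back_iter fs \<omega> j)) (return sphere_borel y))"

end

(* The pole a attracts and -a repels under the Moebius map f0 = (dilation by c towards a) o P, where P fixes a
   and permutes the other coordinates cyclically; all other generators are close to a rotation R by an irrational
   angle in the plane of a and one coordinate vector.

   Contraction: chordal distances obey |f0 x - f0 y|^2 = rho x * rho y * |x - y|^2, and rho is small except near -a.
   A bounded potential that penalises points about to be rotated close to -a makes the mean logarithm of the
   contraction rate uniformly negative in one step, so E |g_w x - g_w y|^s <= K r^n |x - y|^s for some s > 0 and
   all pairs x, y, robustly under C^1 perturbations.  Hence reversed compositions converge almost surely, the law of
   the limit is stationary, and its conditional measures are delta measures; Fatou's lemma turns the estimate into
   exponential decay of derivatives, while the limit defining the Lyapunov exponent exists by Kingman's theorem.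

   Minimality: every point y of the sphere is R^(t_n) f0 ... R^(t_1) f0 a with suitable rotations.  For y near a these
   words contract a large region into itself, which gives a blending neighbourhood of a that survives perturbation. *)
theory Submission
  imports Defs
begin

section \<open>Kingman's subadditive ergodic theorem\<close>

text \<open>The obstacle is the point \<open>- a\<close>. There \<open>f0\<close> expands by
  \<open>1 / c\<close>, so the one-step mean of the logarithm of the derivative is positive, and no
  one-step estimate for the bare metric can hold everywhere; the potential repairs this. Chordal
  distances treat all pairs of points at once: the factor of a pair is the geometric mean of two
  one-point factors, so a drift condition at single points is enough. The permutation
  \<open>P\<close> matters as soon as the sphere has dimension at least 2: the dilation and the
  rotations preserve the circle in the plane of \<open>a\<close> and \<open>E 0\<close>, and without
  \<open>P\<close> no orbit starting on it would leave it. The constants are fixed in an order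
  without circularity: \<open>J\<close> from \<open>p 0\<close>, then \<open>\<eta>\<close> from the
  first \<open>J\<close> rotations of \<open>a\<close> and \<open>- a\<close>, then
  \<open>c = \<eta> ^ 4\<close>, then the radius \<open>\<sigma>\<close> of the blending
  neighbourhood, then bounds \<open>b\<close> and \<open>L\<close> on exponents and word lengths,
  and finally \<open>\<epsilon>\<close>. The bounds \<open>b\<close> and \<open>L\<close> are
  uniform over the sphere, which is why one \<open>\<epsilon>\<close> serves all words.\<close>

definition low_rate :: "(nat \<Rightarrow> 'a \<Rightarrow> real) \<Rightarrow> 'a \<Rightarrow> real" where
  "low_rate \<phi> x = real_of_ereal (liminf (\<lambda>n. ereal (\<phi> n x / real n)))"

lemma low_rate_measurable[measurable]:
  assumes [measurable]: "\<And>n. \<phi> n \<in> borel_measurable M"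
  shows "low_rate \<phi> \<in> borel_measurable M"
  unfolding low_rate_def by measurable

context
  fixes \<phi> :: "nat \<Rightarrow> 'a \<Rightarrow> real" and C :: real and x :: 'a
  assumes bound: "\<And>n. \<bar>\<phi> n x\<bar> \<le> C * real n"
begin

lemma ratio_bound: "\<bar>\<phi> n x / real n\<bar> \<le> C"
proof (cases "n = 0")
  case True
  have "0 \<le> C" using bound[of 1] by (smt (verit) mult_cancel_left1 of_nat_1 abs_ge_zero)
  then show ?thesis using True by simp
next
  case False
  then show ?thesis using bound[of n] by (simp add: field_simps)
qed

lemma liminf_ratio_bounds:
  "ereal (- C) \<le> liminf (\<lambda>n. ereal (\<phi> n x / real n))" "liminf (\<lambda>n. ereal (\<phi> n x / real n)) \<le> ereal C"
proof -
  let ?u = "\<lambda>n. ereal (\<phi> n x / real n)"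
  show "ereal (- C) \<le> liminf ?u"
    by (rule Liminf_bounded) (use abs_le_D2[OF ratio_bound] in \<open>auto intro!: always_eventually simp: minus_le_iff\<close>)
  have "liminf ?u \<le> limsup ?u" by (rule Liminf_le_Limsup) simp
  also have "limsup ?u \<le> ereal C"
    by (rule Limsup_bounded) (use abs_le_D1[OF ratio_bound] in \<open>auto intro!: always_eventually\<close>)
  finally show "liminf ?u \<le> ereal C" .
qed

text \<open>\<open>real_of_ereal\<close> sends infinite values to 0, but the linear bound confines
  the liminf to the interval from \<open>- C\<close> to \<open>C\<close>, so nothing is
  lost.\<close>

lemma ereal_low_rate: "ereal (low_rate \<phi> x) = liminf (\<lambda>n. ereal (\<phi> n x / real n))"
proof -
  have "\<bar>liminf (\<lambda>n. ereal (\<phi> n x / real n))\<bar> \<noteq> \<infinity>" using liminf_ratio_bounds by auto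
  then show ?thesis unfolding low_rate_def by (simp add: ereal_real)
qed

lemma low_rate_bound: "\<bar>low_rate \<phi> x\<bar> \<le> C"
  using liminf_ratio_bounds unfolding ereal_low_rate[symmetric] by (simp add: abs_le_iff minus_le_iff)

lemma low_rate_eventually: "e > 0 \<Longrightarrow> \<forall>\<^sub>F n in sequentially. low_rate \<phi> x - e < \<phi> n x / real n"
  using less_LiminfD[of "ereal (low_rate \<phi> x - e)" sequentially "\<lambda>n. ereal (\<phi> n x / real n)"]
  by (simp add: ereal_low_rate[symmetric])

lemma low_rate_frequently: "e > 0 \<Longrightarrow> \<exists>\<^sub>F n in sequentially. \<phi> n x / real n < low_rate \<phi> x + e"
proof (rule ccontr)
  assume e: "e > 0" and "\<not> (\<exists>\<^sub>F n in sequentially. \<phi> n x / real n < low_rate \<phi> x + e)"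
  then have "\<forall>\<^sub>F n in sequentially. ereal (low_rate \<phi> x + e) \<le> ereal (\<phi> n x / real n)"
    by (simp add: frequently_def not_less)
  then have "ereal (low_rate \<phi> x + e) \<le> ereal (low_rate \<phi> x)"
    unfolding ereal_low_rate by (rule Liminf_bounded)
  then show False using e by simp
qed

lemma low_rate_ge:
  assumes "\<And>e. e > 0 \<Longrightarrow> \<forall>\<^sub>F n in sequentially. L - e \<le> \<phi> n x / real n"
  shows "L \<le> low_rate \<phi> x"
proof (rule field_le_epsilon)
  fix e :: real assume "e > 0"
  then have "\<forall>\<^sub>F n in sequentially. ereal (L - e) \<le> ereal (\<phi> n x / real n)" using assms by simp
  then have "ereal (L - e) \<le> ereal (low_rate \<phi> x)" unfolding ereal_low_rate by (rule Liminf_bounded)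
  then show "L \<le> low_rate \<phi> x + e" by simp
qed

end

text \<open>The bound linear in \<open>n\<close> takes the place of the usual integrability
  condition and forces \<open>\<phi> 0 x = 0\<close>. As \<open>T\<close> may fail to be ergodic,
  the limit is an invariant function rather than a constant.\<close>

locale bounded_cocycle = prob_space M for M :: "'a measure" +
  fixes T :: "'a \<Rightarrow> 'a" and \<phi> :: "nat \<Rightarrow> 'a \<Rightarrow> real" and C :: real
  assumes T_meas[measurable]: "T \<in> measurable M M"
    and T_inv: "distr M M T = M"
    and phi_meas[measurable]: "\<And>n. \<phi> n \<in> borel_measurable M"
    and subadd: "\<And>m n x. x \<in> space M \<Longrightarrow> \<phi> (m + n) x \<le> \<phi> m x + \<phi> n ((T ^^ m) x)"
    and bound: "\<And>n x. x \<in> space M \<Longrightarrow> \<bar>\<phi> n x\<bar> \<le> C * real n"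
begin

lemma T_space: "x \<in> space M \<Longrightarrow> T x \<in> space M"
  using T_meas by (rule measurable_space)

lemma Tn_space: "x \<in> space M \<Longrightarrow> (T ^^ n) x \<in> space M"
  by (induction n) (auto intro: T_space)

lemma Tn_meas[measurable]: "(T ^^ n) \<in> measurable M M"
  by (induction n) (auto intro: measurable_comp T_meas simp: id_def)

lemma Tn_inv: "distr M M (T ^^ n) = M"
proof (induction n)
  case (Suc n)
  have "distr M M (T ^^ Suc n) = distr (distr M M (T ^^ n)) M T"
    by (subst distr_distr) auto
  then show ?case unfolding Suc T_inv by (simp add: comp_def)
qed (simp add: id_def distr_id)

lemma integral_Tn:
  assumes [measurable]: "f \<in> borel_measurable M"
  shows "(\<integral>x. f ((T ^^ n) x) \<partial>M) = (\<integral>x. (f x :: real) \<partial>M)"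
proof -
  have "(\<integral>x. f x \<partial>M) = (\<integral>x. f x \<partial>distr M M (T ^^ n))" by (simp add: Tn_inv)
  also have "\<dots> = (\<integral>x. f ((T ^^ n) x) \<partial>M)" by (rule integral_distr) auto
  finally show ?thesis by simp
qed

lemma C_nonneg: "0 \<le> C"
proof -
  obtain x where "x \<in> space M" using not_empty by auto
  from bound[OF this, of 1] show ?thesis by simp
qed

abbreviation "lo \<equiv> low_rate \<phi>"

lemma integrable_bdd:
  assumes [measurable]: "f \<in> borel_measurable M" and "\<And>x. x \<in> space M \<Longrightarrow> \<bar>f x\<bar> \<le> (B::real)"
  shows "integrable M f"
  by (rule integrable_const_bound[where B=B]) (use assms in auto)

lemma lo_integrable: "integrable M lo"
  by (rule integrable_bdd[where B=C]) (auto intro: low_rate_bound bound)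

lemma phi_integrable: "integrable M (\<phi> n)"
  by (rule integrable_bdd[where B="C * real n"]) (auto intro: bound)

text \<open>Subadditivity splits off the first step of the orbit; its cost is at most
  \<open>C\<close>, which disappears after division by \<open>n\<close>.\<close>

lemma lo_le_lo_T:
  assumes x: "x \<in> space M"
  shows "lo x \<le> lo (T x)"
proof (rule low_rate_ge[where C=C])
  show "\<bar>\<phi> n (T x)\<bar> \<le> C * real n" for n using bound T_space[OF x] by simp
  fix e :: real assume e: "e > 0"
  have ev: "\<forall>\<^sub>F n in sequentially. lo x - e / 2 < \<phi> n x / real n"
    by (rule low_rate_eventually[where C=C]) (use bound[OF x] e in auto)
  then have ev': "\<forall>\<^sub>F n in sequentially. lo x - e / 2 < \<phi> (Suc n) x / real (Suc n)"
    using eventually_sequentially_Suc[of "\<lambda>n. lo x - e / 2 < \<phi> n x / real n"] by simp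
  \<comment> \<open>Beyond this threshold the slack \<open>e / 2 * n\<close> absorbs both losses:
    \<open>C\<close> for the first step, and at most \<open>C + e / 2\<close> for replacing
    \<open>n + 1\<close> by \<open>n\<close>.\<close>
  obtain N :: nat where N: "real N > 2 * (2 * C + e) / e" using reals_Archimedean2 by blast
  have "\<forall>\<^sub>F n in sequentially. n \<ge> Suc N" by (rule eventually_ge_at_top)
  with ev' show "\<forall>\<^sub>F n in sequentially. lo x - e \<le> \<phi> n (T x) / real n"
  proof eventually_elim
    case (elim n)
    have n: "real n > 2 * (2 * C + e) / e" "n > 0" using elim N by linarith+
    have s: "\<phi> (Suc n) x \<le> \<phi> 1 x + \<phi> n (T x)" using subadd[OF x, of 1 n] by simp
    have "\<phi> 1 x \<le> C" using bound[OF x, of 1] by simp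
    with s have 1: "\<phi> n (T x) \<ge> \<phi> (Suc n) x - C" by simp
    have 2: "\<phi> (Suc n) x \<ge> (lo x - e / 2) * (real n + 1)"
      using elim(1) by (simp add: field_simps del: of_nat_Suc) (simp add: field_simps)
    have "lo x \<ge> - C" using low_rate_bound[of \<phi> x C] bound[OF x] by (simp add: abs_le_iff)
    then have 3: "(lo x - e / 2) * (real n + 1) \<ge> (lo x - e/2) * real n - C - e / 2"
      by (simp add: algebra_simps)
    have 4: "e / 2 * real n \<ge> 2 * C + e" using n e by (simp add: field_simps)
    have "(lo x - e) * real n \<le> \<phi> n (T x)" using 1 2 3 4 e by (auto simp: algebra_simps add_divide_distrib)
    then show ?case using n by (simp add: field_simps)
  qed
qed

text \<open>The increment \<open>lo (T x) - lo x\<close> is nonnegative and, since \<open>T\<close>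
  preserves \<open>M\<close>, has integral 0.\<close>

lemma lo_T: "AE x in M. lo (T x) = lo x"
proof -
  have i: "integrable M (\<lambda>x. lo (T x))"
    by (rule integrable_bdd[where B=C]) (auto intro: low_rate_bound bound T_space)
  have "(\<integral>x. lo (T x) - lo x \<partial>M) = 0"
    using integral_Tn[of lo 1] by (simp add: i lo_integrable)
  then have "AE x in M. lo (T x) - lo x = 0"
    by (subst (asm) integral_nonneg_eq_0_iff_AE) (auto simp: i lo_integrable lo_le_lo_T intro!: AE_I2)
  then show ?thesis by simp
qed

lemma lo_Tn: "AE x in M. \<forall>n. lo ((T ^^ n) x) = lo x"
proof -
  have "AE x in M. lo (T ((T ^^ n) x)) = lo ((T ^^ n) x)" for n
  proof -
    have "AE x in distr M M (T ^^ n). lo (T x) = lo x" unfolding Tn_inv by (rule lo_T)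
    then show ?thesis by (rule AE_distrD[rotated]) auto
  qed
  then have "AE x in M. \<forall>n. lo (T ((T ^^ n) x)) = lo ((T ^^ n) x)" by (simp add: AE_all_countable)
  then show ?thesis
  proof eventually_elim
    case (elim x)
    have "lo ((T ^^ n) x) = lo x" for n using elim by (induction n) auto
    then show ?case by simp
  qed
qed

definition bad :: "real \<Rightarrow> nat \<Rightarrow> 'a set" where
  "bad e K = {x \<in> space M. \<forall>n\<in>{1..K}. real n * (lo x + e) < \<phi> n x}"

lemma bad_sets[measurable]: "bad e K \<in> sets M"
  unfolding bad_def by measurable

text \<open>The sets decrease in \<open>K\<close>, and a point in all of them would have ratios
  bounded away from its own liminf.\<close>

lemma bad_measure: "e > 0 \<Longrightarrow> (\<lambda>K. measure M (bad e K)) \<longlonglongrightarrow> 0"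
proof -
  assume e: "e > 0"
  have "(\<lambda>K. measure M (bad e K)) \<longlonglongrightarrow> measure M (\<Inter>K. bad e K)"
  proof (rule finite_Lim_measure_decseq)
    show "range (bad e) \<subseteq> sets M" by auto
    show "decseq (bad e)" unfolding decseq_def bad_def by auto
  qed
  also have "(\<Inter>K. bad e K) = {}"
  proof (rule ccontr)
    assume "(\<Inter>K. bad e K) \<noteq> {}"
    then obtain x where x: "\<And>K. x \<in> bad e K" by auto
    have xs: "x \<in> space M" using x[of 0] by (auto simp: bad_def)
    have "\<exists>\<^sub>F n in sequentially. \<phi> n x / real n < lo x + e"
      by (rule low_rate_frequently[where C=C]) (use bound[OF xs] e in auto)
    then obtain n where n: "n \<ge> 1" "\<phi> n x / real n < lo x + e"
      by (meson frequently_sequentially)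
    have "real n * (lo x + e) < \<phi> n x" using x[of n] n(1) by (auto simp: bad_def)
    then show False using n by (simp add: field_simps)
  qed
  finally show ?thesis by simp
qed

text \<open>Cut the orbit into good blocks of length at most \<open>K\<close>, on which \<open>\<phi>\<close> is almost minimal,
  and single bad points, each of which costs at most \<open>2 * C\<close>.\<close>
lemma block_decomposition:
  assumes e: "e > 0" and "x \<in> space M" "\<And>j. lo ((T ^^ j) x) = l"
  shows "\<phi> n x \<le> real n * (l + e) + 2 * C * (\<Sum>i<n. indicat_real (bad e K) ((T ^^ i) x)) + 2 * C * real K"
  using assms(2,3)
proof (induction n arbitrary: x rule: less_induct)
  case (less n)
  let ?S = "\<lambda>n x. \<Sum>i<n. indicat_real (bad e K) ((T ^^ i) x)"
  have lx: "lo x = l" using less.prems(2)[of 0] by simp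
  have l: "l \<ge> - C" using low_rate_bound[of \<phi> x C] bound[OF less.prems(1)] lx by (simp add: abs_le_iff)
  have S0: "?S n x \<ge> 0" for n by (rule sum_nonneg) auto
  have shift: "lo ((T ^^ j) ((T ^^ m) x)) = l" for j m
    using less.prems(2)[of "j + m"] by (simp add: funpow_add)
  have split: "?S n x = ?S m x + ?S (n - m) ((T ^^ m) x)" if "m \<le> n" for m
  proof -
    have "?S n x = ?S m x + sum (\<lambda>i. indicat_real (bad e K) ((T ^^ i) x)) {m..<n}"
      using that by (simp add: lessThan_atLeast0 sum.atLeastLessThan_concat)
    also have "sum (\<lambda>i. indicat_real (bad e K) ((T ^^ i) x)) {m..<n} = ?S (n - m) ((T ^^ m) x)"
      using that by (intro sum.reindex_bij_witness[of _ "\<lambda>i. i + m" "\<lambda>i. i - m"]) (auto simp flip: funpow_add comp_apply[of "(T ^^ _)"])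
    finally show ?thesis .
  qed
  show ?case
  \<comment> \<open>When at most \<open>K\<close> steps remain, the trivial bounds
    \<open>\<phi> n x \<le> C * n\<close> and \<open>l + e \<ge> - C\<close> differ from each other
    by no more than the boundary term \<open>2 * C * K\<close>. Longer orbits are shortened.\<close>
  proof (cases "n \<le> K")
    case True
    have "\<phi> n x \<le> C * real n" using bound[OF less.prems(1), of n] by simp
    moreover have "real n * (l + e) \<ge> real n * (- C)" using l e by (intro mult_left_mono) auto
    moreover have "C * real n \<le> C * real K" using True C_nonneg by (intro mult_left_mono) auto
    moreover have "2 * C * ?S n x \<ge> 0" using C_nonneg S0 by simp
    ultimately show ?thesis by (simp add: algebra_simps)
  next
    case False
    show ?thesis
    proof (cases "x \<in> bad e K")
      case True
      have n: "n \<ge> 1" using False by simp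
      have "\<phi> n x \<le> \<phi> 1 x + \<phi> (n - 1) (T x)" using subadd[OF less.prems(1), of 1 "n - 1"] n by simp
      also have "\<phi> 1 x \<le> C" using bound[OF less.prems(1), of 1] by simp
      also have "\<phi> (n - 1) (T x) \<le> real (n - 1) * (l + e) + 2 * C * ?S (n - 1) (T x) + 2 * C * real K"
        using less.IH[of "n - 1" "T x"] n T_space[OF less.prems(1)] shift[of _ 1] by simp
      finally have 1: "\<phi> n x \<le> C + (real (n - 1) * (l + e) + 2 * C * ?S (n - 1) (T x) + 2 * C * real K)"
        by simp
      have 2: "?S n x = 1 + ?S (n - 1) (T x)" using split[of 1] n True by simp
      have 3: "real n * (l + e) = real (n - 1) * (l + e) + l + e" using n by (simp add: of_nat_diff algebra_simps)
      show ?thesis unfolding 2 3 using 1 l e by (simp add: distrib_left)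
    next
      case notbad: False
      then obtain N where N: "N \<in> {1..K}" "\<phi> N x \<le> real N * (l + e)"
        using less.prems(1) lx by (auto simp: bad_def not_less)
      then have Nn: "N \<le> n" "n - N < n" using False by auto
      have "\<phi> n x \<le> \<phi> N x + \<phi> (n - N) ((T ^^ N) x)" using subadd[OF less.prems(1), of N "n - N"] Nn by simp
      also have "\<phi> (n - N) ((T ^^ N) x) \<le> real (n - N) * (l + e) + 2 * C * ?S (n - N) ((T ^^ N) x) + 2 * C * real K"
        by (rule less.IH[OF Nn(2) Tn_space[OF less.prems(1)] shift])
      also have "2 * C * ?S (n - N) ((T ^^ N) x) \<le> 2 * C * ?S n x"
        using split[OF Nn(1)] S0[of N] C_nonneg by (intro mult_left_mono) auto
      finally show ?thesis using N Nn by (simp add: of_nat_diff algebra_simps)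
    qed
  qed
qed

lemma integral_indicator_Tn: "(\<integral>x. indicat_real (bad e K) ((T ^^ i) x) \<partial>M) = measure M (bad e K)"
  using integral_Tn[of "indicat_real (bad e K)" i] by simp

lemma integral_phi_le:
  assumes e: "e > 0"
  shows "(\<integral>x. \<phi> n x \<partial>M) \<le> real n * ((\<integral>x. lo x \<partial>M) + e + 2 * C * measure M (bad e K)) + 2 * C * real K"
proof -
  have int: "integrable M (\<lambda>x. \<Sum>i<n. indicat_real (bad e K) ((T ^^ i) x))"
    by (intro Bochner_Integration.integrable_sum integrable_bdd[where B=1]) (auto simp: indicator_def)
  have "(\<integral>x. \<phi> n x \<partial>M) \<le>
    (\<integral>x. real n * (lo x + e) + 2 * C * (\<Sum>i<n. indicat_real (bad e K) ((T ^^ i) x)) + 2 * C * real K \<partial>M)"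
  proof (rule integral_mono_AE)
    show "AE x in M. \<phi> n x \<le> real n * (lo x + e) + 2 * C * (\<Sum>i<n. indicat_real (bad e K) ((T ^^ i) x)) + 2 * C * real K"
      using lo_Tn AE_space
    proof eventually_elim
      case (elim x)
      show ?case by (rule block_decomposition[OF e]) (use elim in auto)
    qed
  qed (use phi_integrable lo_integrable int in auto)
  also have "\<dots> = real n * ((\<integral>x. lo x \<partial>M) + e) + 2 * C * (\<Sum>i<n. measure M (bad e K)) + 2 * C * real K"
  proof -
    have "(\<integral>x. (\<Sum>i<n. indicat_real (bad e K) ((T ^^ i) x)) \<partial>M) = (\<Sum>i<n. \<integral>x. indicat_real (bad e K) ((T ^^ i) x) \<partial>M)"
      by (intro Bochner_Integration.integral_sum integrable_bdd[where B=1]) (auto simp: indicator_def)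
    then have "(\<integral>x. (\<Sum>i<n. indicat_real (bad e K) ((T ^^ i) x)) \<partial>M) = (\<Sum>i<n. measure M (bad e K))"
      by (simp only: integral_indicator_Tn)
    then show ?thesis using int lo_integrable by (simp add: prob_space del: sum_constant)
  qed
  finally show ?thesis by (simp add: algebra_simps)
qed

text \<open>Limits are taken in the order \<open>n\<close>, \<open>K\<close>, slack: after division
  by \<open>n\<close> the boundary term \<open>2 * C * K / n\<close> vanishes, then the measure of
  the bad set, then the slack \<open>d\<close>.\<close>

lemma integral_low_rate_ge:
  assumes "\<And>n. (\<integral>x. \<phi> n x \<partial>M) = real n * I"
  shows "I \<le> (\<integral>x. lo x \<partial>M)"
proof (rule field_le_epsilon)
  fix d :: real assume d: "d > 0"
  have *: "I \<le> (\<integral>x. lo x \<partial>M) + d / 2 + 2 * C * measure M (bad (d / 2) K)" for K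
  proof (rule field_le_epsilon)
    fix r :: real assume r: "r > 0"
    obtain n where n: "real n > 2 * C * real K / r" using reals_Archimedean2 by blast
    have "n > 0" using n C_nonneg r by (cases "n = 0") (auto simp: divide_less_0_iff mult_less_0_iff)
    have "real n * I \<le> real n * ((\<integral>x. lo x \<partial>M) + d / 2 + 2 * C * measure M (bad (d / 2) K)) + 2 * C * real K"
      using integral_phi_le[of "d / 2" n K] d assms by simp
    also have "2 * C * real K \<le> real n * r" using n r by (simp add: field_simps)
    finally have "real n * I \<le> real n * ((\<integral>x. lo x \<partial>M) + d / 2 + 2 * C * measure M (bad (d / 2) K) + r)"
      by (simp add: algebra_simps)
    then show "I \<le> (\<integral>x. lo x \<partial>M) + d / 2 + 2 * C * measure M (bad (d / 2) K) + r"
      using \<open>n > 0\<close> by simp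
  qed
  have "(\<lambda>K. (\<integral>x. lo x \<partial>M) + d / 2 + 2 * C * measure M (bad (d / 2) K)) \<longlonglongrightarrow> (\<integral>x. lo x \<partial>M) + d / 2 + 2 * C * 0"
    by (intro tendsto_intros bad_measure) (use d in auto)
  then have "I \<le> (\<integral>x. lo x \<partial>M) + d / 2 + 2 * C * 0"
    by (rule LIMSEQ_le_const) (use * in auto)
  then show "I \<le> (\<integral>x. lo x \<partial>M) + d" using d by simp
qed

text \<open>Half of the ergodic theorem for an indicator. The negated visit counts form an additive
  cocycle, and minus its lower rate is the limsup of the visit frequencies.\<close>

lemma upper_frequency_le:
  assumes [measurable]: "A \<in> sets M"
  shows "- (\<integral>x. low_rate (\<lambda>n x. - (\<Sum>i<n. indicat_real A ((T ^^ i) x))) x \<partial>M) \<le> measure M A"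
proof -
  interpret ind: bounded_cocycle M T "\<lambda>n x. - (\<Sum>i<n. indicat_real A ((T ^^ i) x))" 1
  proof
    fix m n x
    have "(\<Sum>i<m + n. indicat_real A ((T ^^ i) x)) =
        (\<Sum>i<m. indicat_real A ((T ^^ i) x)) + sum (\<lambda>i. indicat_real A ((T ^^ i) x)) {m..<m + n}"
      by (simp add: lessThan_atLeast0 sum.atLeastLessThan_concat)
    also have "sum (\<lambda>i. indicat_real A ((T ^^ i) x)) {m..<m + n} = (\<Sum>i<n. indicat_real A ((T ^^ i) ((T ^^ m) x)))"
      by (intro sum.reindex_bij_witness[of _ "\<lambda>i. i + m" "\<lambda>i. i - m"]) (auto simp flip: funpow_add comp_apply[of "(T ^^ _)"])
    finally show "- (\<Sum>i<m + n. indicat_real A ((T ^^ i) x)) \<le>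
      - (\<Sum>i<m. indicat_real A ((T ^^ i) x)) + - (\<Sum>i<n. indicat_real A ((T ^^ i) ((T ^^ m) x)))" by simp
  next
    fix n x
    have "\<bar>\<Sum>i<n. indicat_real A ((T ^^ i) x)\<bar> \<le> (\<Sum>i<n. 1)"
      by (rule order_trans[OF sum_abs]) (intro sum_mono, auto simp: indicator_def)
    then show "\<bar>- (\<Sum>i<n. indicat_real A ((T ^^ i) x))\<bar> \<le> 1 * real n" by simp
  qed (use T_inv in auto)
  have "- measure M A \<le> (\<integral>x. low_rate (\<lambda>n x. - (\<Sum>i<n. indicat_real A ((T ^^ i) x))) x \<partial>M)"
  proof (rule ind.integral_low_rate_ge)
    fix n
    have "(\<integral>x. (\<Sum>i<n. indicat_real A ((T ^^ i) x)) \<partial>M) = (\<Sum>i<n. \<integral>x. indicat_real A ((T ^^ i) x) \<partial>M)"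
      by (intro Bochner_Integration.integral_sum integrable_bdd[where B=1]) (auto simp: indicator_def)
    also have "\<dots> = real n * measure M A"
      using integral_Tn[of "indicat_real A"] by simp
    finally show "(\<integral>x. - (\<Sum>i<n. indicat_real A ((T ^^ i) x)) \<partial>M) = real n * (- measure M A)"
      by simp
  qed
  then show ?thesis by simp
qed

text \<open>The block decomposition bounds the limsup at a point by \<open>lo x + e\<close> plus
  \<open>2 * C\<close> times the upper frequency of visits to the bad set. Integrating, letting
  \<open>K\<close> grow and then \<open>e\<close> shrink gives equal integrals of limsup and liminf,
  hence equality almost everywhere.\<close>

theorem AE_converges: "AE x in M. (\<lambda>n. \<phi> n x / real n) \<longlonglongrightarrow> lo x"
proof -
  \<comment> \<open>The facts about \<open>low_rate\<close> ask for a linear bound alone, so they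
    apply to \<open>- \<phi>\<close> as well and describe the limsup.\<close>
  define hi where "hi x = - low_rate (\<lambda>n x. - \<phi> n x) x" for x
  have [measurable]: "hi \<in> borel_measurable M" unfolding hi_def by measurable
  have hib: "\<bar>hi x\<bar> \<le> C" if "x \<in> space M" for x
    unfolding hi_def using low_rate_bound[of "\<lambda>n x. - \<phi> n x" x C] bound[OF that] by simp
  have hi_int: "integrable M hi" by (rule integrable_bdd[where B=C]) (auto simp: hib)
  have ev_lo: "\<forall>\<^sub>F n in sequentially. lo x - e < \<phi> n x / real n" if "x \<in> space M" "e > 0" for x e
    by (rule low_rate_eventually[where C=C]) (use bound that in auto)
  have ev_hi: "\<forall>\<^sub>F n in sequentially. \<phi> n x / real n < hi x + e" if "x \<in> space M" "e > 0" for x e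
  proof -
    have "\<forall>\<^sub>F n in sequentially. low_rate (\<lambda>n x. - \<phi> n x) x - e < - \<phi> n x / real n"
      by (rule low_rate_eventually[where C=C]) (use bound that in auto)
    then show ?thesis by (rule eventually_mono) (simp add: hi_def)
  qed
  have lohi: "lo x \<le> hi x" if "x \<in> space M" for x
  proof (rule field_le_epsilon)
    fix e :: real assume "e > 0"
    then have "\<forall>\<^sub>F n in sequentially. lo x - e/2 < \<phi> n x / real n \<and> \<phi> n x / real n < hi x + e/2"
      using ev_lo[OF that, of "e/2"] ev_hi[OF that, of "e/2"] by (simp add: eventually_conj)
    then obtain n where "lo x - e/2 < \<phi> n x / real n \<and> \<phi> n x / real n < hi x + e/2"
      using eventually_happens'[OF sequentially_bot] by blast
    then show "lo x \<le> hi x + e" by linarith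
  qed
  have key: "(\<integral>x. hi x \<partial>M) - (\<integral>x. lo x \<partial>M) \<le> e + 2 * C * measure M (bad e K)" if e: "e > 0" for e K
  proof -
    define fr where "fr x = - low_rate (\<lambda>n x. - (\<Sum>i<n. indicat_real (bad e K) ((T ^^ i) x))) x" for x
    have fr_int: "integrable M fr"
    proof (rule integrable_bdd[where B=1])
      fix x
      have "\<bar>\<Sum>i<n. indicat_real (bad e K) ((T ^^ i) x)\<bar> \<le> (\<Sum>i<n. 1)" for n
        by (rule order_trans[OF sum_abs]) (intro sum_mono, auto simp: indicator_def)
      then show "\<bar>fr x\<bar> \<le> 1" unfolding fr_def abs_minus_cancel
        by (intro low_rate_bound) simp
    qed (unfold fr_def, measurable)
    have "AE x in M. hi x \<le> lo x + e + 2 * C * fr x"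
      using lo_Tn AE_space
    proof eventually_elim
      case (elim x)
      let ?S = "\<lambda>n. \<Sum>i<n. indicat_real (bad e K) ((T ^^ i) x)"
      have Sb: "\<bar>?S n\<bar> \<le> 1 * real n" for n
        by (rule order_trans[OF sum_abs]) (rule order_trans[OF sum_mono[where g="\<lambda>_. 1"]], auto simp: indicator_def)
      have "- (lo x + e + 2 * C * fr x) \<le> low_rate (\<lambda>n x. - \<phi> n x) x"
      proof (rule low_rate_ge[where C=C])
        show "\<bar>- \<phi> n x\<bar> \<le> C * real n" for n using bound elim by simp
        fix d :: real assume d: "d > 0"
        \<comment> \<open>Chosen so that \<open>2 * C * d' \<le> d / 2\<close>; the added 1 keeps
          the denominator positive when \<open>C = 0\<close>.\<close>
        define d' where "d' = d / (2 * (2 * C + 1))"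
        have d': "d' > 0" using d C_nonneg by (simp add: d'_def)
        have "\<forall>\<^sub>F n in sequentially. low_rate (\<lambda>n x. - (\<Sum>i<n. indicat_real (bad e K) ((T ^^ i) x))) x - d' < - ?S n / real n"
          by (rule low_rate_eventually[where C=1]) (use Sb d' in auto)
        moreover obtain N :: nat where N: "real N > 2 * C * real K / (d / 2)" using reals_Archimedean2 by blast
        have "\<forall>\<^sub>F n in sequentially. n \<ge> Suc N" by (rule eventually_ge_at_top)
        ultimately show "\<forall>\<^sub>F n in sequentially. - (lo x + e + 2 * C * fr x) - d \<le> - \<phi> n x / real n"
        proof eventually_elim
          case (elim n)
          have n: "n > 0" "real n > 2 * C * real K / (d / 2)" using elim(2) N by linarith+
          have "?S n / real n \<le> fr x + d'" using elim(1) by (simp add: fr_def)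
          then have "2 * C * (?S n / real n) \<le> 2 * C * (fr x + d')" using C_nonneg by (intro mult_left_mono) auto
          also have "2 * C * (fr x + d') \<le> 2 * C * fr x + d / 2"
          proof -
            have "2 * C * d' \<le> (2 * C + 1) * d'" using d' by simp
            also have "\<dots> = d / 2" using C_nonneg by (simp add: d'_def divide_simps)
            finally show ?thesis by (simp add: algebra_simps)
          qed
          finally have 1: "2 * C * (?S n / real n) \<le> 2 * C * fr x + d / 2" .
          have 2: "2 * C * real K / real n \<le> d / 2" using n d by (simp add: field_simps)
          have "\<phi> n x \<le> real n * (lo x + e) + 2 * C * ?S n + 2 * C * real K"
            by (rule block_decomposition[OF e]) (use \<open>x \<in> space M\<close> \<open>\<forall>n. lo ((T ^^ n) x) = lo x\<close> in auto)
          then have "\<phi> n x / real n \<le> lo x + e + 2 * C * (?S n / real n) + 2 * C * real K / real n"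
            using n by (simp add: field_simps)
          with 1 2 show ?case by simp
        qed
      qed
      then show ?case by (simp add: hi_def)
    qed
    then have "(\<integral>x. hi x \<partial>M) \<le> (\<integral>x. lo x + e + 2 * C * fr x \<partial>M)"
      by (intro integral_mono_AE) (use hi_int lo_integrable fr_int in auto)
    also have "\<dots> = (\<integral>x. lo x \<partial>M) + e + 2 * C * (\<integral>x. fr x \<partial>M)"
      using lo_integrable fr_int by (simp add: prob_space)
    also have "(\<integral>x. fr x \<partial>M) \<le> measure M (bad e K)"
      using upper_frequency_le[of "bad e K"] by (simp add: fr_def)
    finally show ?thesis using C_nonneg by (simp add: mult_left_mono)
  qed
  have "(\<integral>x. hi x \<partial>M) - (\<integral>x. lo x \<partial>M) \<le> 0"
  proof (rule field_le_epsilon)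
    fix e :: real assume e: "e > 0"
    have "(\<lambda>K. e + 2 * C * measure M (bad e K)) \<longlonglongrightarrow> e + 2 * C * 0"
      by (intro tendsto_intros bad_measure e)
    then have "(\<integral>x. hi x \<partial>M) - (\<integral>x. lo x \<partial>M) \<le> e + 2 * C * 0"
      by (rule LIMSEQ_le_const) (use key[OF e] in auto)
    then show "(\<integral>x. hi x \<partial>M) - (\<integral>x. lo x \<partial>M) \<le> 0 + e" by simp
  qed
  moreover have "(\<integral>x. hi x - lo x \<partial>M) = (\<integral>x. hi x \<partial>M) - (\<integral>x. lo x \<partial>M)"
    using hi_int lo_integrable by simp
  moreover have "(\<integral>x. hi x - lo x \<partial>M) \<ge> 0" by (rule integral_nonneg_AE) (auto simp: lohi)
  ultimately have "(\<integral>x. hi x - lo x \<partial>M) = 0" by simp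
  then have "AE x in M. hi x - lo x = 0"
    by (subst (asm) integral_nonneg_eq_0_iff_AE) (auto simp: hi_int lo_integrable lohi intro!: AE_I2)
  then show ?thesis using AE_space
  proof eventually_elim
    case (elim x)
    show ?case
    proof (rule order_tendstoI)
      fix a assume "a < lo x"
      then show "\<forall>\<^sub>F n in sequentially. a < \<phi> n x / real n" using ev_lo[of x "lo x - a"] elim by simp
    next
      fix a assume "lo x < a"
      then show "\<forall>\<^sub>F n in sequentially. \<phi> n x / real n < a" using ev_hi[of x "a - lo x"] elim by simp
    qed
  qed
qed

end

section \<open>Differentiable maps of the sphere\<close>

text \<open>The uniform distance together with the Lipschitz seminorm of the difference. All later
  estimates concern pairs of points, so the closeness of a perturbation enters them only through
  this notion, which also satisfies a triangle inequality.\<close>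

definition lip_close :: "real \<Rightarrow> ('a::euclidean_space \<Rightarrow> 'a) \<Rightarrow> ('a \<Rightarrow> 'a) \<Rightarrow> bool" where
  "lip_close e f g \<longleftrightarrow> (\<forall>x\<in>Sph. norm (f x - g x) \<le> e \<and>
     (\<forall>y\<in>Sph. norm ((f x - g x) - (f y - g y)) \<le> e * norm (x - y)))"

text \<open>A pointwise form of \<open>C1_near\<close>, with no neighbourhood to carry along. This
  makes compositions easy, since the maps involved preserve the sphere.\<close>

definition C1_on_Sph :: "('a::euclidean_space \<Rightarrow> 'a) \<Rightarrow> ('a \<Rightarrow> 'a \<Rightarrow>\<^sub>L 'a) \<Rightarrow> bool" where
  "C1_on_Sph f f' \<longleftrightarrow> continuous_on Sph f' \<and> (\<forall>x\<in>Sph. (f has_derivative blinfun_apply (f' x)) (at x))"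

lemma C1_near_imp_C1_on_Sph: "C1_near Sph f \<Longrightarrow> \<exists>f'. C1_on_Sph f f'"
  unfolding C1_near_def C1_on_Sph_def by (meson continuous_on_subset subsetD)

lemma C1_on_Sph_frechet: "C1_on_Sph f f' \<Longrightarrow> x \<in> Sph \<Longrightarrow> frechet_derivative f (at x) = blinfun_apply (f' x)"
  unfolding C1_on_Sph_def by (metis frechet_derivative_at)

lemma C1_on_Sph_continuous: "C1_on_Sph f f' \<Longrightarrow> continuous_on Sph f"
  unfolding C1_on_Sph_def
  by (meson continuous_at_imp_continuous_on has_derivative_continuous)

lemma C1_on_Sph_compose:
  assumes "C1_on_Sph f f'" "C1_on_Sph g g'" "f ` Sph \<subseteq> Sph"
  shows "C1_on_Sph (g \<circ> f) (\<lambda>x. g' (f x) o\<^sub>L f' x)"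
  unfolding C1_on_Sph_def
proof (intro conjI ballI)
  have "continuous_on Sph (\<lambda>x. g' (f x))"
    by (rule continuous_on_compose2[of Sph g' Sph f]) (use assms C1_on_Sph_continuous in \<open>auto simp: C1_on_Sph_def\<close>)
  then show "continuous_on Sph (\<lambda>x. g' (f x) o\<^sub>L f' x)"
    using assms(1) unfolding C1_on_Sph_def
    by (intro bounded_bilinear.continuous_on[OF bounded_bilinear_blinfun_compose]) auto
  fix x :: 'a assume x: "x \<in> Sph"
  have "((g \<circ> f) has_derivative (blinfun_apply (g' (f x)) \<circ> blinfun_apply (f' x))) (at x)"
    by (rule diff_chain_at) (use assms x in \<open>unfold C1_on_Sph_def, blast+\<close>)
  moreover have "blinfun_apply (g' (f x) o\<^sub>L f' x) = blinfun_apply (g' (f x)) \<circ> blinfun_apply (f' x)"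
    by (auto simp: fun_eq_iff)
  ultimately show "((g \<circ> f) has_derivative blinfun_apply (g' (f x) o\<^sub>L f' x)) (at x)" by simp
qed

lemma C1_on_Sph_id: "C1_on_Sph id (\<lambda>_. id_blinfun)"
  unfolding C1_on_Sph_def by (auto simp: id_def id_blinfun.rep_eq)

lemma sphere_diffeoD:
  assumes "sphere_diffeo f"
  shows "f ` Sph = Sph" "\<exists>f'. C1_on_Sph f f'" "x \<in> Sph \<Longrightarrow> f x \<in> Sph"
    "continuous_on Sph f" "C1_near Sph f"
  using assms C1_near_imp_C1_on_Sph C1_on_Sph_continuous unfolding sphere_diffeo_def by blast+

text \<open>For a unit vector \<open>x\<close> this is the orthogonal projection onto the tangent
  space at \<open>x\<close>. It turns \<open>tangent_opnorm\<close>, a supremum over a set that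
  varies with \<open>x\<close>, into an ordinary operator norm, whose continuity in \<open>x\<close>
  is accessible.\<close>

definition tproj :: "'a::euclidean_space \<Rightarrow> 'a \<Rightarrow>\<^sub>L 'a" where
  "tproj x = Blinfun (\<lambda>v. v - inner v x *\<^sub>R x)"

lemma tproj_apply: "blinfun_apply (tproj x) v = v - inner v x *\<^sub>R x"
  unfolding tproj_def
  by (subst bounded_linear_Blinfun_apply) (auto intro!: bounded_linear_intros)

lemma tproj_tangent: "norm x = 1 \<Longrightarrow> inner (blinfun_apply (tproj x) v) x = 0"
  by (simp add: tproj_apply inner_diff_left dot_square_norm)

lemma norm_tproj_le:
  assumes "norm x = 1" shows "norm (blinfun_apply (tproj x) v) \<le> norm v"
proof -
  have "(norm (blinfun_apply (tproj x) v))\<^sup>2 = (norm v)\<^sup>2 - (inner v x)\<^sup>2"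
    using assms unfolding power2_norm_eq_inner norm_eq_1
    by (simp add: tproj_apply inner_diff_left inner_diff_right inner_commute[of x v] power2_eq_square)
  then have "(norm (blinfun_apply (tproj x) v))\<^sup>2 \<le> (norm v)\<^sup>2" by simp
  then show ?thesis by (rule power2_le_imp_le) simp
qed

lemma continuous_tproj: "continuous_on S tproj"
  by (rule continuous_on_blinfun_componentwise) (auto simp: tproj_apply intro!: continuous_intros)

lemma exists_unit_tangent:
  fixes x :: "'a::euclidean_space"
  assumes "DIM('a) \<ge> 2"
  obtains v where "inner v x = 0" "norm v = 1"
proof -
  have "dim {x} < DIM('a)" using dim_le_card'[of "{x}"] assms by simp
  then obtain w where w: "w \<noteq> 0" "\<And>y. y \<in> span {x} \<Longrightarrow> orthogonal w y"
    using orthogonal_to_subspace_exists[of "{x}"] by blast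
  then have "inner w x = 0" by (simp add: span_base orthogonal_def)
  then show ?thesis using that[of "w /\<^sub>R norm w"] w by simp
qed

lemma tangent_opnorm_upper:
  assumes "bounded_linear L" "inner v x = 0" "norm v = 1"
  shows "norm (L v) \<le> tangent_opnorm L x"
  unfolding tangent_opnorm_def
proof (rule cSup_upper)
  show "bdd_above ((\<lambda>v. norm (L v)) ` {v. inner v x = 0 \<and> norm v = 1})"
    using onorm[OF assms(1)] by (intro bdd_aboveI[of _ "onorm L"]) (auto, metis mult.right_neutral)
qed (use assms in auto)

lemma tangent_opnorm_upper':
  assumes "bounded_linear L" "inner v x = 0"
  shows "norm (L v) \<le> tangent_opnorm L x * norm v"
proof (cases "v = 0")
  case False
  interpret bounded_linear L by fact
  have "norm (L (v /\<^sub>R norm v)) \<le> tangent_opnorm L x"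
    by (rule tangent_opnorm_upper) (use assms False in auto)
  then show ?thesis using False by (simp add: scaleR field_simps)
qed (use assms in \<open>simp add: linear_simps\<close>)

lemma tangent_opnorm_least:
  fixes x :: "'a::euclidean_space"
  assumes "DIM('a) \<ge> 2" and "\<And>v. inner v x = 0 \<Longrightarrow> norm v = 1 \<Longrightarrow> norm (L v) \<le> B"
  shows "tangent_opnorm L x \<le> B"
  unfolding tangent_opnorm_def
proof (rule cSup_least)
  obtain v where "inner v x = 0" "norm v = 1" using exists_unit_tangent[OF assms(1)] .
  then show "(\<lambda>v. norm (L v)) ` {v. inner v x = 0 \<and> norm v = 1} \<noteq> {}" by auto
qed (use assms in auto)

lemma tangent_opnorm_nonneg:
  fixes x :: "'a::euclidean_space"
  assumes "DIM('a) \<ge> 2" and "bounded_linear L"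
  shows "0 \<le> tangent_opnorm L x"
proof -
  obtain v where "inner v x = 0" "norm v = 1" using exists_unit_tangent[OF assms(1)] .
  from tangent_opnorm_upper[OF assms(2) this] norm_ge_zero[of "L v"] show ?thesis by linarith
qed

text \<open>The projection fixes tangent vectors and does not increase norms, so composing with it
  neither loses nor adds anything to the restriction of \<open>L\<close> to the tangent
  space.\<close>

lemma tangent_opnorm_eq_norm:
  fixes x :: "'a::euclidean_space" and L :: "'a \<Rightarrow>\<^sub>L 'a"
  assumes "DIM('a) \<ge> 2" "norm x = 1"
  shows "tangent_opnorm (blinfun_apply L) x = norm (L o\<^sub>L tproj x)"
proof (rule antisym)
  show "tangent_opnorm (blinfun_apply L) x \<le> norm (L o\<^sub>L tproj x)"
  proof (rule tangent_opnorm_least[OF assms(1)])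
    fix v assume v: "inner v x = 0" "norm v = 1"
    then show "norm (blinfun_apply L v) \<le> norm (L o\<^sub>L tproj x)"
      using norm_blinfun[of "L o\<^sub>L tproj x" v] by (simp add: tproj_apply)
  qed
  show "norm (L o\<^sub>L tproj x) \<le> tangent_opnorm (blinfun_apply L) x"
  proof (rule norm_blinfun_bound)
    have bl: "bounded_linear (blinfun_apply L)" by (rule blinfun.bounded_linear_right)
    show 0: "0 \<le> tangent_opnorm (blinfun_apply L) x" by (rule tangent_opnorm_nonneg[OF assms(1) bl])
    fix v
    have "norm (blinfun_apply L (blinfun_apply (tproj x) v)) \<le> tangent_opnorm (blinfun_apply L) x * norm (blinfun_apply (tproj x) v)"
      by (rule tangent_opnorm_upper'[OF bl tproj_tangent[OF assms(2)]])
    also have "\<dots> \<le> tangent_opnorm (blinfun_apply L) x * norm v"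
      by (intro mult_left_mono norm_tproj_le 0 assms)
    finally show "norm (blinfun_apply (L o\<^sub>L tproj x) v) \<le> tangent_opnorm (blinfun_apply L) x * norm v" by simp
  qed
qed

lemma continuous_tangent_opnorm:
  fixes f :: "'a::euclidean_space \<Rightarrow> 'a"
  assumes "DIM('a) \<ge> 2" "C1_on_Sph f f'"
  shows "continuous_on Sph (\<lambda>x. tangent_opnorm (frechet_derivative f (at x)) x)"
proof -
  have "continuous_on Sph (\<lambda>x. norm (f' x o\<^sub>L tproj x))"
    using assms(2) unfolding C1_on_Sph_def
    by (intro continuous_on_norm bounded_bilinear.continuous_on[OF bounded_bilinear_blinfun_compose] continuous_tproj) auto
  moreover have "norm (f' x o\<^sub>L tproj x) = tangent_opnorm (frechet_derivative f (at x)) x" if "x \<in> Sph" for x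
    using that assms by (simp add: C1_on_Sph_frechet[OF assms(2)] tangent_opnorm_eq_norm)
  ultimately show ?thesis by (rule continuous_on_eq)
qed

text \<open>The point is that both suprema in \<open>c1_dist\<close> run over bounded sets, by
  continuity on the compact sphere; an unbounded real supremum would carry no information. Each
  summand lies below the sum because the other is nonnegative.\<close>

lemma c1_dist_bounds:
  fixes f g :: "'a::euclidean_space \<Rightarrow> 'a"
  assumes dim: "DIM('a) \<ge> 2" and f: "C1_on_Sph f f'" and g: "C1_on_Sph g g'" and x: "x \<in> Sph"
  shows "norm (f x - g x) \<le> c1_dist f g"
    and "\<lbrakk>inner v x = 0; norm v = 1\<rbrakk> \<Longrightarrow> norm (blinfun_apply (f' x) v - blinfun_apply (g' x) v) \<le> c1_dist f g"
proof -
  let ?A = "\<lambda>x. norm (f x - g x)"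
  let ?B = "\<lambda>x. tangent_opnorm (\<lambda>v. frechet_derivative f (at x) v - frechet_derivative g (at x) v) x"
  have ne: "(Sph :: 'a set) \<noteq> {}" using x by auto
  have "compact (?A ` Sph)"
    by (intro compact_continuous_image continuous_intros C1_on_Sph_continuous[OF f] C1_on_Sph_continuous[OF g]) auto
  then have bA: "bdd_above (?A ` Sph)" by (rule bounded_imp_bdd_above[OF compact_imp_bounded])
  have Beq: "?B x = norm ((f' x - g' x) o\<^sub>L tproj x)" if "x \<in> Sph" for x
  proof -
    have "(\<lambda>v. frechet_derivative f (at x) v - frechet_derivative g (at x) v) = blinfun_apply (f' x - g' x)"
      by (simp add: C1_on_Sph_frechet[OF f that] C1_on_Sph_frechet[OF g that] blinfun.diff_left fun_eq_iff)
    then show ?thesis using that by (simp add: tangent_opnorm_eq_norm[OF dim])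
  qed
  have "compact ((\<lambda>x. norm ((f' x - g' x) o\<^sub>L tproj x)) ` Sph)"
    using f g unfolding C1_on_Sph_def
    by (intro compact_continuous_image continuous_on_norm bounded_bilinear.continuous_on[OF bounded_bilinear_blinfun_compose]
        continuous_tproj continuous_on_diff) auto
  then have "bdd_above ((\<lambda>x. norm ((f' x - g' x) o\<^sub>L tproj x)) ` Sph)"
    by (rule bounded_imp_bdd_above[OF compact_imp_bounded])
  moreover have "(\<lambda>x. norm ((f' x - g' x) o\<^sub>L tproj x)) ` Sph = ?B ` Sph" using Beq by (intro image_cong) auto
  ultimately have bB: "bdd_above (?B ` Sph)" by simp
  have A: "?A x \<le> (SUP x\<in>Sph. ?A x)" by (rule cSUP_upper[OF x bA])
  have B: "?B x \<le> (SUP x\<in>Sph. ?B x)" by (rule cSUP_upper[OF x bB])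
  have B0: "0 \<le> ?B x" using Beq[OF x] by simp
  show "norm (f x - g x) \<le> c1_dist f g" unfolding c1_dist_def using A B B0 by linarith
  assume v: "inner v x = 0" "norm v = 1"
  have "norm (blinfun_apply (f' x - g' x) v) \<le> tangent_opnorm (blinfun_apply (f' x - g' x)) x"
    by (rule tangent_opnorm_upper) (auto intro: v blinfun.bounded_linear_right)
  also have "\<dots> = ?B x" using x by (simp add: Beq tangent_opnorm_eq_norm[OF dim])
  finally have "norm (blinfun_apply (f' x - g' x) v) \<le> ?B x" .
  moreover have "?A x \<ge> 0" by simp
  ultimately have "norm (blinfun_apply (f' x - g' x) v) \<le> c1_dist f g"
    unfolding c1_dist_def using A B by linarith
  then show "norm (blinfun_apply (f' x) v - blinfun_apply (g' x) v) \<le> c1_dist f g"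
    by (simp add: blinfun.diff_left)
qed

text \<open>Close points are joined by the curve \<open>t \<mapsto> sqrt (1 - t\<^sup>2) x + t v\<close> on the sphere, far points are
  handled by the uniform bound.\<close>
lemma tangential_bound_imp_Lipschitz:
  fixes u :: "'a::euclidean_space \<Rightarrow> 'a"
  assumes u: "C1_on_Sph u u'" and b0: "\<And>x. x \<in> Sph \<Longrightarrow> norm (u x) \<le> d"
    and b1: "\<And>x v. \<lbrakk>x \<in> Sph; inner v x = 0; norm v = 1\<rbrakk> \<Longrightarrow> norm (blinfun_apply (u' x) v) \<le> d"
    and x: "x \<in> Sph" and y: "y \<in> Sph"
  shows "norm (u x - u y) \<le> 2 * d * norm (x - y)"
proof -
  have d0: "0 \<le> d" using b0[OF x] norm_ge_zero order_trans by blast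
  consider "x = y" | "norm (x - y) \<ge> 1" | "x \<noteq> y" "norm (x - y) < 1" by linarith
  then show ?thesis
  proof cases
    case 2
    have "norm (u x - u y) \<le> d + d" using norm_triangle_ineq4[of "u x" "u y"] b0[OF x] b0[OF y] by linarith
    also have "\<dots> \<le> 2 * d * norm (x - y)" using 2 d0 mult_left_mono[of 1 "norm (x - y)" "2 * d"] by simp
    finally show ?thesis .
  next
    case 3
    have nx: "inner x x = 1" "inner y y = 1" using x y by (auto simp: dot_square_norm)
    define c where "c = inner x y"
    have nxy: "(norm (x - y))\<^sup>2 = 2 - 2 * c"
      unfolding power2_norm_eq_inner by (simp add: inner_diff_left inner_diff_right nx c_def inner_commute)
    have "(norm (x - y))\<^sup>2 < 1" using 3 by (simp add: abs_square_less_1)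
    then have c: "c > 1 / 2" using nxy by simp
    have c1: "c < 1" using nxy 3(1) by (smt (verit) zero_less_power2 norm_eq_zero right_minus_eq)
    define w where "w = y - c *\<^sub>R x"
    define s where "s = norm w"
    have s2: "s\<^sup>2 = 1 - c\<^sup>2"
      unfolding s_def power2_norm_eq_inner w_def
      by (simp add: inner_diff_left inner_diff_right nx c_def[symmetric] inner_commute[of y x] power2_eq_square)
    have "c\<^sup>2 < 1" using c c1 by (simp add: abs_square_less_1)
    then have s0: "s > 0" using s2 s_def by (smt (verit) norm_ge_zero power_zero_numeral)
    \<comment> \<open>As \<open>s\<^sup>2 \<le> 3 / 4\<close>, the quantity
      \<open>1 - t\<^sup>2\<close> is at least \<open>1 / 4\<close> along the curve and the speed
      \<open>1 / sqrt (1 - t\<^sup>2)\<close> at most 2. This is the factor 2 of the claim.\<close>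
    have "c\<^sup>2 \<ge> 1 / 4" using power_mono[of "1/2" c 2] c by (simp add: power2_eq_square)
    then have s34: "s\<^sup>2 \<le> 3 / 4" using s2 by simp
    have s_le: "s \<le> norm (x - y)"
    proof (rule power2_le_imp_le)
      have "(1 - c) * (1 + c) \<le> (1 - c) * 2" using c1 by (intro mult_left_mono) auto
      then show "s\<^sup>2 \<le> (norm (x - y))\<^sup>2" unfolding s2 nxy by (simp add: algebra_simps power2_eq_square)
    qed simp
    define v where "v = w /\<^sub>R s"
    have nv: "norm v = 1" using s0 by (simp add: v_def s_def)
    have vx: "inner v x = 0" by (simp add: v_def w_def inner_diff_left c_def inner_commute[of y x] nx)
    have vv: "inner v v = 1" using nv by (simp add: dot_square_norm)
    define \<gamma> where "\<gamma> t = sqrt (1 - t\<^sup>2) *\<^sub>R x + t *\<^sub>R v" for t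
    have t34: "t\<^sup>2 \<le> 3 / 4" if "0 \<le> t" "t \<le> s" for t using power_mono[of t s 2] that s34 by linarith
    have \<gamma>S: "\<gamma> t \<in> Sph" if "0 \<le> t" "t \<le> s" for t
    proof -
      have "inner (\<gamma> t) (\<gamma> t) = (sqrt (1 - t\<^sup>2))\<^sup>2 + t\<^sup>2"
        using vx by (simp add: \<gamma>_def inner_add_left inner_add_right nx vv inner_commute[of x v] power2_eq_square)
      also have "\<dots> = 1" using t34[OF that] by simp
      finally show ?thesis by (simp add: norm_eq_1)
    qed
    have \<gamma>0: "\<gamma> 0 = x" by (simp add: \<gamma>_def)
    have "1 - s\<^sup>2 = c\<^sup>2" using s2 by simp
    then have "sqrt (1 - s\<^sup>2) = c" using c by simp
    then have \<gamma>s: "\<gamma> s = y" using s0 by (simp add: \<gamma>_def v_def w_def)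
    have "norm (u (\<gamma> s) - u (\<gamma> 0)) \<le> 2 * d * s - 2 * d * 0"
    proof (rule differentiable_bound_general[where f="\<lambda>t. u (\<gamma> t)" and \<phi>="\<lambda>t. 2 * d * t"])
      show "0 < s" by fact
      have "continuous_on {0..s} \<gamma>" unfolding \<gamma>_def by (intro continuous_intros)
      then show "continuous_on {0..s} (\<lambda>t. u (\<gamma> t))"
        by (rule continuous_on_compose2[OF C1_on_Sph_continuous[OF u]]) (use \<gamma>S in auto)
      show "continuous_on {0..s} (\<lambda>t. 2 * d * t)" by (intro continuous_intros)
      fix t assume t: "0 < t" "t < s"
      define q where "q = sqrt (1 - t\<^sup>2)"
      have q2: "q\<^sup>2 = 1 - t\<^sup>2" and q0: "q > 0" using t34[of t] t by (auto simp: q_def)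
      define r where "r = - t / q"
      define \<gamma>' where "\<gamma>' = r *\<^sub>R x + v"
      have "((\<lambda>t. 1 - t\<^sup>2) has_real_derivative (- 2 * t)) (at t)" by (auto intro!: derivative_eq_intros)
      then have "((\<lambda>t. sqrt (1 - t\<^sup>2)) has_real_derivative (inverse (sqrt (1 - t\<^sup>2)) / 2 * (- 2 * t))) (at t)"
        by (rule DERIV_chain2[OF DERIV_real_sqrt, rotated]) (use q2 q0 in \<open>metis zero_less_power\<close>)
      moreover have "inverse (sqrt (1 - t\<^sup>2)) / 2 * (- 2 * t) = r" 
        unfolding r_def q_def[symmetric] using q0 by (simp add: field_simps)
      ultimately have dq: "((\<lambda>t. sqrt (1 - t\<^sup>2)) has_real_derivative r) (at t)" by simp
      have "(\<gamma> has_vector_derivative (q *\<^sub>R 0 + r *\<^sub>R x) + (t *\<^sub>R 0 + 1 *\<^sub>R v)) (at t)"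
        unfolding \<gamma>_def q_def
        by (rule has_vector_derivative_add[OF has_vector_derivative_scaleR[OF dq has_vector_derivative_const]
             has_vector_derivative_scaleR[OF DERIV_ident has_vector_derivative_const]])
      then have "(\<gamma> has_vector_derivative \<gamma>') (at t)" by (simp add: \<gamma>'_def)
      then have "((\<lambda>t. u (\<gamma> t)) has_vector_derivative blinfun_apply (u' (\<gamma> t)) \<gamma>') (at t)"
        using u \<gamma>S[of t] t
        by (intro vector_derivative_diff_chain_within[of \<gamma> \<gamma>' t UNIV u, unfolded comp_def])
          (simp_all add: C1_on_Sph_def has_derivative_at_withinI)
      then show "((\<lambda>t. u (\<gamma> t)) has_vector_derivative blinfun_apply (u' (\<gamma> t)) \<gamma>') (at t)" .
      show "((\<lambda>t. 2 * d * t) has_vector_derivative (2 * d)) (at t)"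
        by (auto intro!: derivative_eq_intros simp flip: has_real_derivative_iff_has_vector_derivative)
      have "inner \<gamma>' (\<gamma> t) = r * q + t"
        using vx by (simp add: \<gamma>'_def \<gamma>_def q_def[symmetric] inner_add_left inner_add_right nx vv inner_commute[of x v])
      then have orth: "inner \<gamma>' (\<gamma> t) = 0" using q0 by (simp add: r_def)
      have n2: "(norm \<gamma>')\<^sup>2 = 1 / q\<^sup>2"
      proof -
        have "(norm \<gamma>')\<^sup>2 = r\<^sup>2 + 1" unfolding power2_norm_eq_inner
          using vx by (simp add: \<gamma>'_def inner_add_left inner_add_right nx vv inner_commute[of x v] power2_eq_square)
        also have "\<dots> = (t\<^sup>2 + q\<^sup>2) / q\<^sup>2" using q0 by (simp add: r_def field_simps power2_eq_square)
        finally show ?thesis using q2 by simp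
      qed
      have "q\<^sup>2 \<ge> 1 / 4" using q2 t34[of t] t by simp
      then have "(norm \<gamma>')\<^sup>2 \<le> 2\<^sup>2" unfolding n2 using q0 by (simp add: divide_le_eq)
      then have n: "norm \<gamma>' \<le> 2" by (rule power2_le_imp_le) simp
      have "(norm \<gamma>')\<^sup>2 > 0" unfolding n2 using q0 by simp
      then have n0: "norm \<gamma>' > 0" by auto
      have "norm (blinfun_apply (u' (\<gamma> t)) (\<gamma>' /\<^sub>R norm \<gamma>')) \<le> d"
        by (rule b1) (use \<gamma>S[of t] t orth n0 in auto)
      then have "norm (blinfun_apply (u' (\<gamma> t)) \<gamma>') \<le> d * norm \<gamma>'"
        using n0 by (simp add: blinfun.scaleR_right field_simps)
      also have "\<dots> \<le> d * 2" using n d0 by (intro mult_left_mono)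
      finally show "norm (blinfun_apply (u' (\<gamma> t)) \<gamma>') \<le> 2 * d" by simp
    qed
    then have "norm (u y - u x) \<le> 2 * d * s" by (simp add: \<gamma>0 \<gamma>s)
    also have "\<dots> \<le> 2 * d * norm (x - y)" using s_le d0 by (intro mult_left_mono) auto
    finally show ?thesis by (simp add: norm_minus_commute)
  qed simp
qed

text \<open>\<open>tangential_bound_imp_Lipschitz\<close> is applied to the difference of the two
  maps, which need not take values in the sphere.\<close>

lemma c1_dist_lip_close:
  fixes f g :: "'a::euclidean_space \<Rightarrow> 'a"
  assumes dim: "DIM('a) \<ge> 2" and "C1_near Sph f" "C1_near Sph g" and e: "c1_dist f g < e"
  shows "lip_close (2 * e) f g"
proof -
  obtain f' g' where f: "C1_on_Sph f f'" and g: "C1_on_Sph g g'"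
    using assms C1_near_imp_C1_on_Sph by blast
  have u: "C1_on_Sph (\<lambda>x. f x - g x) (\<lambda>x. f' x - g' x)"
    using f g unfolding C1_on_Sph_def
    by (auto intro!: continuous_intros has_derivative_diff simp: blinfun.diff_left[abs_def])
  have "norm (f x - g x) \<le> 2 * e" if "x \<in> Sph" for x
    using c1_dist_bounds(1)[OF dim f g that] e norm_ge_zero[of "f x - g x"] by linarith
  moreover have "norm ((f x - g x) - (f y - g y)) \<le> 2 * e * norm (x - y)" if "x \<in> Sph" "y \<in> Sph" for x y
  proof (rule tangential_bound_imp_Lipschitz[OF u _ _ that])
    fix x :: 'a assume x: "x \<in> Sph"
    show "norm (f x - g x) \<le> e" using c1_dist_bounds(1)[OF dim f g x] e by linarith
    fix v :: 'a assume "inner v x = 0" "norm v = 1"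
    from c1_dist_bounds(2)[OF dim f g x this] e
    show "norm (blinfun_apply (f' x - g' x) v) \<le> e" by (simp add: blinfun.diff_left)
  qed
  ultimately show ?thesis unfolding lip_close_def by blast
qed

lemma lip_close_refl: "lip_close 0 f f"
  by (simp add: lip_close_def)

lemma lip_close_mono: "lip_close d f g \<Longrightarrow> d \<le> e \<Longrightarrow> lip_close e f g"
  unfolding lip_close_def by (meson mult_right_mono norm_ge_zero order_trans)

lemma lip_close_trans:
  assumes "lip_close d f g" "lip_close e g h"
  shows "lip_close (d + e) f h"
  unfolding lip_close_def
proof (intro ballI conjI)
  fix x :: 'a assume x: "x \<in> Sph"
  show "norm (f x - h x) \<le> d + e"
    using norm_triangle_ineq[of "f x - g x" "g x - h x"] assms x unfolding lip_close_def
    by (smt (verit) diff_add_cancel add_diff_eq)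
  fix y :: 'a assume y: "y \<in> Sph"
  have "norm ((f x - h x) - (f y - h y)) =
      norm (((f x - g x) - (f y - g y)) + ((g x - h x) - (g y - h y)))" by (simp add: algebra_simps)
  also have "\<dots> \<le> norm ((f x - g x) - (f y - g y)) + norm ((g x - h x) - (g y - h y))"
    by (rule norm_triangle_ineq)
  also have "\<dots> \<le> d * norm (x - y) + e * norm (x - y)"
    using assms x y unfolding lip_close_def by (intro add_mono) auto
  finally show "norm ((f x - h x) - (f y - h y)) \<le> (d + e) * norm (x - y)" by (simp add: algebra_simps)
qed

text \<open>For orthonormal \<open>x\<close> and \<open>v\<close> this is the great circle through
  \<open>x\<close> with velocity \<open>v\<close>. As it stays on the sphere, estimates known only
  there pass to derivatives along tangent vectors.\<close>

definition circ :: "'a::euclidean_space \<Rightarrow> 'a \<Rightarrow> real \<Rightarrow> 'a" where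
  "circ x v t = cos t *\<^sub>R x + sin t *\<^sub>R v"

lemma circ_Sph:
  assumes "norm x = 1" "norm v = 1" "inner v x = 0" shows "circ x v t \<in> Sph"
proof -
  have "inner (circ x v t) (circ x v t) = (cos t)\<^sup>2 + (sin t)\<^sup>2"
    using assms by (simp add: circ_def inner_add_left inner_add_right norm_eq_1 inner_commute[of x v] power2_eq_square)
  then show ?thesis by (simp add: norm_eq_1)
qed

lemma circ_deriv: "(circ x v has_vector_derivative v) (at 0)"
  unfolding circ_def[abs_def] by (auto intro!: derivative_eq_intros)

lemma vector_derivative_quotient:
  assumes "(F has_vector_derivative d) (at 0)"
  shows "((\<lambda>t. (F t - F 0) /\<^sub>R t) \<longlongrightarrow> d) (at 0)"
proof -
  have "((\<lambda>h. norm (F (0 + h) - F 0 - h *\<^sub>R d) / norm h) \<longlongrightarrow> 0) (at 0)"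
    using assms unfolding has_vector_derivative_def has_derivative_at by blast
  moreover have "\<forall>\<^sub>F h in at 0. norm (F (0 + h) - F 0 - h *\<^sub>R d) / norm h = norm ((F h - F 0) /\<^sub>R h - d)"
  proof (rule eventually_at_filter[THEN iffD2], rule always_eventually, intro allI impI)
    fix h :: real assume "h \<noteq> 0"
    then have "(F h - F 0) /\<^sub>R h - d = (F (0 + h) - F 0 - h *\<^sub>R d) /\<^sub>R h" by (simp add: scaleR_diff_right)
    then show "norm (F (0 + h) - F 0 - h *\<^sub>R d) / norm h = norm ((F h - F 0) /\<^sub>R h - d)"
      by (simp add: divide_inverse mult.commute)
  qed
  ultimately have "((\<lambda>h. norm ((F h - F 0) /\<^sub>R h - d)) \<longlongrightarrow> 0) (at 0)"
    by (rule Lim_transform_eventually)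
  then show ?thesis by (rule LIM_zero_cancel[OF tendsto_norm_zero_cancel])
qed

lemma circ_quotient:
  assumes "(f has_derivative f') (at x)"
  shows "((\<lambda>t. (f (circ x v t) - f x) /\<^sub>R t) \<longlongrightarrow> f' v) (at 0)"
proof -
  have a0: "circ x v 0 = x" by (simp add: circ_def)
  have "((f \<circ> circ x v) has_vector_derivative f' v) (at 0)"
    using vector_derivative_diff_chain_within[of "circ x v" v 0 UNIV f f'] circ_deriv[of x v] assms
    by (simp add: a0 has_derivative_at_withinI)
  then show ?thesis using vector_derivative_quotient[of "f \<circ> circ x v"] by (simp add: a0)
qed

lemma tangential_derivative_le:
  assumes "(f has_derivative f') (at x)" "norm x = 1" "norm v = 1" "inner v x = 0"
    and L: "\<And>y. y \<in> Sph \<Longrightarrow> norm (f y - f x) \<le> K * norm (y - x)"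
  shows "norm (f' v) \<le> K"
proof -
  have 1: "((\<lambda>t. norm ((f (circ x v t) - f x) /\<^sub>R t)) \<longlongrightarrow> norm (f' v)) (at 0)"
    by (rule tendsto_norm[OF circ_quotient[OF assms(1)]])
  have 2: "((\<lambda>t. K * norm ((circ x v t - x) /\<^sub>R t)) \<longlongrightarrow> K * norm v) (at 0)"
    by (rule tendsto_mult_left[OF tendsto_norm[OF circ_quotient[OF has_derivative_ident]]])
  have "norm (f' v) \<le> K * norm v"
  proof (rule tendsto_le[OF _ 2 1])
    show "\<forall>\<^sub>F t in at 0. norm ((f (circ x v t) - f x) /\<^sub>R t) \<le> K * norm ((circ x v t - x) /\<^sub>R t)"
    proof (intro always_eventually allI)
      fix t
      show "norm ((f (circ x v t) - f x) /\<^sub>R t) \<le> K * norm ((circ x v t - x) /\<^sub>R t)"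
        unfolding norm_scaleR mult.left_commute[of K]
        by (rule mult_left_mono[OF L[OF circ_Sph[OF assms(2-4)]] abs_ge_zero])
    qed
  qed simp
  then show ?thesis using assms(3) by simp
qed

lemma tangential_derivative_ge:
  assumes "(f has_derivative f') (at x)" "norm x = 1" "norm v = 1" "inner v x = 0"
    and L: "\<And>y. y \<in> Sph \<Longrightarrow> norm (f y - f x) \<ge> K * norm (y - x)"
  shows "norm (f' v) \<ge> K"
proof -
  have 1: "((\<lambda>t. norm ((f (circ x v t) - f x) /\<^sub>R t)) \<longlongrightarrow> norm (f' v)) (at 0)"
    by (rule tendsto_norm[OF circ_quotient[OF assms(1)]])
  have 2: "((\<lambda>t. K * norm ((circ x v t - x) /\<^sub>R t)) \<longlongrightarrow> K * norm v) (at 0)"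
    by (rule tendsto_mult_left[OF tendsto_norm[OF circ_quotient[OF has_derivative_ident]]])
  have "K * norm v \<le> norm (f' v)"
  proof (rule tendsto_le[OF _ 1 2])
    show "\<forall>\<^sub>F t in at 0. K * norm ((circ x v t - x) /\<^sub>R t) \<le> norm ((f (circ x v t) - f x) /\<^sub>R t)"
    proof (intro always_eventually allI)
      fix t
      show "K * norm ((circ x v t - x) /\<^sub>R t) \<le> norm ((f (circ x v t) - f x) /\<^sub>R t)"
        unfolding norm_scaleR mult.left_commute[of K]
        by (rule mult_left_mono[OF L[OF circ_Sph[OF assms(2-4)]] abs_ge_zero])
    qed
  qed simp
  then show ?thesis using assms(3) by simp
qed

text \<open>Differentiate \<open>norm (f y) = 1\<close> along a great circle. For unit vectors
  \<open>f y - f x\<close> is orthogonal to \<open>f y + f x\<close>; dividing by \<open>t\<close>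
  and letting \<open>t\<close> tend to 0 leaves \<open>2 * inner (f' v) (f x) = 0\<close>.\<close>

lemma derivative_tangent:
  assumes "(f has_derivative f') (at x)" "x \<in> Sph" "inner v x = 0" and fS: "\<And>y. y \<in> Sph \<Longrightarrow> f y \<in> Sph"
  shows "inner (f' v) (f x) = 0"
proof (cases "v = 0")
  case True
  then show ?thesis using assms(1) by (simp add: linear_simps[OF has_derivative_bounded_linear])
next
  case False
  define w where "w = v /\<^sub>R norm v"
  have w: "norm w = 1" "inner w x = 0" using False assms by (auto simp: w_def)
  have 1: "((\<lambda>t. inner ((f (circ x w t) - f x) /\<^sub>R t) (f (circ x w t) + f x)) \<longlongrightarrow> inner (f' w) (f (circ x w 0) + f x)) (at 0)"
  proof (intro tendsto_inner tendsto_add tendsto_const circ_quotient assms(1))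
    have "isCont (\<lambda>t. f (circ x w t)) 0"
      by (rule isCont_o2[of 0 "circ x w" f])
        (auto simp: circ_def[abs_def] intro!: continuous_intros has_derivative_continuous[OF assms(1)])
    then show "((\<lambda>t. f (circ x w t)) \<longlongrightarrow> f (circ x w 0)) (at 0)" by (simp add: isCont_def)
  qed
  have z: "inner ((f (circ x w t) - f x) /\<^sub>R t) (f (circ x w t) + f x) = 0" for t
  proof -
    have "inner (f (circ x w t)) (f (circ x w t)) = 1" "inner (f x) (f x) = 1"
      using fS[OF circ_Sph[of x w t]] fS[OF assms(2)] w assms(2) by (auto simp: norm_eq_1)
    then have "inner (f (circ x w t) - f x) (f (circ x w t) + f x) = 0"
      by (simp add: inner_diff_left inner_add_right inner_commute[of "f x" "f (circ x w t)"])
    then show ?thesis by simp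
  qed
  have "((\<lambda>t. 0) \<longlongrightarrow> inner (f' w) (f (circ x w 0) + f x)) (at (0::real))" using 1 unfolding z .
  then have "inner (f' w) (f (circ x w 0) + f x) = 0"
    by (metis tendsto_const_iff trivial_limit_at)
  then have "inner (f' w) (f x) = 0" by (simp add: circ_def inner_add_right)
  moreover have "f' w = f' v /\<^sub>R norm v" unfolding w_def
    by (simp add: linear_simps[OF has_derivative_bounded_linear[OF assms(1)]])
  ultimately show ?thesis using False by simp
qed

section \<open>Random compositions\<close>

lemma ifs_iter_cong: "(\<And>i. i < n \<Longrightarrow> \<omega> i = \<omega>' i) \<Longrightarrow> ifs_iter fs \<omega> n = ifs_iter fs \<omega>' n"
  by (induction n) auto

lemma ifs_iter_add: "ifs_iter fs \<omega> (m + n) = ifs_iter fs (\<lambda>i. \<omega> (i + m)) n \<circ> ifs_iter fs \<omega> m"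
  by (induction n) (auto simp: comp_assoc add.commute)

lemma ifs_iter_shift: "ifs_iter fs \<omega> (Suc n) x = ifs_iter fs (\<lambda>i. \<omega> (Suc i)) n ((fs ! \<omega> 0) x)"
  using ifs_iter_add[of fs \<omega> 1 n] by simp

definition word :: "('a \<Rightarrow> 'a) list \<Rightarrow> nat list \<Rightarrow> 'a \<Rightarrow> 'a" where
  "word fs w = fold (\<lambda>i. fs ! i) w"

lemma word_simps [simp]:
  "word fs [] = id" "word fs (i # w) = word fs w \<circ> fs ! i" "word fs (v @ w) = word fs w \<circ> word fs v"
  by (auto simp: word_def)

lemma ifs_iter_word: "ifs_iter fs \<omega> n = word fs (map \<omega> [0..<n])"
  by (induction n) auto

text \<open>Equals \<open>fs ! \<omega> 0 \<circ> \<dots> \<circ> fs ! \<omega> (n - 1)\<close>: a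
  new letter acts innermost. For each fixed \<open>n\<close> the law is that of the forward
  composition.\<close>

definition back_comp :: "('a \<Rightarrow> 'a) list \<Rightarrow> (nat \<Rightarrow> nat) \<Rightarrow> nat \<Rightarrow> 'a \<Rightarrow> 'a" where
  "back_comp fs \<omega> n = ifs_iter fs (\<lambda>i. \<omega> (n - 1 - i)) n"

lemma back_comp_Suc: "back_comp fs \<omega> (Suc n) x = back_comp fs \<omega> n ((fs ! \<omega> n) x)"
  unfolding back_comp_def by (subst ifs_iter_shift) simp

lemma back_comp_case_nat: "back_comp fs (case_nat i \<omega>) (Suc n) = fs ! i \<circ> back_comp fs \<omega> n"
proof -
  have "ifs_iter fs (\<lambda>j. (case_nat i \<omega>) (Suc n - 1 - j)) n = ifs_iter fs (\<lambda>j. \<omega> (n - 1 - j)) n"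
    by (rule ifs_iter_cong) (auto split: nat.split intro: arg_cong[where f=\<omega>])
  then show ?thesis by (simp add: back_comp_def)
qed

text \<open>The conditional measure at \<open>\<omega>\<close> depends only on the past, which is
  read here backwards from index \<open>- 1\<close> as a one-sided sequence.\<close>

lemma back_iter_back_comp: "back_iter fs \<omega> j = back_comp fs (\<lambda>i. \<omega> (- 1 - int i)) j"
  unfolding back_iter_def back_comp_def by (rule ifs_iter_cong) (auto intro: arg_cong[where f=\<omega>])

text \<open>Half of the decay is spent on dividing by \<open>R ^ n\<close> with
  \<open>R = sqrt r\<close>: the series of \<open>X n x powr s / R ^ n\<close> still has finite
  integral, so it is finite almost everywhere and dominates each of its terms. Taking powers with
  exponent \<open>1 / s\<close> gives the rate.\<close>

lemma AE_geometric_decay: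
  fixes X :: "nat \<Rightarrow> 'b \<Rightarrow> real"
  assumes [measurable]: "\<And>n. X n \<in> borel_measurable M" and X0: "\<And>n x. 0 \<le> X n x"
    and s: "0 < s" and r: "0 < r" "r < 1" and C: "0 \<le> C"
    and mom: "\<And>n. (\<integral>\<^sup>+x. ennreal (X n x powr s) \<partial>M) \<le> ennreal (C * r ^ n)"
  shows "AE x in M. \<exists>c. \<forall>n. X n x \<le> c * (sqrt r powr (1 / s)) ^ n"
proof -
  define R where "R = sqrt r"
  have R: "0 < R" "R < 1" "r = R * R" using r by (auto simp: R_def)
  have "(\<integral>\<^sup>+x. (\<Sum>n. ennreal (X n x powr s / R ^ n)) \<partial>M) = (\<Sum>n. \<integral>\<^sup>+x. ennreal (X n x powr s / R ^ n) \<partial>M)"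
    by (rule nn_integral_suminf) measurable
  also have "\<dots> \<le> (\<Sum>n. ennreal (C * R ^ n))"
  proof (rule suminf_le)
    fix n
    have "(\<integral>\<^sup>+x. ennreal (X n x powr s / R ^ n) \<partial>M) = (\<integral>\<^sup>+x. ennreal (1 / R ^ n) * ennreal (X n x powr s) \<partial>M)"
      using R by (intro nn_integral_cong) (simp flip: ennreal_mult)
    also have "\<dots> = ennreal (1 / R ^ n) * (\<integral>\<^sup>+x. ennreal (X n x powr s) \<partial>M)"
      by (rule nn_integral_cmult) measurable
    also have "\<dots> \<le> ennreal (1 / R ^ n) * ennreal (C * r ^ n)"
      by (intro mult_left_mono mom) simp
    also have "\<dots> = ennreal (C * R ^ n)" using R C by (simp add: power_mult_distrib flip: ennreal_mult)
    finally show "(\<integral>\<^sup>+x. ennreal (X n x powr s / R ^ n) \<partial>M) \<le> ennreal (C * R ^ n)" .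
  qed auto
  also have "\<dots> < \<infinity>"
  proof -
    have "summable (\<lambda>n. C * R ^ n)" using R by (intro summable_mult summable_geometric) auto
    then show ?thesis using R C by (subst suminf_ennreal2) auto
  qed
  finally have "(\<integral>\<^sup>+x. (\<Sum>n. ennreal (X n x powr s / R ^ n)) \<partial>M) \<noteq> \<infinity>" by simp
  then have "AE x in M. (\<Sum>n. ennreal (X n x powr s / R ^ n)) \<noteq> \<infinity>"
    by (intro nn_integral_PInf_AE) auto
  then show ?thesis
  proof eventually_elim
    case (elim x)
    define T where "T = enn2real (\<Sum>n. ennreal (X n x powr s / R ^ n))"
    have T: "ennreal T = (\<Sum>n. ennreal (X n x powr s / R ^ n))"
      unfolding T_def using elim by (intro ennreal_enn2real) (simp add: less_top)
    have T0: "0 \<le> T" by (simp add: T_def)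
    have "X n x \<le> T powr (1 / s) * (R powr (1 / s)) ^ n" for n
    proof -
      have "(\<Sum>i\<in>{n}. ennreal (X i x powr s / R ^ i)) \<le> (\<Sum>i. ennreal (X i x powr s / R ^ i))"
        by (rule sum_le_suminf) auto
      then have "ennreal (X n x powr s / R ^ n) \<le> ennreal T" by (simp add: T)
      then have "X n x powr s / R ^ n \<le> T" using T0 by (simp add: ennreal_le_iff)
      then have "X n x powr s \<le> T * R ^ n" using R by (simp add: field_simps)
      then have "(X n x powr s) powr (1 / s) \<le> (T * R ^ n) powr (1 / s)"
        using s by (intro powr_mono2) auto
      moreover have "(X n x powr s) powr (1 / s) = X n x" using s X0[of n x] by (simp add: powr_powr)
      moreover have "(R ^ n) powr (1 / s) = (R powr (1 / s)) ^ n"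
        using R by (simp add: powr_power powr_realpow[symmetric] powr_powr mult.commute)
      ultimately show ?thesis using T0 R by (simp add: powr_mult)
    qed
    then show ?case unfolding R_def by blast
  qed
qed

lemma space_sphere_borel [simp]: "space (sphere_borel :: 'a::euclidean_space measure) = Sph"
  by (simp add: sphere_borel_def space_restrict_space)

lemma measurable_sphere_borel:
  fixes f :: "'a::euclidean_space \<Rightarrow> 'b::topological_space"
  shows "continuous_on Sph f \<Longrightarrow> f \<in> borel_measurable sphere_borel"
  unfolding sphere_borel_def by (rule borel_measurable_continuous_on_restrict)

lemma measurable_into_sphere_borel:
  assumes "f \<in> borel_measurable M" "\<And>x. x \<in> space M \<Longrightarrow> f x \<in> Sph"
  shows "f \<in> measurable M sphere_borel"
  unfolding sphere_borel_def by (rule measurable_restrict_space2) (use assms in auto)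

lemma sphere_borel_measurable_ident: "(\<lambda>x. x) \<in> borel_measurable sphere_borel"
  by (rule measurable_sphere_borel) simp

section \<open>Bernoulli measures and measurability of random compositions\<close>

locale sphere_ifs =
  fixes fs :: "('a::euclidean_space \<Rightarrow> 'a) list" and p :: "nat \<Rightarrow> real"
  assumes dim: "DIM('a) \<ge> 2"
    and diffeo: "\<And>i. i < length fs \<Longrightarrow> sphere_diffeo (fs ! i)"
    and p_pos: "\<And>i. i < length fs \<Longrightarrow> 0 < p i"
    and p_sum: "(\<Sum>i<length fs. p i) = 1"
begin

abbreviation "letters \<equiv> {..<length fs}"
abbreviation "LM \<equiv> letter_measure (length fs) p"
abbreviation "N \<equiv> nu_plus (length fs) p"
abbreviation "SB \<equiv> sphere_borel :: 'a measure"

lemma space_LM [simp]: "space LM = letters"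
  by (simp add: letter_measure_def space_point_measure)

lemma sets_LM: "sets LM = Pow letters"
  by (simp add: letter_measure_def sets_point_measure)

lemma nn_integral_LM: "(\<integral>\<^sup>+i. F i \<partial>LM) = (\<Sum>i\<in>letters. ennreal (p i) * F i)"
  by (simp add: letter_measure_def nn_integral_point_measure_finite)

sublocale LM: prob_space LM
proof
  have "emeasure LM letters = (\<Sum>i\<in>letters. ennreal (p i))"
    by (simp add: letter_measure_def emeasure_point_measure_finite)
  also have "\<dots> = ennreal (\<Sum>i\<in>letters. p i)" using p_pos by (intro sum_ennreal) (auto intro: less_imp_le)
  finally show "emeasure LM (space LM) = 1" using p_sum by simp
qed

sublocale seq: sequence_space LM ..

lemma N_eq: "N = seq.S" by (simp add: nu_plus_def)

sublocale N: prob_space N unfolding N_eq by unfold_locales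

lemma space_N: "space N = {\<omega>. \<forall>i. \<omega> i < length fs}"
  by (auto simp: N_eq space_PiM PiE_UNIV_domain)

lemma coord_measurable [measurable]: "(\<lambda>\<omega>. \<omega> i) \<in> measurable N (count_space letters)"
proof -
  have "(\<lambda>\<omega>. \<omega> i) \<in> measurable N LM" unfolding N_eq by (rule measurable_component_singleton) simp
  moreover have "measurable N LM = measurable N (count_space letters)"
    by (rule measurable_cong_sets) (simp_all add: sets_LM)
  ultimately show ?thesis by simp
qed

lemma N_measurableI:
  assumes "\<And>i. (\<lambda>x. f x i) \<in> measurable M (count_space letters)"
  shows "f \<in> measurable M N"
  unfolding N_eq
proof (rule measurable_PiM_single')
  fix i
  have "measurable M LM = measurable M (count_space letters)"
    by (rule measurable_cong_sets) (simp_all add: sets_LM)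
  then show "(\<lambda>x. f x i) \<in> measurable M LM" using assms by simp
next
  show "f \<in> space M \<rightarrow> (\<Pi>\<^sub>E i\<in>UNIV. space LM)"
    using assms[THEN measurable_space] by (auto simp: PiE_UNIV_domain)
qed

lemma case_nat_measurable [measurable]: "i \<in> letters \<Longrightarrow> case_nat i \<in> measurable N N"
  by (rule N_measurableI) (auto split: nat.split)

lemma reindex_N:
  assumes "inj g"
  shows "distr N N (\<lambda>\<omega> i. \<omega> (g i)) = N"
proof -
  have "distr (\<Pi>\<^sub>M i\<in>UNIV. LM) (\<Pi>\<^sub>M i\<in>UNIV::nat set. LM) (\<lambda>\<omega>. \<lambda>n\<in>UNIV. \<omega> (g n)) = (\<Pi>\<^sub>M i\<in>UNIV. LM)"
    by (rule distr_PiM_reindex[of UNIV "\<lambda>_. LM" g UNIV]) (use assms LM.prob_space_axioms in auto)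
  then show ?thesis by (simp add: N_eq restrict_UNIV)
qed

lemma reindex_N_measurable [measurable]: "(\<lambda>\<omega> i. \<omega> (g i)) \<in> measurable N N"
  by (rule N_measurableI) measurable

lemma reindex_nu_two:
  assumes "inj (g :: nat \<Rightarrow> int)"
  shows "(\<lambda>\<omega> i. \<omega> (g i)) \<in> measurable (nu_two (length fs) p) N"
    and "distr (nu_two (length fs) p) N (\<lambda>\<omega> i. \<omega> (g i)) = N"
proof -
  have "distr (\<Pi>\<^sub>M i\<in>UNIV. LM) (\<Pi>\<^sub>M i\<in>UNIV::nat set. LM) (\<lambda>\<omega>. \<lambda>n\<in>UNIV. \<omega> (g n)) = (\<Pi>\<^sub>M i\<in>UNIV. LM)"
    by (rule distr_PiM_reindex[of UNIV "\<lambda>_. LM" g UNIV]) (use assms LM.prob_space_axioms in auto)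
  then show "distr (nu_two (length fs) p) N (\<lambda>\<omega> i. \<omega> (g i)) = N" by (simp add: N_eq nu_two_def restrict_UNIV)
  show "(\<lambda>\<omega> i. \<omega> (g i)) \<in> measurable (nu_two (length fs) p) N"
    unfolding N_eq nu_two_def
    by (rule measurable_PiM_single') (auto simp: space_PiM PiE_UNIV_domain)
qed

lemma nn_integral_N_step:
  assumes [measurable]: "F \<in> borel_measurable N"
  shows "(\<integral>\<^sup>+\<omega>. F \<omega> \<partial>N) = (\<Sum>i\<in>letters. ennreal (p i) * (\<integral>\<^sup>+\<omega>. F (case_nat i \<omega>) \<partial>N))"
proof -
  have m: "(\<lambda>(s, \<omega>). case_nat s \<omega>) \<in> measurable (LM \<Otimes>\<^sub>M N) N"
    unfolding N_eq by measurable
  have "distr (LM \<Otimes>\<^sub>M N) N (\<lambda>(s, \<omega>). case_nat s \<omega>) = N"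
    using seq.PiM_iter by (simp add: N_eq)
  then have "(\<integral>\<^sup>+\<omega>. F \<omega> \<partial>N) = (\<integral>\<^sup>+\<omega>. F \<omega> \<partial>distr (LM \<Otimes>\<^sub>M N) N (\<lambda>(s, \<omega>). case_nat s \<omega>))" by simp
  also have "\<dots> = (\<integral>\<^sup>+z. F ((\<lambda>(s, \<omega>). case_nat s \<omega>) z) \<partial>(LM \<Otimes>\<^sub>M N))"
    by (rule nn_integral_distr[OF m]) simp
  also have "\<dots> = (\<integral>\<^sup>+s. \<integral>\<^sup>+\<omega>. F ((\<lambda>(s, \<omega>). case_nat s \<omega>) (s, \<omega>)) \<partial>N \<partial>LM)"
    by (rule N.nn_integral_fst[OF measurable_compose[OF m assms], symmetric])
  finally show ?thesis by (simp add: nn_integral_LM)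
qed

text \<open>Only finitely many words of length \<open>n\<close> occur, so a quantity depending on
  the first \<open>n\<close> letters and a point is pieced together from finitely many functions of
  the point alone.\<close>

lemma words_measurable:
  assumes G: "\<And>w. set w \<subseteq> letters \<Longrightarrow> length w = n \<Longrightarrow> G w \<in> measurable M B"
  shows "(\<lambda>z. G (map (fst z) [0..<n]) (snd z)) \<in> measurable (N \<Otimes>\<^sub>M M) B"
proof -
  let ?W = "{w. set w \<subseteq> letters \<and> length w = n}"
  have fin: "finite ?W" by (rule finite_lists_length_eq) simp
  have "(\<lambda>z. map (fst z) [0..<n]) \<in> measurable (N \<Otimes>\<^sub>M M) (count_space ?W)"
  proof (subst measurable_count_space_eq2[OF fin], intro conjI ballI)
    show "(\<lambda>z. map (fst z) [0..<n]) \<in> space (N \<Otimes>\<^sub>M M) \<rightarrow> ?W"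
      by (auto simp: space_pair_measure space_N)
    fix w assume w: "w \<in> ?W"
    have "map f [0..<n] = w \<longleftrightarrow> (\<forall>i\<in>{..<n}. f i = w ! i)" for f :: "nat \<Rightarrow> nat"
    proof
      assume "map f [0..<n] = w"
      then show "\<forall>i\<in>{..<n}. f i = w ! i" by auto
    next
      assume "\<forall>i\<in>{..<n}. f i = w ! i"
      then show "map f [0..<n] = w" using w by (intro nth_equalityI) simp_all
    qed
    then have "(\<lambda>z. map (fst z) [0..<n]) -` {w} \<inter> space (N \<Otimes>\<^sub>M M) = {z \<in> space (N \<Otimes>\<^sub>M M). \<forall>i\<in>{..<n}. fst z i = w ! i}"
      by blast
    moreover have "{z \<in> space (N \<Otimes>\<^sub>M M). fst z i = w ! i} \<in> sets (N \<Otimes>\<^sub>M M)" if "i < n" for i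
    proof -
      have "w ! i \<in> letters" using w that by (metis (mono_tags) mem_Collect_eq nth_mem subsetD)
      then have "(\<lambda>z. fst z i) -` {w ! i} \<inter> space (N \<Otimes>\<^sub>M M) \<in> sets (N \<Otimes>\<^sub>M M)"
        by (intro measurable_sets[of _ _ "count_space letters"]) auto
      moreover have "(\<lambda>z. fst z i) -` {w ! i} \<inter> space (N \<Otimes>\<^sub>M M) = {z \<in> space (N \<Otimes>\<^sub>M M). fst z i = w ! i}" by auto
      ultimately show ?thesis by simp
    qed
    ultimately show "(\<lambda>z. map (fst z) [0..<n]) -` {w} \<inter> space (N \<Otimes>\<^sub>M M) \<in> sets (N \<Otimes>\<^sub>M M)"
      by (auto intro!: sets.sets_Collect_finite_All)
  qed
  then show ?thesis
    by (rule measurable_compose_countable'[rotated])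
      (use G fin in \<open>auto intro: measurable_compose[OF measurable_snd] countable_finite\<close>)
qed

lemma word_C1:
  assumes "set w \<subseteq> letters"
  shows "\<exists>F'. C1_on_Sph (word fs w) F'" and "word fs w ` Sph = Sph"
proof -
  have "(\<exists>F'. C1_on_Sph (word fs w) F') \<and> word fs w ` Sph = Sph"
    using assms
  proof (induction w rule: rev_induct)
    case Nil
    show ?case using C1_on_Sph_id unfolding word_simps by (metis image_id id_apply)
  next
    case (snoc i w)
    then have i: "i < length fs" by auto
    obtain F' g' where F: "C1_on_Sph (word fs w) F'" "C1_on_Sph (fs ! i) g'"
      using snoc sphere_diffeoD(2)[OF diffeo[OF i]] by auto
    have im: "word fs w ` Sph = Sph" using snoc by auto
    have "word fs (w @ [i]) = fs ! i \<circ> word fs w" by simp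
    moreover have "(fs ! i \<circ> word fs w) ` Sph = Sph"
      by (simp only: image_comp[symmetric] im sphere_diffeoD(1)[OF diffeo[OF i]])
    moreover have "C1_on_Sph (fs ! i \<circ> word fs w) (\<lambda>x. g' (word fs w x) o\<^sub>L F' x)"
      by (rule C1_on_Sph_compose[OF F]) (use im in simp)
    ultimately show ?case by metis
  qed
  then show "\<exists>F'. C1_on_Sph (word fs w) F'" "word fs w ` Sph = Sph" by auto
qed

lemma word_Sph: "set w \<subseteq> letters \<Longrightarrow> x \<in> Sph \<Longrightarrow> word fs w x \<in> Sph"
  using word_C1(2)[of w] by blast

lemma word_measurable:
  assumes w: "set w \<subseteq> letters"
  shows "word fs w \<in> measurable SB SB"
proof (rule measurable_into_sphere_borel)
  obtain F' where "C1_on_Sph (word fs w) F'" using word_C1(1)[OF w] ..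
  then show "word fs w \<in> borel_measurable SB" by (intro measurable_sphere_borel C1_on_Sph_continuous)
  show "word fs w x \<in> Sph" if "x \<in> space SB" for x using word_Sph[OF w] that by simp
qed

lemma N_words: "\<omega> \<in> space N \<Longrightarrow> set (map (\<lambda>i. \<omega> (g i)) [0..<n]) \<subseteq> letters"
  by (auto simp: space_N)

lemma iter_Sph: "\<omega> \<in> space N \<Longrightarrow> x \<in> Sph \<Longrightarrow> ifs_iter fs \<omega> n x \<in> Sph"
  unfolding ifs_iter_word by (rule word_Sph) (auto simp: space_N)

lemma back_comp_Sph: "\<omega> \<in> space N \<Longrightarrow> x \<in> Sph \<Longrightarrow> back_comp fs \<omega> n x \<in> Sph"
  unfolding back_comp_def ifs_iter_word by (rule word_Sph[OF N_words])

lemma iter_measurable: "(\<lambda>z. ifs_iter fs (fst z) n (snd z)) \<in> measurable (N \<Otimes>\<^sub>M SB) SB"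
  unfolding ifs_iter_word by (rule words_measurable) (rule word_measurable)

text \<open>Reversing the first \<open>n\<close> letters is extended by the identity to an injection
  of all indices, so that reindexing preserves the whole product measure.\<close>

definition flip :: "nat \<Rightarrow> nat \<Rightarrow> nat" where "flip n i = (if i < n then n - 1 - i else i)"

lemma inj_flip: "inj (flip n)"
  by (rule inj_on_inverseI[where g="flip n"]) (auto simp: flip_def)

lemma back_comp_flip: "back_comp fs \<omega> n = ifs_iter fs (\<lambda>i. \<omega> (flip n i)) n"
  unfolding back_comp_def by (rule ifs_iter_cong) (simp add: flip_def)

lemma back_comp_measurable: "(\<lambda>z. back_comp fs (fst z) n (snd z)) \<in> measurable (N \<Otimes>\<^sub>M SB) SB"
proof -
  have "(\<lambda>z. ((\<lambda>i. fst z (flip n i)), snd z)) \<in> measurable (N \<Otimes>\<^sub>M SB) (N \<Otimes>\<^sub>M SB)"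
    by (intro measurable_Pair measurable_compose[OF measurable_fst reindex_N_measurable]) simp
  from measurable_compose[OF this iter_measurable[of n]] show ?thesis by (simp add: back_comp_flip)
qed

lemma measurable_section:
  assumes "F \<in> measurable (N \<Otimes>\<^sub>M SB) B" "x \<in> Sph"
  shows "(\<lambda>\<omega>. F (\<omega>, x)) \<in> measurable N B"
  by (rule measurable_compose[OF measurable_Pair2' assms(1)]) (use assms(2) in simp)

lemma iter_measurable_section: "x \<in> Sph \<Longrightarrow> (\<lambda>\<omega>. ifs_iter fs \<omega> n x) \<in> borel_measurable N"
  using measurable_compose[OF measurable_section[OF iter_measurable] sphere_borel_measurable_ident] by simp

lemma back_comp_measurable_section: "x \<in> Sph \<Longrightarrow> (\<lambda>\<omega>. back_comp fs \<omega> n x) \<in> borel_measurable N"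
  using measurable_compose[OF measurable_section[OF back_comp_measurable] sphere_borel_measurable_ident] by simp

lemma nn_integral_back_comp:
  assumes "(\<lambda>\<omega>. H (ifs_iter fs \<omega> n)) \<in> borel_measurable N"
  shows "(\<integral>\<^sup>+\<omega>. H (back_comp fs \<omega> n) \<partial>N) = (\<integral>\<^sup>+\<omega>. H (ifs_iter fs \<omega> n) \<partial>N)"
proof -
  have "(\<integral>\<^sup>+\<omega>. H (ifs_iter fs \<omega> n) \<partial>N) = (\<integral>\<^sup>+\<omega>. H (ifs_iter fs \<omega> n) \<partial>distr N N (\<lambda>\<omega> i. \<omega> (flip n i)))"
    by (simp add: reindex_N[OF inj_flip])
  also have "\<dots> = (\<integral>\<^sup>+\<omega>. H (ifs_iter fs (\<lambda>i. \<omega> (flip n i)) n) \<partial>N)"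
    by (rule nn_integral_distr) (use assms in auto)
  finally show ?thesis by (simp add: back_comp_flip)
qed

end

section \<open>Stationary measures of systems that contract on average\<close>

text \<open>The exponent may have to be small: single maps can expand so strongly that the first
  moment grows, but a negative mean logarithm still yields decay of a sufficiently small
  power.\<close>

locale contracting_ifs = sphere_ifs +
  fixes s K r :: real
  assumes s_pos: "0 < s" and r_pos: "0 < r" and r_less: "r < 1" and K_nonneg: "0 \<le> K"
    and contract: "\<And>n x y. \<lbrakk>x \<in> Sph; y \<in> Sph\<rbrakk> \<Longrightarrow>
      (\<integral>\<^sup>+\<omega>. ennreal (norm (ifs_iter fs \<omega> n x - ifs_iter fs \<omega> n y) powr s) \<partial>nu_plus (length fs) p)
        \<le> ennreal (K * r ^ n * norm (x - y) powr s)"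
begin

definition \<theta> :: real where "\<theta> = sqrt r powr (1 / s)"

lemma \<theta>: "0 < \<theta>" "\<theta> < 1"
proof -
  show "0 < \<theta>" using r_pos by (simp add: \<theta>_def)
  have "sqrt r < 1" using r_less by simp
  then have "sqrt r powr (1 / s) < 1 powr (1 / s)" using r_pos s_pos by (intro powr_less_mono2) auto
  then show "\<theta> < 1" by (simp add: \<theta>_def)
qed

lemma contract_back:
  assumes x: "x \<in> Sph" and y: "y \<in> Sph"
  shows "(\<integral>\<^sup>+\<omega>. ennreal (norm (back_comp fs \<omega> n x - back_comp fs \<omega> n y) powr s) \<partial>N) \<le> ennreal (K * 2 powr s * r ^ n)"
proof -
  note [measurable] = iter_measurable_section[OF x] iter_measurable_section[OF y]
  have "(\<integral>\<^sup>+\<omega>. ennreal (norm (back_comp fs \<omega> n x - back_comp fs \<omega> n y) powr s) \<partial>N) =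
      (\<integral>\<^sup>+\<omega>. ennreal (norm (ifs_iter fs \<omega> n x - ifs_iter fs \<omega> n y) powr s) \<partial>N)"
    by (rule nn_integral_back_comp[of "\<lambda>h. ennreal (norm (h x - h y) powr s)"]) measurable
  also have "\<dots> \<le> ennreal (K * r ^ n * norm (x - y) powr s)" by (rule contract[OF x y])
  also have "\<dots> \<le> ennreal (K * r ^ n * 2 powr s)"
  proof (intro ennreal_leI mult_left_mono powr_mono2)
    show "norm (x - y) \<le> 2" using norm_triangle_ineq4[of x y] x y by simp
  qed (use s_pos K_nonneg r_pos in auto)
  finally show ?thesis by (simp add: mult_ac)
qed

definition x0 :: 'a where "x0 = (SOME x. x \<in> Sph)"

lemma x0: "x0 \<in> Sph"
proof -
  obtain v :: 'a where "norm v = 1" using exists_unit_tangent[OF dim, of 0] by metis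
  then have "v \<in> Sph" by simp
  then show ?thesis unfolding x0_def by (rule someI)
qed

text \<open>By \<open>back_comp_Suc\<close> consecutive terms are images of
  \<open>(fs ! \<omega> n) x0\<close> and \<open>x0\<close> under the same reversed composition of
  length \<open>n\<close>, so the moment bound makes the increments summable.\<close>

lemma AE_back_comp_Cauchy: "AE \<omega> in N. convergent (\<lambda>n. back_comp fs \<omega> n x0)"
proof -
  let ?X = "\<lambda>n \<omega>. norm (back_comp fs \<omega> (Suc n) x0 - back_comp fs \<omega> n x0)"
  note [measurable] = back_comp_measurable_section[OF x0]
  have "AE \<omega> in N. \<exists>c. \<forall>n. ?X n \<omega> \<le> c * (sqrt r powr (1 / s)) ^ n"
  proof (rule AE_geometric_decay[OF _ _ s_pos r_pos r_less])
    show "0 \<le> real (length fs) * (K * 2 powr s)" using K_nonneg by simp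
    fix n
    have f: "(fs ! i) x0 \<in> Sph" if "i \<in> letters" for i using sphere_diffeoD(3)[OF diffeo x0] that by simp
    \<comment> \<open>The first point depends on the random letter \<open>\<omega> n\<close>.
      Summing over all letters replaces it by deterministic points, at the price of the factor
      \<open>length fs\<close>.\<close>
    have "(\<integral>\<^sup>+\<omega>. ennreal (?X n \<omega> powr s) \<partial>N) \<le>
      (\<integral>\<^sup>+\<omega>. (\<Sum>i\<in>letters. ennreal (norm (back_comp fs \<omega> n ((fs ! i) x0) - back_comp fs \<omega> n x0) powr s)) \<partial>N)"
    proof (rule nn_integral_mono)
      fix \<omega> assume "\<omega> \<in> space N"
      then have "\<omega> n \<in> letters" by (simp add: space_N)
      then have "(\<Sum>i\<in>{\<omega> n}. ennreal (norm (back_comp fs \<omega> n ((fs ! i) x0) - back_comp fs \<omega> n x0) powr s)) \<le>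
        (\<Sum>i\<in>letters. ennreal (norm (back_comp fs \<omega> n ((fs ! i) x0) - back_comp fs \<omega> n x0) powr s))"
        by (intro sum_mono2) auto
      then show "ennreal (?X n \<omega> powr s) \<le>
        (\<Sum>i\<in>letters. ennreal (norm (back_comp fs \<omega> n ((fs ! i) x0) - back_comp fs \<omega> n x0) powr s))"
        by (simp add: back_comp_Suc)
    qed
    also have "\<dots> = (\<Sum>i\<in>letters. \<integral>\<^sup>+\<omega>. ennreal (norm (back_comp fs \<omega> n ((fs ! i) x0) - back_comp fs \<omega> n x0) powr s) \<partial>N)"
    proof (rule nn_integral_sum)
      fix i assume "i \<in> letters"
      note [measurable] = back_comp_measurable_section[OF f[OF this]]
      show "(\<lambda>\<omega>. ennreal (norm (back_comp fs \<omega> n ((fs ! i) x0) - back_comp fs \<omega> n x0) powr s)) \<in> borel_measurable N"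
        by measurable
    qed
    also have "\<dots> \<le> (\<Sum>i\<in>letters. ennreal (K * 2 powr s * r ^ n))"
      by (intro sum_mono contract_back f x0)
    also have "\<dots> = ennreal (real (length fs) * (K * 2 powr s) * r ^ n)"
      using K_nonneg r_pos by (simp add: ennreal_mult ennreal_of_nat_eq_real_of_nat mult.assoc)
    finally show "(\<integral>\<^sup>+\<omega>. ennreal (?X n \<omega> powr s) \<partial>N) \<le> ennreal (real (length fs) * (K * 2 powr s) * r ^ n)" .
  qed auto
  then show ?thesis
  proof eventually_elim
    case (elim \<omega>)
    then obtain c where c: "\<And>n. ?X n \<omega> \<le> c * \<theta> ^ n" unfolding \<theta>_def by blast
    have "summable (\<lambda>n. back_comp fs \<omega> (Suc n) x0 - back_comp fs \<omega> n x0)"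
    proof (rule summable_comparison_test')
      show "summable (\<lambda>n. c * \<theta> ^ n)" using \<theta> by (intro summable_mult summable_geometric) auto
    qed (use c in auto)
    then have "convergent (\<lambda>n. \<Sum>i<n. back_comp fs \<omega> (Suc i) x0 - back_comp fs \<omega> i x0)"
      by (simp add: summable_iff_convergent)
    then have "convergent (\<lambda>n. back_comp fs \<omega> n x0 - back_comp fs \<omega> 0 x0)"
      unfolding sum_lessThan_telescope[of "\<lambda>i. back_comp fs \<omega> i x0"] .
    then show ?case by (simp add: convergent_diff_const_right_iff)
  qed
qed

text \<open>The default \<open>x0\<close> makes \<open>Z\<close> sphere-valued everywhere, so that
  its law is a measure on the sphere; it can matter only on the null set of sequences without a
  limit.\<close>

definition Z :: "(nat \<Rightarrow> nat) \<Rightarrow> 'a" where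
  "Z \<omega> = (let z = lim (\<lambda>n. back_comp fs \<omega> n x0) in if z \<in> Sph then z else x0)"

lemma Z_Sph: "Z \<omega> \<in> Sph" using x0 by (simp add: Z_def Let_def)

lemma Z_lim: "\<omega> \<in> space N \<Longrightarrow> (\<lambda>n. back_comp fs \<omega> n x0) \<longlonglongrightarrow> z \<Longrightarrow> Z \<omega> = z"
proof -
  assume w: "\<omega> \<in> space N" and l: "(\<lambda>n. back_comp fs \<omega> n x0) \<longlonglongrightarrow> z"
  have "z \<in> Sph" by (rule closed_sequentially[OF closed_sphere _ l]) (use back_comp_Sph[OF w x0] in auto)
  then show "Z \<omega> = z" using limI[OF l] by (simp add: Z_def)
qed

lemma AE_Z: "AE \<omega> in N. (\<lambda>n. back_comp fs \<omega> n x0) \<longlonglongrightarrow> Z \<omega>"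
  using AE_back_comp_Cauchy AE_space
proof eventually_elim
  case (elim \<omega>)
  then obtain z where "(\<lambda>n. back_comp fs \<omega> n x0) \<longlonglongrightarrow> z" by (auto simp: convergent_def)
  then show ?case using Z_lim[OF elim(2)] by simp
qed

lemma Z_measurable [measurable]: "Z \<in> measurable N SB"
proof (rule measurable_into_sphere_borel)
  note [measurable] = back_comp_measurable_section[OF x0]
  have [measurable]: "(\<lambda>\<omega>. lim (\<lambda>n. back_comp fs \<omega> n x0)) \<in> borel_measurable N"
    by (rule borel_measurable_lim_metric) measurable
  have [measurable]: "(Sph :: 'a set) \<in> sets borel" by (rule borel_closed) simp
  show "Z \<in> borel_measurable N" unfolding Z_def[abs_def] Let_def by measurable
qed (rule Z_Sph)

definition m :: "'a measure" where "m = distr N SB Z"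

lemma sets_m [simp, measurable_cong]: "sets m = sets SB" by (simp add: m_def)
lemma space_m [simp]: "space m = Sph" by (simp add: m_def)

sublocale m: prob_space m
  unfolding m_def by (rule N.prob_space_distr) simp

lemma f_measurable: "i \<in> letters \<Longrightarrow> fs ! i \<in> measurable SB SB"
  using word_measurable[of "[i]"] by simp

text \<open>Prepending a letter adds an outermost map, which passes to the limit by continuity.
  After conditioning on the first letter this identity becomes stationarity of the law of
  \<open>Z\<close>.\<close>

lemma Z_equivariant:
  assumes i: "i \<in> letters"
  shows "AE \<omega> in N. Z (case_nat i \<omega>) = (fs ! i) (Z \<omega>)"
  using AE_Z AE_space
proof eventually_elim
  case (elim \<omega>)
  have w: "case_nat i \<omega> \<in> space N" using elim(2) i by (auto simp: space_N split: nat.split)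
  have "(\<lambda>n. (fs ! i) (back_comp fs \<omega> n x0)) \<longlonglongrightarrow> (fs ! i) (Z \<omega>)"
    using i elim by (intro continuous_on_tendsto_compose[OF sphere_diffeoD(4)[OF diffeo]])
      (auto simp: Z_Sph[simplified] back_comp_Sph[OF _ x0, simplified] intro!: always_eventually)
  then have "(\<lambda>n. back_comp fs (case_nat i \<omega>) (Suc n) x0) \<longlonglongrightarrow> (fs ! i) (Z \<omega>)"
    by (simp add: back_comp_case_nat)
  then have "(\<lambda>n. back_comp fs (case_nat i \<omega>) n x0) \<longlonglongrightarrow> (fs ! i) (Z \<omega>)" by (rule LIMSEQ_imp_Suc)
  then show ?case by (rule Z_lim[OF w])
qed

lemma emeasure_m_step:
  assumes A: "A \<in> sets SB"
  shows "emeasure m A = (\<Sum>i\<in>letters. ennreal (p i) * emeasure m ((fs ! i) -` A \<inter> Sph))"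
proof -
  note [measurable] = A
  have eq: "emeasure m B = (\<integral>\<^sup>+\<omega>. indicator B (Z \<omega>) \<partial>N)" if "B \<in> sets SB" for B
  proof -
    have "emeasure m B = (\<integral>\<^sup>+x. indicator B x \<partial>m)" using that by simp
    also have "\<dots> = (\<integral>\<^sup>+\<omega>. indicator B (Z \<omega>) \<partial>N)"
      unfolding m_def by (rule nn_integral_distr) (use that in auto)
    finally show ?thesis .
  qed
  have "emeasure m A = (\<integral>\<^sup>+\<omega>. indicator A (Z \<omega>) \<partial>N)" by (rule eq[OF A])
  also have "\<dots> = (\<Sum>i\<in>letters. ennreal (p i) * (\<integral>\<^sup>+\<omega>. indicator A (Z (case_nat i \<omega>)) \<partial>N))"
    by (rule nn_integral_N_step) measurable
  also have "\<dots> = (\<Sum>i\<in>letters. ennreal (p i) * emeasure m ((fs ! i) -` A \<inter> Sph))"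
  proof (intro sum.cong refl arg_cong2[where f="(*)"])
    fix i assume i: "i \<in> letters"
    have m: "(fs ! i) -` A \<inter> Sph \<in> sets SB" using measurable_sets[OF f_measurable[OF i] A] by simp
    have "(\<integral>\<^sup>+\<omega>. indicator A (Z (case_nat i \<omega>)) \<partial>N) = (\<integral>\<^sup>+\<omega>. indicator ((fs ! i) -` A \<inter> Sph) (Z \<omega>) \<partial>N)"
      using Z_equivariant[OF i] by (intro nn_integral_cong_AE) (auto elim!: eventually_mono simp: indicator_def Z_Sph[simplified])
    then show "(\<integral>\<^sup>+\<omega>. indicator A (Z (case_nat i \<omega>)) \<partial>N) = emeasure m ((fs ! i) -` A \<inter> Sph)"
      using eq[OF m] by simp
  qed
  finally show ?thesis .
qed

lemma stationary_m: "stationary fs p m"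
  unfolding stationary_def
proof (intro conjI ballI)
  show "prob_space m" by unfold_locales
  fix A assume "A \<in> sets m"
  then have A: "A \<in> sets SB" by simp
  have "emeasure (distr m SB (fs ! i)) A = emeasure m ((fs ! i) -` A \<inter> Sph)" if "i \<in> letters" for i
    using f_measurable[OF that] A by (subst emeasure_distr) (auto cong: measurable_cong_sets)
  then show "emeasure m A = (\<Sum>i<length fs. ennreal (p i) * emeasure (distr m SB (fs ! i)) A)"
    using emeasure_m_step[OF A] by simp
qed simp

text \<open>All weights are positive, so a null set on the left of the stationarity equation forces
  every summand on the right to vanish.\<close>

lemma null_preimage:
  assumes "set w \<subseteq> letters" "A \<in> sets SB" "emeasure m A = 0"
  shows "emeasure m (word fs w -` A \<inter> Sph) = 0"
  using assms
proof (induction w)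
  case Nil
  have "A \<subseteq> Sph" using sets.sets_into_space[OF Nil(2)] by simp
  then show ?case using Nil by (simp add: Int_absorb2)
next
  case (Cons i w)
  then have i: "i \<in> letters" by auto
  let ?B = "word fs w -` A \<inter> Sph"
  have B: "?B \<in> sets SB" using measurable_sets[OF word_measurable Cons.prems(2), of w] Cons.prems by simp
  have "emeasure m ?B = 0" using Cons by simp
  then have "(\<Sum>i\<in>letters. ennreal (p i) * emeasure m ((fs ! i) -` ?B \<inter> Sph)) = 0"
    using emeasure_m_step[OF B] by simp
  then have "ennreal (p i) * emeasure m ((fs ! i) -` ?B \<inter> Sph) = 0" using i by (simp add: sum_nonneg_eq_0_iff)
  then have "emeasure m ((fs ! i) -` ?B \<inter> Sph) = 0" using p_pos[of i] i by (auto simp: ennreal_eq_0_iff)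
  moreover have "(fs ! i) -` ?B \<inter> Sph = word fs (i # w) -` A \<inter> Sph"
    using sphere_diffeoD(3)[OF diffeo[of i]] i by auto
  ultimately show ?case by (simp only:)
qed

text \<open>By minimality the preimages of a ball under the countably many finite words cover the
  sphere. If the ball were null, all of them would be null.\<close>

lemma full_support_m:
  assumes "minimal_ifs fs"
  shows "full_support m"
  unfolding full_support_def
proof (intro ballI allI impI, rule ccontr)
  fix y :: 'a and e :: real assume y: "y \<in> Sph" and e: "e > 0" and n: "\<not> 0 < emeasure m (ball y e \<inter> Sph)"
  let ?V = "ball y e \<inter> Sph"
  have V: "?V \<in> sets SB" unfolding sphere_borel_def by (auto simp: sets_restrict_space)
  have V0: "emeasure m ?V = 0" using n by (simp add: zero_less_iff_neq_zero)
  have "Sph \<subseteq> (\<Union>w\<in>lists letters. word fs w -` ?V \<inter> Sph)"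
  proof
    fix x :: 'a assume x: "x \<in> Sph"
    obtain \<omega> where \<omega>: "\<And>j. \<omega> j < length fs" "Sph \<subseteq> closure (range (\<lambda>j. ifs_iter fs \<omega> j x))"
      using bspec[OF assms[unfolded minimal_ifs_def] x] by blast
    have "y \<in> closure (range (\<lambda>j. ifs_iter fs \<omega> j x))" using \<omega>(2) y by (rule subsetD)
    then obtain j where "dist (ifs_iter fs \<omega> j x) y < e"
      unfolding closure_approachable using e by blast
    moreover have "set (map \<omega> [0..<j]) \<subseteq> letters" using \<omega>(1) by auto
    ultimately have "map \<omega> [0..<j] \<in> lists letters \<and> x \<in> word fs (map \<omega> [0..<j]) -` ?V \<inter> Sph"
      using x word_Sph[of "map \<omega> [0..<j]" x] by (simp add: ifs_iter_word dist_commute in_lists_conv_set subset_iff)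
    then show "x \<in> (\<Union>w\<in>lists letters. word fs w -` ?V \<inter> Sph)" by blast
  qed
  moreover have "(\<Union>w\<in>lists letters. word fs w -` ?V \<inter> Sph) \<in> null_sets m"
  proof (rule null_sets_UN')
    fix w assume "w \<in> lists letters"
    then have w: "set w \<subseteq> letters" by (auto simp: in_lists_conv_set)
    have "word fs w -` ?V \<inter> Sph \<in> sets SB"
      using measurable_sets[OF word_measurable[OF w] V] by (simp only: space_sphere_borel)
    then show "word fs w -` ?V \<inter> Sph \<in> null_sets m"
      using null_preimage[OF w V V0] by (simp only: null_sets_def sets_m mem_Collect_eq)
  qed simp
  ultimately have "emeasure m Sph = 0"
    by (metis (no_types, lifting) emeasure_mono le_zero_eq null_setsD1 null_setsD2)
  then show False using m.emeasure_space_1 by simp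
qed

text \<open>Working on the product collects the exceptional sets of all starting points in one null
  set. Fubini then gives, for almost every \<open>\<omega>\<close>, convergence from
  \<open>m\<close>-almost every starting point.\<close>

lemma contract_product:
  "AE z in N \<Otimes>\<^sub>M m. (\<lambda>n. norm (back_comp fs (fst z) n (snd z) - back_comp fs (fst z) n x0)) \<longlonglongrightarrow> 0"
proof -
  interpret P: pair_sigma_finite N m ..
  have c: "measurable (N \<Otimes>\<^sub>M m) = measurable (N \<Otimes>\<^sub>M SB)" by (intro ext measurable_cong_sets sets_pair_measure_cong) auto
  have [measurable]: "(\<lambda>z. back_comp fs (fst z) n (snd z)) \<in> borel_measurable (N \<Otimes>\<^sub>M m)" for n
    using measurable_compose[OF back_comp_measurable sphere_borel_measurable_ident] by (simp add: c)
  have [measurable]: "(\<lambda>z. back_comp fs (fst z) n x0) \<in> borel_measurable (N \<Otimes>\<^sub>M m)" for n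
    by (rule measurable_compose[OF measurable_fst back_comp_measurable_section[OF x0]])
  let ?X = "\<lambda>n z. norm (back_comp fs (fst z) n (snd z) - back_comp fs (fst z) n x0)"
  have "AE z in N \<Otimes>\<^sub>M m. \<exists>c. \<forall>n. ?X n z \<le> c * (sqrt r powr (1 / s)) ^ n"
  proof (rule AE_geometric_decay[OF _ _ s_pos r_pos r_less])
    show "0 \<le> K * 2 powr s" using K_nonneg by simp
    fix n
    have "(\<integral>\<^sup>+z. ennreal (?X n z powr s) \<partial>(N \<Otimes>\<^sub>M m)) = (\<integral>\<^sup>+x. \<integral>\<^sup>+\<omega>. ennreal (?X n (\<omega>, x) powr s) \<partial>N \<partial>m)"
      by (rule P.nn_integral_snd[symmetric]) measurable
    also have "\<dots> \<le> (\<integral>\<^sup>+x. ennreal (K * 2 powr s * r ^ n) \<partial>m)"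
    proof (rule nn_integral_mono)
      fix x assume "x \<in> space m"
      then have "x \<in> Sph" by simp
      from contract_back[OF this x0, of n]
      show "(\<integral>\<^sup>+\<omega>. ennreal (?X n (\<omega>, x) powr s) \<partial>N) \<le> ennreal (K * 2 powr s * r ^ n)" by simp
    qed
    also have "\<dots> = ennreal (K * 2 powr s * r ^ n)" using m.emeasure_space_1 by simp
    finally show "(\<integral>\<^sup>+z. ennreal (?X n z powr s) \<partial>(N \<Otimes>\<^sub>M m)) \<le> ennreal (K * 2 powr s * r ^ n)" .
  qed auto
  then show ?thesis
  proof eventually_elim
    case (elim z)
    then obtain c where c: "\<And>n. ?X n z \<le> c * \<theta> ^ n" unfolding \<theta>_def by blast
    have "(\<lambda>n. c * \<theta> ^ n) \<longlonglongrightarrow> c * 0" using \<theta> by (intro tendsto_intros LIMSEQ_power_zero) auto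
    then have l: "(\<lambda>n. c * \<theta> ^ n) \<longlonglongrightarrow> 0" by simp
    show ?case by (rule tendsto_sandwich[OF _ _ tendsto_const l]) (auto intro!: always_eventually c)
  qed
qed

text \<open>Almost every starting point follows \<open>x0\<close>, so the reversed compositions tend
  to the constant \<open>Z \<omega>\<close> \<open>m\<close>-almost everywhere, and dominated
  convergence handles continuous test functions.\<close>

lemma AE_weak_star:
  "AE \<omega> in N. weak_star_conv (\<lambda>j. distr m SB (back_comp fs \<omega> j)) (return SB (Z \<omega>))"
proof -
  interpret P: pair_sigma_finite N m ..
  have "AE \<omega> in N. AE x in m. (\<lambda>n. norm (back_comp fs \<omega> n x - back_comp fs \<omega> n x0)) \<longlonglongrightarrow> 0"
    using P.AE_pair[OF contract_product] by simp
  then show ?thesis using AE_Z AE_space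
  proof eventually_elim
    case (elim \<omega>)
    note lim = elim(2) and w = elim(3)
    have bm: "back_comp fs \<omega> j \<in> measurable m SB" for j
    proof -
      have "set (map (\<lambda>i. \<omega> (j - 1 - i)) [0..<j]) \<subseteq> letters" by (rule N_words[OF elim(3)])
      from word_measurable[OF this] have "back_comp fs \<omega> j \<in> measurable SB SB"
        by (simp add: back_comp_def ifs_iter_word)
      then show ?thesis by (simp cong: measurable_cong_sets)
    qed
    show ?case unfolding weak_star_conv_def
    proof (intro allI impI)
      fix g :: "'a \<Rightarrow> real" assume g: "continuous_on Sph g"
      have gm: "g \<in> borel_measurable SB" by (rule measurable_sphere_borel[OF g])
      have "compact (g ` Sph)" by (rule compact_continuous_image[OF g]) simp
      then obtain B where B: "\<And>x. x \<in> Sph \<Longrightarrow> \<bar>g x\<bar> \<le> B"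
        using compact_imp_bounded[of "g ` Sph"] unfolding bounded_real by blast
      have "(\<lambda>j. \<integral>x. g (back_comp fs \<omega> j x) \<partial>m) \<longlonglongrightarrow> (\<integral>x. g (Z \<omega>) \<partial>m)"
      proof (rule integral_dominated_convergence[where w="\<lambda>_. B"])
        show "(\<lambda>x. g (back_comp fs \<omega> j x)) \<in> borel_measurable m" for j
          by (rule measurable_compose[OF bm gm])
        show "AE x in m. norm (g (back_comp fs \<omega> j x)) \<le> B" for j
          using back_comp_Sph[OF elim(3)] B by (intro AE_I2) simp
        show "AE x in m. (\<lambda>j. g (back_comp fs \<omega> j x)) \<longlonglongrightarrow> g (Z \<omega>)"
          using elim(1) AE_space
        proof eventually_elim
          case (elim x)
          have "(\<lambda>n. back_comp fs \<omega> n x - back_comp fs \<omega> n x0) \<longlonglongrightarrow> 0"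
            by (rule tendsto_norm_zero_cancel[OF elim(1)])
          from tendsto_add[OF this lim] have "(\<lambda>n. back_comp fs \<omega> n x) \<longlonglongrightarrow> Z \<omega>" by simp
          moreover have "\<forall>\<^sub>F n in sequentially. back_comp fs \<omega> n x \<in> Sph"
            by (intro always_eventually allI back_comp_Sph[OF w]) (use elim(2) in simp)
          ultimately show ?case by (rule continuous_on_tendsto_compose[OF g _ Z_Sph])
        qed
      qed auto
      moreover have "(\<integral>x. g (Z \<omega>) \<partial>m) = (\<integral>x. g x \<partial>return SB (Z \<omega>))"
        using gm Z_Sph m.prob_space by (subst integral_return) auto
      moreover have "(\<integral>x. g (back_comp fs \<omega> j x) \<partial>m) = (\<integral>x. g x \<partial>distr m SB (back_comp fs \<omega> j))" for j
        by (rule integral_distr[symmetric, OF bm gm])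
      ultimately show "(\<lambda>j. \<integral>x. g x \<partial>distr m SB (back_comp fs \<omega> j)) \<longlonglongrightarrow> (\<integral>x. g x \<partial>return SB (Z \<omega>))" by simp
    qed
  qed
qed

lemma delta_conditionals_m: "delta_conditionals fs p m"
proof -
  have inj: "inj (\<lambda>i::nat. - 1 - int i)" by (auto intro: injI)
  have "AE \<omega> in distr (nu_two (length fs) p) N (\<lambda>\<omega> i. \<omega> (- 1 - int i)).
      weak_star_conv (\<lambda>j. distr m SB (back_comp fs \<omega> j)) (return SB (Z \<omega>))"
    unfolding reindex_nu_two(2)[OF inj] by (rule AE_weak_star)
  from AE_distrD[OF reindex_nu_two(1)[OF inj] this]
  show ?thesis unfolding delta_conditionals_def back_iter_back_comp
    by (rule eventually_mono) (use Z_Sph in blast)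
qed

end

section \<open>Lyapunov exponents\<close>

lemma C1_on_Sph_Lipschitz:
  assumes f: "C1_on_Sph f f'" and S: "\<And>x. x \<in> Sph \<Longrightarrow> f x \<in> Sph"
  shows "\<exists>L\<ge>1. \<forall>x\<in>Sph. \<forall>y\<in>Sph. norm (f x - f y) \<le> L * norm (x - y)"
proof -
  have "compact (f' ` Sph)" using f unfolding C1_on_Sph_def by (intro compact_continuous_image) auto
  then obtain B where B: "\<And>x. x \<in> Sph \<Longrightarrow> norm (f' x) \<le> B"
    using compact_imp_bounded[of "f' ` Sph"] unfolding bounded_iff by blast
  \<comment> \<open>One constant has to bound both the derivative and the map itself, whose values
    are unit vectors.\<close>
  define d where "d = max 1 B"
  have "norm (f x - f y) \<le> 2 * d * norm (x - y)" if "x \<in> Sph" "y \<in> Sph" for x y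
  proof (rule tangential_bound_imp_Lipschitz[OF f _ _ that])
    fix x :: 'a assume x: "x \<in> Sph"
    show "norm (f x) \<le> d" using S[OF x] by (simp add: d_def)
    fix v :: 'a assume "norm v = 1"
    then have "norm (blinfun_apply (f' x) v) \<le> norm (f' x)" using norm_blinfun[of "f' x" v] by simp
    then show "norm (blinfun_apply (f' x) v) \<le> d" using B[OF x] by (simp add: d_def)
  qed
  moreover have "2 * d \<ge> 1" by (simp add: d_def)
  ultimately show ?thesis by blast
qed

lemma sphere_diffeo_bi_Lipschitz:
  assumes "sphere_diffeo f"
  shows "\<exists>L\<ge>1. \<forall>x\<in>Sph. \<forall>y\<in>Sph. norm (f x - f y) \<le> L * norm (x - y) \<and> norm (x - y) \<le> L * norm (f x - f y)"
proof -
  obtain g where g: "C1_near Sph g" "\<And>x. x \<in> Sph \<Longrightarrow> g x \<in> Sph" "\<And>x. x \<in> Sph \<Longrightarrow> g (f x) = x"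
    using assms unfolding sphere_diffeo_def by blast
  obtain f' g' where "C1_on_Sph f f'" "C1_on_Sph g g'"
    using sphere_diffeoD(2)[OF assms] C1_near_imp_C1_on_Sph[OF g(1)] by blast
  then obtain L1 L2 where L: "L1 \<ge> 1" "L2 \<ge> 1"
    "\<And>x y. x \<in> Sph \<Longrightarrow> y \<in> Sph \<Longrightarrow> norm (f x - f y) \<le> L1 * norm (x - y)"
    "\<And>x y. x \<in> Sph \<Longrightarrow> y \<in> Sph \<Longrightarrow> norm (g x - g y) \<le> L2 * norm (x - y)"
    using C1_on_Sph_Lipschitz[of f f'] C1_on_Sph_Lipschitz[of g g'] sphere_diffeoD(3)[OF assms] g(2) by metis
  let ?L = "max L1 L2"
  have "norm (f x - f y) \<le> ?L * norm (x - y) \<and> norm (x - y) \<le> ?L * norm (f x - f y)"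
    if xy: "x \<in> Sph" "y \<in> Sph" for x y
  proof
    have "norm (f x - f y) \<le> L1 * norm (x - y)" by (rule L(3)[OF xy])
    also have "\<dots> \<le> ?L * norm (x - y)" by (intro mult_right_mono) auto
    finally show "norm (f x - f y) \<le> ?L * norm (x - y)" .
    have "norm (x - y) \<le> L2 * norm (f x - f y)"
      using L(4)[of "f x" "f y"] sphere_diffeoD(3)[OF assms] xy g(3) by simp
    also have "\<dots> \<le> ?L * norm (f x - f y)" by (intro mult_right_mono) auto
    finally show "norm (x - y) \<le> ?L * norm (f x - f y)" .
  qed
  moreover have "?L \<ge> 1" using L by simp
  ultimately show ?thesis by blast
qed

context sphere_ifs
begin

lemma ex_bi_Lipschitz:
  "\<exists>L\<ge>1. \<forall>i\<in>letters. \<forall>x\<in>Sph. \<forall>y\<in>Sph. norm ((fs ! i) x - (fs ! i) y) \<le> L * norm (x - y)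
      \<and> norm (x - y) \<le> L * norm ((fs ! i) x - (fs ! i) y)"
proof -
  have "\<forall>i\<in>letters. \<exists>L\<ge>1. \<forall>x\<in>Sph. \<forall>y\<in>Sph. norm ((fs ! i) x - (fs ! i) y) \<le> L * norm (x - y)
      \<and> norm (x - y) \<le> L * norm ((fs ! i) x - (fs ! i) y)"
    using sphere_diffeo_bi_Lipschitz[OF diffeo] by blast
  then obtain l where l: "\<And>i. i \<in> letters \<Longrightarrow> l i \<ge> (1::real)"
    "\<And>i x y. i \<in> letters \<Longrightarrow> x \<in> Sph \<Longrightarrow> y \<in> Sph \<Longrightarrow> norm ((fs ! i) x - (fs ! i) y) \<le> l i * norm (x - y)
      \<and> norm (x - y) \<le> l i * norm ((fs ! i) x - (fs ! i) y)"
    by metis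
  define L where "L = 1 + (\<Sum>i\<in>letters. l i)"
  have L: "l i \<le> L" if "i \<in> letters" for i
  proof -
    have "l i \<le> (\<Sum>i\<in>letters. l i)" by (rule member_le_sum) (use that l(1) in \<open>auto intro: order_trans[of 0 1]\<close>)
    then show ?thesis by (simp add: L_def)
  qed
  have "L \<ge> 1" unfolding L_def using sum_nonneg[of letters l] order_trans[OF zero_le_one l(1)] by simp
  moreover have "norm ((fs ! i) x - (fs ! i) y) \<le> L * norm (x - y) \<and> norm (x - y) \<le> L * norm ((fs ! i) x - (fs ! i) y)"
    if "i \<in> letters" "x \<in> Sph" "y \<in> Sph" for i x y
    using l(2)[OF that] mult_right_mono[OF L[OF that(1)] norm_ge_zero[of "x - y"]]
      mult_right_mono[OF L[OF that(1)] norm_ge_zero[of "(fs ! i) x - (fs ! i) y"]] by linarith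
  ultimately show ?thesis by blast
qed

text \<open>Bounds the growth of derivatives per step from both sides, which yields the linear bound
  on its logarithm that the ergodic theorem asks for.\<close>

definition \<Lambda> :: real where
  "\<Lambda> = (SOME L. L \<ge> 1 \<and> (\<forall>i\<in>letters. \<forall>x\<in>Sph. \<forall>y\<in>Sph. norm ((fs ! i) x - (fs ! i) y) \<le> L * norm (x - y)
      \<and> norm (x - y) \<le> L * norm ((fs ! i) x - (fs ! i) y)))"

lemma \<Lambda>: "\<Lambda> \<ge> 1"
  "\<lbrakk>i \<in> letters; x \<in> Sph; y \<in> Sph\<rbrakk> \<Longrightarrow> norm ((fs ! i) x - (fs ! i) y) \<le> \<Lambda> * norm (x - y)"
  "\<lbrakk>i \<in> letters; x \<in> Sph; y \<in> Sph\<rbrakk> \<Longrightarrow> norm (x - y) \<le> \<Lambda> * norm ((fs ! i) x - (fs ! i) y)"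
  using someI_ex[OF ex_bi_Lipschitz] unfolding \<Lambda>_def[symmetric] by blast+

lemma iter_bi_Lipschitz:
  assumes w: "\<omega> \<in> space N" and x: "x \<in> Sph" and y: "y \<in> Sph"
  shows "norm (ifs_iter fs \<omega> n x - ifs_iter fs \<omega> n y) \<le> \<Lambda> ^ n * norm (x - y) \<and>
    norm (x - y) \<le> \<Lambda> ^ n * norm (ifs_iter fs \<omega> n x - ifs_iter fs \<omega> n y)"
proof (induction n)
  case (Suc n)
  let ?x = "ifs_iter fs \<omega> n x" and ?y = "ifs_iter fs \<omega> n y"
  have i: "\<omega> n \<in> letters" using w by (simp add: space_N)
  have "norm ((fs ! \<omega> n) ?x - (fs ! \<omega> n) ?y) \<le> \<Lambda> * norm (?x - ?y)"
    by (intro \<Lambda> i iter_Sph w x y)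
  also have "\<dots> \<le> \<Lambda> * (\<Lambda> ^ n * norm (x - y))" using Suc \<Lambda>(1) by (intro mult_left_mono) auto
  finally have 1: "norm ((fs ! \<omega> n) ?x - (fs ! \<omega> n) ?y) \<le> \<Lambda> * (\<Lambda> ^ n * norm (x - y))" .
  have "norm (x - y) \<le> \<Lambda> ^ n * norm (?x - ?y)" using Suc by simp
  also have "\<dots> \<le> \<Lambda> ^ n * (\<Lambda> * norm ((fs ! \<omega> n) ?x - (fs ! \<omega> n) ?y))"
    using \<Lambda>(1) by (intro mult_left_mono \<Lambda>(3) i iter_Sph w x y) auto
  finally show ?case using 1 by (simp add: mult_ac)
qed simp

section \<open>Growth of tangential derivatives along orbits\<close>

abbreviation "D \<omega> n x \<equiv> frechet_derivative (ifs_iter fs \<omega> n) (at x)"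

definition tangent_growth :: "(nat \<Rightarrow> nat) \<Rightarrow> nat \<Rightarrow> 'a \<Rightarrow> real" where
  "tangent_growth \<omega> n x = tangent_opnorm (D \<omega> n x) x"

lemma iter_has_derivative:
  assumes w: "\<omega> \<in> space N" and x: "x \<in> Sph"
  shows "(ifs_iter fs \<omega> n has_derivative D \<omega> n x) (at x)"
proof -
  have "set (map \<omega> [0..<n]) \<subseteq> letters" using w by (auto simp: space_N)
  then obtain F' where F: "C1_on_Sph (ifs_iter fs \<omega> n) F'" using word_C1(1) unfolding ifs_iter_word by blast
  then show ?thesis using C1_on_Sph_frechet[OF F x] x unfolding C1_on_Sph_def by simp
qed

lemma D_bounded_linear: "\<omega> \<in> space N \<Longrightarrow> x \<in> Sph \<Longrightarrow> bounded_linear (D \<omega> n x)"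
  using iter_has_derivative has_derivative_bounded_linear by blast

lemma D_le:
  assumes w: "\<omega> \<in> space N" and x: "x \<in> Sph" and v: "norm v = 1" "inner v x = 0"
  shows "norm (D \<omega> n x v) \<le> \<Lambda> ^ n" and "norm (D \<omega> n x v) \<ge> 1 / \<Lambda> ^ n"
proof -
  have nx: "norm x = 1" using x by simp
  show "norm (D \<omega> n x v) \<le> \<Lambda> ^ n"
    by (rule tangential_derivative_le[OF iter_has_derivative[OF w x] nx v])
      (use iter_bi_Lipschitz[OF w _ x] in blast)
  have L: "\<Lambda> ^ n > 0" using \<Lambda>(1) by simp
  show "norm (D \<omega> n x v) \<ge> 1 / \<Lambda> ^ n"
  proof (rule tangential_derivative_ge[OF iter_has_derivative[OF w x] nx v])
    fix y :: 'a assume "y \<in> Sph"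
    then have "norm (y - x) \<le> \<Lambda> ^ n * norm (ifs_iter fs \<omega> n y - ifs_iter fs \<omega> n x)"
      using iter_bi_Lipschitz[OF w _ x] by blast
    then show "1 / \<Lambda> ^ n * norm (y - x) \<le> norm (ifs_iter fs \<omega> n y - ifs_iter fs \<omega> n x)"
      using L by (simp add: field_simps)
  qed
qed

lemma tangent_growth_bounds:
  assumes w: "\<omega> \<in> space N" and x: "x \<in> Sph"
  shows "tangent_growth \<omega> n x \<le> \<Lambda> ^ n" "1 / \<Lambda> ^ n \<le> tangent_growth \<omega> n x" "0 < tangent_growth \<omega> n x"
proof -
  show "tangent_growth \<omega> n x \<le> \<Lambda> ^ n" unfolding tangent_growth_def by (rule tangent_opnorm_least[OF dim]) (use D_le(1)[OF w x] in blast)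
  obtain v where v: "inner v x = 0" "norm v = 1" using exists_unit_tangent[OF dim] .
  show *: "1 / \<Lambda> ^ n \<le> tangent_growth \<omega> n x"
    using D_le(2)[OF w x v(2,1), of n] tangent_opnorm_upper[OF D_bounded_linear[OF w x, of n] v]
    unfolding tangent_growth_def by linarith
  have "1 / \<Lambda> ^ n > 0" using \<Lambda>(1) by simp
  with * show "0 < tangent_growth \<omega> n x" by linarith
qed

lemma shift_space: "\<omega> \<in> space N \<Longrightarrow> (\<lambda>i. \<omega> (i + k)) \<in> space N"
  by (simp add: space_N)

text \<open>The chain rule alone does not suffice: by \<open>derivative_tangent\<close> the image of
  a tangent vector is again tangent, so the tangential norm of the second factor applies to
  it.\<close>

lemma tangent_growth_submult:
  assumes w: "\<omega> \<in> space N" and x: "x \<in> Sph"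
  shows "tangent_growth \<omega> (k + n) x \<le> tangent_growth \<omega> k x * tangent_growth (\<lambda>i. \<omega> (i + k)) n (ifs_iter fs \<omega> k x)"
  unfolding tangent_growth_def[of \<omega> "k + n"]
proof (rule tangent_opnorm_least[OF dim])
  fix v assume v: "inner v x = 0" "norm v = 1"
  let ?y = "ifs_iter fs \<omega> k x" and ?w = "\<lambda>i. \<omega> (i + k)"
  have y: "?y \<in> Sph" by (rule iter_Sph[OF w x])
  have "(ifs_iter fs ?w n \<circ> ifs_iter fs \<omega> k has_derivative D ?w n ?y \<circ> D \<omega> k x) (at x)"
    by (rule diff_chain_at[OF iter_has_derivative[OF w x] iter_has_derivative[OF shift_space[OF w] y]])
  then have c: "D \<omega> (k + n) x = D ?w n ?y \<circ> D \<omega> k x"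
    unfolding ifs_iter_add by (metis frechet_derivative_at)
  have t: "inner (D \<omega> k x v) ?y = 0"
    by (rule derivative_tangent[OF iter_has_derivative[OF w x] x v(1) iter_Sph[OF w]])
  have "norm (D \<omega> (k + n) x v) \<le> tangent_growth ?w n ?y * norm (D \<omega> k x v)"
    unfolding c comp_def tangent_growth_def by (rule tangent_opnorm_upper'[OF D_bounded_linear[OF shift_space[OF w] y] t])
  also have "\<dots> \<le> tangent_growth ?w n ?y * tangent_growth \<omega> k x"
    using tangent_opnorm_upper[OF D_bounded_linear[OF w x] v] tangent_growth_bounds(3)[OF shift_space[OF w] y, of k n]
    unfolding tangent_growth_def[of \<omega>] by (intro mult_left_mono) auto
  finally show "norm (D \<omega> (k + n) x v) \<le> tangent_growth \<omega> k x * tangent_growth ?w n ?y" by (simp add: mult.commute)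
qed

lemma tangent_growth_measurable: "(\<lambda>z. tangent_growth (fst z) n (snd z)) \<in> borel_measurable (N \<Otimes>\<^sub>M SB)"
proof -
  have "(\<lambda>z. tangent_opnorm (frechet_derivative (word fs (map (fst z) [0..<n])) (at (snd z))) (snd z)) \<in> borel_measurable (N \<Otimes>\<^sub>M SB)"
  proof (rule words_measurable[where G="\<lambda>w x. tangent_opnorm (frechet_derivative (word fs w) (at x)) x"])
    fix w assume "set w \<subseteq> letters"
    then obtain F' where "C1_on_Sph (word fs w) F'" using word_C1(1) by blast
    then show "(\<lambda>x. tangent_opnorm (frechet_derivative (word fs w) (at x)) x) \<in> borel_measurable SB"
      by (intro measurable_sphere_borel continuous_tangent_opnorm[OF dim])
  qed
  then show ?thesis unfolding tangent_growth_def ifs_iter_word .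
qed

lemma D_section_measurable:
  assumes "x \<in> Sph" shows "(\<lambda>\<omega>. D \<omega> n x v) \<in> borel_measurable N"
proof -
  have "(\<lambda>z. frechet_derivative (word fs (map (fst z) [0..<n])) (at x) v) \<in> borel_measurable (N \<Otimes>\<^sub>M SB)"
    by (rule words_measurable[where G="\<lambda>w _. frechet_derivative (word fs w) (at x) v"]) simp
  from measurable_section[OF this assms] show ?thesis by (simp add: ifs_iter_word)
qed

text \<open>Moment bounds are available for one fixed vector at a time. The projected basis vectors
  reduce the supremum over all unit tangent vectors to finitely many fixed ones.\<close>

lemma tangent_growth_le_sum:
  assumes w: "\<omega> \<in> space N" and x: "x \<in> Sph"
  shows "tangent_growth \<omega> n x \<le> (\<Sum>b\<in>Basis. norm (D \<omega> n x (blinfun_apply (tproj x) b)))"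
  unfolding tangent_growth_def
proof (rule tangent_opnorm_least[OF dim])
  fix v assume v: "inner v x = 0" "norm v = 1"
  interpret bounded_linear "D \<omega> n x" by (rule D_bounded_linear[OF w x])
  have "v = blinfun_apply (tproj x) v" using v by (simp add: tproj_apply)
  also have "\<dots> = blinfun_apply (tproj x) (\<Sum>b\<in>Basis. inner v b *\<^sub>R b)" by (simp add: euclidean_representation)
  also have "\<dots> = (\<Sum>b\<in>Basis. inner v b *\<^sub>R blinfun_apply (tproj x) b)"
    by (simp add: blinfun.sum_right blinfun.scaleR_right)
  finally have "D \<omega> n x v = (\<Sum>b\<in>Basis. inner v b *\<^sub>R D \<omega> n x (blinfun_apply (tproj x) b))"
    by (metis (no_types, lifting) sum scaleR sum.cong)
  also have "norm \<dots> \<le> (\<Sum>b\<in>Basis. norm (inner v b *\<^sub>R D \<omega> n x (blinfun_apply (tproj x) b)))" by (rule norm_sum)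
  also have "\<dots> \<le> (\<Sum>b\<in>Basis. norm (D \<omega> n x (blinfun_apply (tproj x) b)))"
  proof (rule sum_mono)
    fix b :: 'a assume "b \<in> Basis"
    then have "\<bar>inner v b\<bar> \<le> 1" using Basis_le_norm[of b v] v by simp
    then show "norm (inner v b *\<^sub>R D \<omega> n x (blinfun_apply (tproj x) b)) \<le> norm (D \<omega> n x (blinfun_apply (tproj x) b))"
      by (simp add: mult_left_le_one_le)
  qed
  finally show "norm (D \<omega> n x v) \<le> (\<Sum>b\<in>Basis. norm (D \<omega> n x (blinfun_apply (tproj x) b)))" .
qed

end

context contracting_ifs
begin

text \<open>The two-point bound is divided by \<open>t l\<close> at points \<open>y l\<close> of the
  great circle through \<open>x\<close> in direction \<open>v\<close>. Since
  \<open>norm (y l - x) / t l\<close> tends to 1, the constant \<open>K * r ^ n\<close> survives the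
  limit.\<close>

lemma moment_D:
  assumes x: "x \<in> Sph" and v: "inner v x = 0" "norm v = 1"
  shows "(\<integral>\<^sup>+\<omega>. ennreal (norm (D \<omega> n x v) powr s) \<partial>N) \<le> ennreal (K * r ^ n)"
proof -
  have nx: "norm x = 1" using x by simp
  define t where "t l = 1 / real (Suc l)" for l :: nat
  define y where "y l = circ x v (t l)" for l
  have t0: "t l > 0" for l by (simp add: t_def)
  have yS: "y l \<in> Sph" for l unfolding y_def by (rule circ_Sph[OF nx v(2,1)])
  have tl: "filterlim t (at 0) sequentially"
    unfolding filterlim_at t_def using LIMSEQ_inverse_real_of_nat by (auto simp: inverse_eq_divide)
  have lim: "(\<lambda>l. norm (g (y l) - g x) / t l) \<longlonglongrightarrow> norm (g' v)" if "(g has_derivative g') (at x)" for g g'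
  proof -
    have "(\<lambda>l. norm ((g (y l) - g x) /\<^sub>R t l)) \<longlonglongrightarrow> norm (g' v)"
      unfolding y_def by (rule tendsto_norm[OF filterlim_compose[OF circ_quotient[OF that] tl]])
    then show ?thesis using t0 by (simp add: divide_inverse mult.commute less_imp_le)
  qed
  have m[measurable]: "(\<lambda>\<omega>. ifs_iter fs \<omega> n (y l)) \<in> borel_measurable N" "(\<lambda>\<omega>. ifs_iter fs \<omega> n x) \<in> borel_measurable N" for l
    using iter_measurable_section yS x by auto
  have "(\<integral>\<^sup>+\<omega>. ennreal (norm (D \<omega> n x v) powr s) \<partial>N) =
      (\<integral>\<^sup>+\<omega>. liminf (\<lambda>l. ennreal ((norm (ifs_iter fs \<omega> n (y l) - ifs_iter fs \<omega> n x) / t l) powr s)) \<partial>N)"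
  proof (rule nn_integral_cong)
    fix \<omega> assume w: "\<omega> \<in> space N"
    have "(\<lambda>l. ennreal ((norm (ifs_iter fs \<omega> n (y l) - ifs_iter fs \<omega> n x) / t l) powr s)) \<longlonglongrightarrow> ennreal (norm (D \<omega> n x v) powr s)"
      by (intro tendsto_ennrealI tendsto_powr' lim[OF iter_has_derivative[OF w x]] tendsto_const)
        (use s_pos t0 in \<open>auto simp: less_imp_le\<close>)
    from lim_imp_Liminf[OF _ this]
    show "ennreal (norm (D \<omega> n x v) powr s) =
      liminf (\<lambda>l. ennreal ((norm (ifs_iter fs \<omega> n (y l) - ifs_iter fs \<omega> n x) / t l) powr s))" by simp
  qed
  also have "\<dots> \<le> liminf (\<lambda>l. \<integral>\<^sup>+\<omega>. ennreal ((norm (ifs_iter fs \<omega> n (y l) - ifs_iter fs \<omega> n x) / t l) powr s) \<partial>N)"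
    by (rule nn_integral_liminf) measurable
  also have "\<dots> \<le> liminf (\<lambda>l. ennreal (K * r ^ n * (norm (y l - x) / t l) powr s))"
  proof (rule Liminf_mono, rule always_eventually, rule allI)
    fix l
    have "(\<integral>\<^sup>+\<omega>. ennreal ((norm (ifs_iter fs \<omega> n (y l) - ifs_iter fs \<omega> n x) / t l) powr s) \<partial>N) =
        (\<integral>\<^sup>+\<omega>. ennreal (1 / t l powr s) * ennreal (norm (ifs_iter fs \<omega> n (y l) - ifs_iter fs \<omega> n x) powr s) \<partial>N)"
      using t0[of l] by (intro nn_integral_cong) (simp add: powr_divide less_imp_le flip: ennreal_mult)
    also have "\<dots> = ennreal (1 / t l powr s) * (\<integral>\<^sup>+\<omega>. ennreal (norm (ifs_iter fs \<omega> n (y l) - ifs_iter fs \<omega> n x) powr s) \<partial>N)"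
      by (rule nn_integral_cmult) measurable
    also have "\<dots> \<le> ennreal (1 / t l powr s) * ennreal (K * r ^ n * norm (y l - x) powr s)"
      by (intro mult_left_mono contract yS x) simp
    also have "\<dots> = ennreal (K * r ^ n * (norm (y l - x) / t l) powr s)"
      using t0[of l] K_nonneg r_pos by (simp add: powr_divide less_imp_le flip: ennreal_mult)
    finally show "(\<integral>\<^sup>+\<omega>. ennreal ((norm (ifs_iter fs \<omega> n (y l) - ifs_iter fs \<omega> n x) / t l) powr s) \<partial>N)
      \<le> ennreal (K * r ^ n * (norm (y l - x) / t l) powr s)" .
  qed
  also have "\<dots> = ennreal (K * r ^ n * norm v powr s)"
  proof (rule lim_imp_Liminf)
    show "(\<lambda>l. ennreal (K * r ^ n * (norm (y l - x) / t l) powr s)) \<longlonglongrightarrow> ennreal (K * r ^ n * norm v powr s)"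
      by (intro tendsto_ennrealI tendsto_mult tendsto_powr' lim[of "\<lambda>x. x" "\<lambda>x. x"] tendsto_const has_derivative_ident)
        (use s_pos t0 in \<open>auto simp: less_imp_le\<close>)
  qed simp
  finally show ?thesis using v by simp
qed

lemma moment_opn:
  assumes x: "x \<in> Sph"
  shows "(\<integral>\<^sup>+\<omega>. ennreal (tangent_growth \<omega> n x powr s) \<partial>N) \<le> ennreal (real DIM('a) powr s * real DIM('a) * K * r ^ n)"
proof -
  let ?d = "real DIM('a)"
  have nx: "norm x = 1" using x by simp
  let ?v = "\<lambda>b. blinfun_apply (tproj x) b"
  note [measurable] = D_section_measurable[OF x]
  have "(\<integral>\<^sup>+\<omega>. ennreal (tangent_growth \<omega> n x powr s) \<partial>N) \<le>
    (\<integral>\<^sup>+\<omega>. ennreal (?d powr s) * (\<Sum>b\<in>Basis. ennreal (norm (D \<omega> n x (?v b)) powr s)) \<partial>N)"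
  proof (rule nn_integral_mono)
    fix \<omega> assume w: "\<omega> \<in> space N"
    let ?a = "\<lambda>b. norm (D \<omega> n x (?v b))"
    \<comment> \<open>Bounding the sum by its largest term before taking the power works for every
      \<open>s > 0\<close>, without any convexity.\<close>
    define M where "M = Max (?a ` (Basis :: 'a set))"
    obtain b where b: "b \<in> Basis" "M = ?a b"
      using Max_in[of "?a ` (Basis :: 'a set)"] unfolding M_def
      by (metis (no_types, lifting) finite_Basis finite_imageI image_is_empty nonempty_Basis imageE)
    have "tangent_growth \<omega> n x \<le> (\<Sum>b\<in>Basis. ?a b)" by (rule tangent_growth_le_sum[OF w x])
    also have "\<dots> \<le> (\<Sum>b\<in>(Basis :: 'a set). M)" by (rule sum_mono) (simp add: M_def)
    finally have "tangent_growth \<omega> n x \<le> ?d * ?a b" using b by simp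
    then have "tangent_growth \<omega> n x powr s \<le> (?d * ?a b) powr s"
      using s_pos tangent_growth_bounds(3)[OF w x, of n] by (intro powr_mono2) auto
    also have "\<dots> = ?d powr s * ?a b powr s" by (simp add: powr_mult)
    also have "\<dots> \<le> ?d powr s * (\<Sum>b\<in>Basis. ?a b powr s)"
      by (intro mult_left_mono member_le_sum[where f="\<lambda>b. ?a b powr s"]) (use b in auto)
    finally have "ennreal (tangent_growth \<omega> n x powr s) \<le> ennreal (?d powr s * (\<Sum>b\<in>Basis. ?a b powr s))" by (rule ennreal_leI)
    then show "ennreal (tangent_growth \<omega> n x powr s) \<le> ennreal (?d powr s) * (\<Sum>b\<in>Basis. ennreal (?a b powr s))"
      by (simp add: ennreal_mult sum_nonneg sum_ennreal)
  qed
  also have "\<dots> = ennreal (?d powr s) * (\<Sum>b\<in>Basis. \<integral>\<^sup>+\<omega>. ennreal (norm (D \<omega> n x (?v b)) powr s) \<partial>N)"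
    by (subst nn_integral_cmult, measurable, subst nn_integral_sum, measurable)
  also have "\<dots> \<le> ennreal (?d powr s) * (\<Sum>b\<in>(Basis :: 'a set). ennreal (K * r ^ n))"
  proof (intro mult_left_mono sum_mono)
    fix b :: 'a assume "b \<in> Basis"
    have Kr: "0 \<le> K * r ^ n" using K_nonneg r_pos by simp
    show "(\<integral>\<^sup>+\<omega>. ennreal (norm (D \<omega> n x (?v b)) powr s) \<partial>N) \<le> ennreal (K * r ^ n)"
    \<comment> \<open>The projected vector vanishes when \<open>b\<close> is parallel to
      \<open>x\<close>. Otherwise its norm is at most 1, so normalising it for
      \<open>moment_D\<close> only increases the integrand.\<close>
    proof (cases "?v b = 0")
      case True
      have "(\<integral>\<^sup>+\<omega>. ennreal (norm (D \<omega> n x (?v b)) powr s) \<partial>N) = (\<integral>\<^sup>+\<omega>. 0 \<partial>N)"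
        using True by (intro nn_integral_cong) (simp add: linear_simps(3)[OF D_bounded_linear[OF _ x]])
      then show ?thesis by simp
    next
      case False
      let ?u = "?v b /\<^sub>R norm (?v b)"
      have n1: "norm (?v b) \<le> 1" using norm_tproj_le[OF nx, of b] \<open>b \<in> Basis\<close> by simp
      have u: "inner ?u x = 0" "norm ?u = 1" using False tproj_tangent[OF nx, of b] by auto
      have "(\<integral>\<^sup>+\<omega>. ennreal (norm (D \<omega> n x (?v b)) powr s) \<partial>N) \<le> (\<integral>\<^sup>+\<omega>. ennreal (norm (D \<omega> n x ?u) powr s) \<partial>N)"
      proof (rule nn_integral_mono)
        fix \<omega> assume w: "\<omega> \<in> space N"
        have "norm (D \<omega> n x ?u) = norm (D \<omega> n x (?v b)) / norm (?v b)"
          by (simp add: linear_simps(5)[OF D_bounded_linear[OF w x]] divide_inverse mult.commute)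
        then have "norm (D \<omega> n x (?v b)) \<le> norm (D \<omega> n x ?u)"
          using n1 False by (simp add: le_divide_eq mult_left_le)
        then show "ennreal (norm (D \<omega> n x (?v b)) powr s) \<le> ennreal (norm (D \<omega> n x ?u) powr s)"
          using s_pos by (intro ennreal_leI powr_mono2) auto
      qed
      also have "\<dots> \<le> ennreal (K * r ^ n)" by (rule moment_D[OF x u])
      finally show ?thesis .
    qed
  qed simp
  also have "\<dots> = ennreal (?d powr s * ?d * K * r ^ n)"
    using K_nonneg r_pos by (simp add: ennreal_of_nat_eq_real_of_nat mult.assoc flip: ennreal_mult)
  finally show ?thesis .
qed

section \<open>The one-sided skew product and its derivative cocycle\<close>

definition skew :: "(nat \<Rightarrow> nat) \<times> 'a \<Rightarrow> (nat \<Rightarrow> nat) \<times> 'a" where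
  "skew z = ((\<lambda>i. fst z (Suc i)), (fs ! fst z 0) (snd z))"

lemma skew_funpow: "(skew ^^ n) z = ((\<lambda>i. fst z (i + n)), ifs_iter fs (fst z) n (snd z))"
  by (induction n) (auto simp: skew_def)

lemma measurable_N_m: "measurable (N \<Otimes>\<^sub>M m) = measurable (N \<Otimes>\<^sub>M SB)" "measurable A (N \<Otimes>\<^sub>M m) = measurable A (N \<Otimes>\<^sub>M SB)"
  by (intro ext measurable_cong_sets sets_pair_measure_cong; simp)+

lemma skew_measurable: "skew \<in> measurable (N \<Otimes>\<^sub>M m) (N \<Otimes>\<^sub>M m)"
proof -
  have "(\<lambda>z. ((\<lambda>i. fst z (Suc i)), ifs_iter fs (fst z) 1 (snd z))) \<in> measurable (N \<Otimes>\<^sub>M SB) (N \<Otimes>\<^sub>M SB)"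
    by (intro measurable_Pair measurable_compose[OF measurable_fst reindex_N_measurable] iter_measurable)
  moreover have "(\<lambda>z. ((\<lambda>i. fst z (Suc i)), ifs_iter fs (fst z) 1 (snd z))) = skew"
    by (simp add: fun_eq_iff skew_def)
  ultimately show ?thesis unfolding measurable_N_m by (simp only:)
qed

text \<open>Rectangles suffice. Conditioning on the first letter \<open>i\<close> leaves
  \<open>A\<close> for the shifted sequence and the preimage of \<open>B\<close> under
  \<open>fs ! i\<close> for the point; \<open>emeasure_m_step\<close> adds these up.\<close>

lemma skew_preserves: "distr (N \<Otimes>\<^sub>M m) (N \<Otimes>\<^sub>M m) skew = N \<Otimes>\<^sub>M m"
proof (rule pair_measure_eqI[symmetric])
  show "sigma_finite_measure N" "sigma_finite_measure m" by unfold_locales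
  show "sets (N \<Otimes>\<^sub>M m) = sets (distr (N \<Otimes>\<^sub>M m) (N \<Otimes>\<^sub>M m) skew)" by simp
  fix A B assume A: "A \<in> sets N" and B: "B \<in> sets m"
  have BS: "B \<in> sets SB" using B by simp
  have AB: "A \<times> B \<in> sets (N \<Otimes>\<^sub>M m)" using A B by (rule pair_measureI)
  define P where "P = skew -` (A \<times> B) \<inter> space (N \<Otimes>\<^sub>M m)"
  have P: "P \<in> sets (N \<Otimes>\<^sub>M m)" unfolding P_def by (rule measurable_sets[OF skew_measurable AB])
  have "emeasure (distr (N \<Otimes>\<^sub>M m) (N \<Otimes>\<^sub>M m) skew) (A \<times> B) = emeasure (N \<Otimes>\<^sub>M m) P"
    unfolding P_def by (rule emeasure_distr[OF skew_measurable AB])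
  also have "\<dots> = (\<integral>\<^sup>+\<omega>. emeasure m (Pair \<omega> -` P) \<partial>N)" by (rule m.emeasure_pair_measure_alt[OF P])
  also have "\<dots> = (\<Sum>i\<in>letters. ennreal (p i) * (\<integral>\<^sup>+\<omega>. emeasure m (Pair (case_nat i \<omega>) -` P) \<partial>N))"
    by (rule nn_integral_N_step) (rule m.measurable_emeasure_Pair[OF P])
  also have "\<dots> = (\<Sum>i\<in>letters. ennreal (p i) * (emeasure N A * emeasure m ((fs ! i) -` B \<inter> Sph)))"
  proof (intro sum.cong refl arg_cong2[where f="(*)"])
    fix i assume i: "i \<in> letters"
    have "(\<integral>\<^sup>+\<omega>. emeasure m (Pair (case_nat i \<omega>) -` P) \<partial>N) = (\<integral>\<^sup>+\<omega>. emeasure m ((fs ! i) -` B \<inter> Sph) * indicator A \<omega> \<partial>N)"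
    proof (rule nn_integral_cong)
      fix \<omega> assume w: "\<omega> \<in> space N"
      have w': "case_nat i \<omega> \<in> space N" using w i by (auto simp: space_N split: nat.split)
      have "Pair (case_nat i \<omega>) -` P = (if \<omega> \<in> A then (fs ! i) -` B \<inter> Sph else {})"
        using w' unfolding P_def skew_def space_pair_measure by auto
      then show "emeasure m (Pair (case_nat i \<omega>) -` P) = emeasure m ((fs ! i) -` B \<inter> Sph) * indicator A \<omega>" by simp
    qed
    also have "\<dots> = emeasure N A * emeasure m ((fs ! i) -` B \<inter> Sph)"
      using A by (subst nn_integral_cmult_indicator) (auto simp: mult.commute)
    finally show "(\<integral>\<^sup>+\<omega>. emeasure m (Pair (case_nat i \<omega>) -` P) \<partial>N) = emeasure N A * emeasure m ((fs ! i) -` B \<inter> Sph)" .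
  qed
  also have "\<dots> = emeasure N A * emeasure m B"
    unfolding emeasure_m_step[OF BS] by (simp add: sum_distrib_left mult.left_commute)
  finally show "emeasure N A * emeasure m B = emeasure (distr (N \<Otimes>\<^sub>M m) (N \<Otimes>\<^sub>M m) skew) (A \<times> B)" by simp
qed

sublocale NM: pair_prob_space N m ..

lemma cocycle: "bounded_cocycle (N \<Otimes>\<^sub>M m) skew (\<lambda>n z. ln (tangent_growth (fst z) n (snd z))) (ln \<Lambda>)"
proof
  show "skew \<in> measurable (N \<Otimes>\<^sub>M m) (N \<Otimes>\<^sub>M m)" by (rule skew_measurable)
  show "distr (N \<Otimes>\<^sub>M m) (N \<Otimes>\<^sub>M m) skew = N \<Otimes>\<^sub>M m" by (rule skew_preserves)
  show "(\<lambda>z. ln (tangent_growth (fst z) n (snd z))) \<in> borel_measurable (N \<Otimes>\<^sub>M m)" for n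
    unfolding measurable_N_m by (rule borel_measurable_ln[OF tangent_growth_measurable])
  fix k n z assume "z \<in> space (N \<Otimes>\<^sub>M m)"
  then have z: "fst z \<in> space N" "snd z \<in> Sph" by (auto simp: space_pair_measure)
  let ?w = "\<lambda>i. fst z (i + k)" and ?y = "ifs_iter fs (fst z) k (snd z)"
  have y: "?w \<in> space N" "?y \<in> Sph" using shift_space iter_Sph z by auto
  have "ln (tangent_growth (fst z) (k + n) (snd z)) \<le> ln (tangent_growth (fst z) k (snd z) * tangent_growth ?w n ?y)"
    using tangent_growth_submult[OF z] tangent_growth_bounds(3)[OF z] by (simp add: tangent_growth_bounds(3)[OF y])
  also have "\<dots> = ln (tangent_growth (fst z) k (snd z)) + ln (tangent_growth ?w n ?y)"
    using less_imp_neq[OF tangent_growth_bounds(3)[OF z, of k]] less_imp_neq[OF tangent_growth_bounds(3)[OF y, of n]] by (simp add: ln_mult)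
  finally show "ln (tangent_growth (fst z) (k + n) (snd z)) \<le> ln (tangent_growth (fst z) k (snd z)) + ln (tangent_growth (fst ((skew ^^ k) z)) n (snd ((skew ^^ k) z)))"
    by (simp add: skew_funpow)
next
  fix n z assume "z \<in> space (N \<Otimes>\<^sub>M m)"
  then have z: "fst z \<in> space N" "snd z \<in> Sph" by (auto simp: space_pair_measure)
  have L: "\<Lambda> ^ n > 0" using \<Lambda>(1) by simp
  have "ln (tangent_growth (fst z) n (snd z)) \<le> ln (\<Lambda> ^ n)" using tangent_growth_bounds[OF z, of n] L by simp
  moreover have "ln (1 / \<Lambda> ^ n) \<le> ln (tangent_growth (fst z) n (snd z))"
    using tangent_growth_bounds[OF z, of n] L by (subst ln_le_cancel_iff) auto
  ultimately show "\<bar>ln (tangent_growth (fst z) n (snd z))\<bar> \<le> ln \<Lambda> * real n"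
    using \<Lambda>(1) by (simp add: ln_div ln_realpow abs_le_iff mult.commute)
qed

lemma neg_lyap_m: "neg_lyap fs p m"
proof -
  interpret c: bounded_cocycle "N \<Otimes>\<^sub>M m" skew "\<lambda>n z. ln (tangent_growth (fst z) n (snd z))" "ln \<Lambda>" by (rule cocycle)
  \<comment> \<open>\<open>AE_geometric_decay\<close> wants nonnegativity everywhere, whereas
    \<open>tangent_growth\<close> is known to be positive on the underlying space; truncation
    changes nothing there.\<close>
  define X where "X n z = max 0 (tangent_growth (fst z) n (snd z))" for n z
  have om[measurable]: "(\<lambda>z. tangent_growth (fst z) n (snd z)) \<in> borel_measurable (N \<Otimes>\<^sub>M m)" for n
    unfolding measurable_N_m by (rule tangent_growth_measurable)
  have "AE z in N \<Otimes>\<^sub>M m. \<exists>c. \<forall>n. X n z \<le> c * (sqrt r powr (1 / s)) ^ n"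
  proof (rule AE_geometric_decay[OF _ _ s_pos r_pos r_less])
    show "X n \<in> borel_measurable (N \<Otimes>\<^sub>M m)" for n unfolding X_def by measurable
    show "0 \<le> real DIM('a) powr s * real DIM('a) * K" using K_nonneg by simp
    fix n
    have "(\<integral>\<^sup>+z. ennreal (X n z powr s) \<partial>(N \<Otimes>\<^sub>M m)) = (\<integral>\<^sup>+x. \<integral>\<^sup>+\<omega>. ennreal (X n (\<omega>, x) powr s) \<partial>N \<partial>m)"
      unfolding X_def by (rule NM.nn_integral_snd[symmetric]) measurable
    also have "\<dots> \<le> (\<integral>\<^sup>+x. ennreal (real DIM('a) powr s * real DIM('a) * K * r ^ n) \<partial>m)"
    proof (rule nn_integral_mono)
      fix x assume "x \<in> space m"
      then have x: "x \<in> Sph" by simp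
      have "(\<integral>\<^sup>+\<omega>. ennreal (X n (\<omega>, x) powr s) \<partial>N) = (\<integral>\<^sup>+\<omega>. ennreal (tangent_growth \<omega> n x powr s) \<partial>N)"
        using tangent_growth_bounds(3)[OF _ x] by (intro nn_integral_cong) (simp add: X_def max_def not_le less_imp_le)
      also have "\<dots> \<le> ennreal (real DIM('a) powr s * real DIM('a) * K * r ^ n)" by (rule moment_opn[OF x])
      finally show "(\<integral>\<^sup>+\<omega>. ennreal (X n (\<omega>, x) powr s) \<partial>N) \<le> ennreal (real DIM('a) powr s * real DIM('a) * K * r ^ n)" .
    qed
    also have "\<dots> = ennreal (real DIM('a) powr s * real DIM('a) * K * r ^ n)" using m.emeasure_space_1 by simp
    finally show "(\<integral>\<^sup>+z. ennreal (X n z powr s) \<partial>(N \<Otimes>\<^sub>M m)) \<le> ennreal (real DIM('a) powr s * real DIM('a) * K * r ^ n)" .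
  qed (simp add: X_def)
  with c.AE_converges have "AE z in N \<Otimes>\<^sub>M m. \<exists>L<0. (\<lambda>n. ln (tangent_growth (fst z) n (snd z)) / real n) \<longlonglongrightarrow> L"
    using AE_space
  proof eventually_elim
    case (elim z)
    then have z: "fst z \<in> space N" "snd z \<in> Sph" by (auto simp: space_pair_measure)
    obtain c where c: "\<And>n. X n z \<le> c * \<theta> ^ n" using elim(2) unfolding \<theta>_def by blast
    have pos: "0 < tangent_growth (fst z) n (snd z)" for n by (rule tangent_growth_bounds(3)[OF z])
    have "0 < c" using pos[of 0] c[of 0] by (simp add: X_def)
    have le: "ln (tangent_growth (fst z) n (snd z)) / real n \<le> ln c / real n + ln \<theta>" if "n \<ge> 1" for n
    proof -
      have "tangent_growth (fst z) n (snd z) \<le> c * \<theta> ^ n" using c[of n] by (simp add: X_def)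
      then have "ln (tangent_growth (fst z) n (snd z)) \<le> ln (c * \<theta> ^ n)" using pos[of n] \<open>0 < c\<close> \<theta> by simp
      also have "\<dots> = ln c + real n * ln \<theta>" using \<open>0 < c\<close> \<theta> by (simp add: ln_mult ln_realpow)
      finally show ?thesis using that by (simp add: field_simps)
    qed
    have "(\<lambda>n. ln c / real n + ln \<theta>) \<longlonglongrightarrow> 0 + ln \<theta>"
      by (intro tendsto_add tendsto_const lim_const_over_n)
    then have "low_rate (\<lambda>n z. ln (tangent_growth (fst z) n (snd z))) z \<le> 0 + ln \<theta>"
      by (rule LIMSEQ_le[OF elim(1)]) (use le in blast)
    also have "\<dots> < 0" using \<theta> by simp
    finally show ?case using elim(1) by blast
  qed
  then show ?thesis unfolding neg_lyap_def tangent_growth_def .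
qed

end

section \<open>Moebius dilations and rotations\<close>

text \<open>Rotations, with constant denominator, and Moebius dilations are both affine maps divided
  by an affine function of one coordinate, so this covers all generators of the model.\<close>

lemma C1_near_fraction:
  fixes L :: "'a::euclidean_space \<Rightarrow> 'a"
  assumes L: "bounded_linear L" and pos: "\<And>x. x \<in> Sph \<Longrightarrow> \<alpha> + \<beta> * inner x a > 0"
  shows "C1_near Sph (\<lambda>x. (1 / (\<alpha> + \<beta> * inner x a)) *\<^sub>R (L x + w))"
  unfolding C1_near_def
proof (intro exI conjI ballI)
  let ?d = "\<lambda>x. \<alpha> + \<beta> * inner x a"
  let ?T = "{x. ?d x > 0}"
  let ?D = "\<lambda>x v. (1 / ?d x) *\<^sub>R L v - ((\<beta> * inner v a) / (?d x)\<^sup>2) *\<^sub>R (L x + w)"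
  interpret L: bounded_linear L by fact
  have bl: "bounded_linear (?D x)" for x
    by (intro bounded_linear_sub bounded_linear_scaleR_right[THEN bounded_linear_compose] L
        bounded_linear_scaleR_left[THEN bounded_linear_compose])
      (auto simp: divide_inverse intro!: bounded_linear_intros)
  show "open ?T" by (intro open_Collect_less continuous_intros)
  show "Sph \<subseteq> ?T" using pos by auto
  show "((\<lambda>x. (1 / ?d x) *\<^sub>R (L x + w)) has_derivative blinfun_apply (Blinfun (?D x))) (at x)" if "x \<in> ?T" for x
  proof -
    have d: "?d x \<noteq> 0" using that by simp
    have 1: "(?d has_derivative (\<lambda>v. \<beta> * inner v a)) (at x)" by (auto intro!: derivative_eq_intros)
    have 2: "((\<lambda>x. L x + w) has_derivative L) (at x)"
      using has_derivative_add[OF L.has_derivative[OF has_derivative_ident] has_derivative_const] by simp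
    have "(\<lambda>v. inverse (?d x) *\<^sub>R L v + - (inverse (?d x) * (\<beta> * inner v a) * inverse (?d x)) *\<^sub>R (L x + w)) = ?D x"
      unfolding fun_eq_iff power2_eq_square divide_inverse inverse_mult_distrib by (simp add: mult_ac)
    with has_derivative_scaleR[OF Deriv.has_derivative_inverse[OF d 1] 2]
    have "((\<lambda>x. (1 / ?d x) *\<^sub>R (L x + w)) has_derivative ?D x) (at x)"
      by (simp only: inverse_eq_divide)
    then show ?thesis by (simp add: bounded_linear_Blinfun_apply[OF bl])
  qed
  show "continuous_on ?T (\<lambda>x. Blinfun (?D x))"
    by (rule continuous_on_blinfun_componentwise)
      (auto simp: bounded_linear_Blinfun_apply[OF bl] intro!: continuous_intros L.continuous_on)
qed

definition perm_map :: "('a::euclidean_space \<Rightarrow> 'a) \<Rightarrow> 'a \<Rightarrow> 'a" where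
  "perm_map \<pi> x = (\<Sum>b\<in>Basis. inner x b *\<^sub>R \<pi> b)"

lemma perm_map_bounded_linear: "bounded_linear (perm_map \<pi>)"
  unfolding perm_map_def[abs_def] by (intro bounded_linear_sum bounded_linear_intros)

lemma perm_map_Basis: "b \<in> Basis \<Longrightarrow> perm_map \<pi> b = \<pi> b"
proof -
  assume b: "b \<in> Basis"
  have "perm_map \<pi> b = (\<Sum>b'\<in>Basis. if b' = b then \<pi> b' else 0)"
    unfolding perm_map_def using b by (intro sum.cong refl) (auto simp: inner_Basis)
  then show ?thesis using b by simp
qed

lemma perm_map_inner:
  assumes \<pi>: "bij_betw \<pi> Basis Basis"
  shows "inner (perm_map \<pi> x) (perm_map \<pi> y) = inner x y"
proof -
  have "inner (perm_map \<pi> x) (perm_map \<pi> y) = (\<Sum>b\<in>Basis. \<Sum>b'\<in>Basis. inner x b * inner y b' * inner (\<pi> b) (\<pi> b'))"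
    unfolding perm_map_def
    by (simp add: inner_sum_left inner_sum_right sum_distrib_left mult_ac) (rule sum.swap)
  also have "\<dots> = (\<Sum>b\<in>Basis. \<Sum>b'\<in>Basis. if b = b' then inner x b * inner y b' else 0)"
  proof (intro sum.cong refl)
    fix b b' :: 'a assume b: "b \<in> Basis" "b' \<in> Basis"
    then have "\<pi> b \<in> Basis" "\<pi> b' \<in> Basis" "\<pi> b = \<pi> b' \<longleftrightarrow> b = b'"
      using \<pi> by (auto simp: bij_betw_def inj_on_def)
    then show "inner x b * inner y b' * inner (\<pi> b) (\<pi> b') = (if b = b' then inner x b * inner y b' else 0)"
      by (auto simp: inner_Basis)
  qed
  also have "\<dots> = inner x y" by (simp add: euclidean_inner[of x y])
  finally show ?thesis .
qed

lemma perm_map_perm_map: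
  assumes "\<And>b. b \<in> Basis \<Longrightarrow> \<pi>' b \<in> Basis" "\<And>b. b \<in> Basis \<Longrightarrow> \<pi> (\<pi>' b) = b"
  shows "perm_map \<pi> (perm_map \<pi>' x) = x"
proof -
  interpret bounded_linear "perm_map \<pi>" by (rule perm_map_bounded_linear)
  have "perm_map \<pi> (perm_map \<pi>' x) = (\<Sum>b\<in>Basis. inner x b *\<^sub>R perm_map \<pi> (\<pi>' b))"
    by (simp add: perm_map_def[of \<pi>'] sum scaleR)
  also have "\<dots> = (\<Sum>b\<in>Basis. inner x b *\<^sub>R b)"
    using assms by (intro sum.cong refl) (simp add: perm_map_Basis)
  finally show ?thesis by (simp add: euclidean_representation)
qed

text \<open>The dilation by \<open>c\<close> in the stereographic chart centred at \<open>a\<close>.\<close>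
definition mden :: "real \<Rightarrow> 'a::euclidean_space \<Rightarrow> 'a \<Rightarrow> real" where
  "mden c a x = (1 + inner x a) + c\<^sup>2 * (1 - inner x a)"

definition mob :: "real \<Rightarrow> 'a::euclidean_space \<Rightarrow> 'a \<Rightarrow> 'a" where
  "mob c a x = (1 / mden c a x) *\<^sub>R ((2 * c) *\<^sub>R (x - inner x a *\<^sub>R a)
     + ((1 + inner x a) - c\<^sup>2 * (1 - inner x a)) *\<^sub>R a)"

context
  fixes a :: "'a::euclidean_space" and c :: real
  assumes a: "norm a = 1" and c: "0 < c"
begin

lemma Sph_inner_bound: "x \<in> Sph \<Longrightarrow> \<bar>inner x a\<bar> \<le> 1"
  using Cauchy_Schwarz_ineq2[of x a] a by simp

lemma mden_pos: "x \<in> Sph \<Longrightarrow> mden c a x > 0"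
proof -
  assume "x \<in> Sph"
  then have h: "\<bar>inner x a\<bar> \<le> 1" by (rule Sph_inner_bound)
  have "c\<^sup>2 > 0" using c by simp
  then show ?thesis unfolding mden_def using h
    by (cases "inner x a = 1") (auto simp: abs_le_iff intro!: add_nonneg_pos mult_pos_pos)
qed

lemma mob_inner_a: "mden c a x \<noteq> 0 \<Longrightarrow> inner (mob c a x) a = ((1 + inner x a) - c\<^sup>2 * (1 - inner x a)) / mden c a x"
  using a by (simp add: mob_def inner_add_left inner_diff_left norm_eq_1)

text \<open>Conformality in two-point form: for unit vectors the squared distance is
  \<open>2 * (1 - inner x y)\<close>, so chordal distances are multiplied by the geometric mean of
  \<open>2 * c / mden c a\<close> at the two points. The case \<open>y = x\<close> shows that the
  sphere is preserved.\<close>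

lemma mob_inner:
  assumes "mden c a x \<noteq> 0" "mden c a y \<noteq> 0"
  shows "1 - inner (mob c a x) (mob c a y) = (2 * c / mden c a x) * (2 * c / mden c a y) * (1 - inner x y)"
proof -
  have aa: "inner a a = 1" using a by (simp add: norm_eq_1)
  define h k z where "h = inner x a" and "k = inner y a" and "z = inner x y"
  define u v where "u = x - h *\<^sub>R a" and "v = y - k *\<^sub>R a"
  have uv: "inner u v = z - h * k" "inner u a = 0" "inner a v = 0"
    by (simp_all add: u_def v_def inner_diff_left inner_diff_right aa h_def k_def z_def inner_commute[of a x] inner_commute[of a y])
  have "inner ((2 * c) *\<^sub>R u + ((1 + h) - c\<^sup>2 * (1 - h)) *\<^sub>R a) ((2 * c) *\<^sub>R v + ((1 + k) - c\<^sup>2 * (1 - k)) *\<^sub>R a) =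
     4 * c\<^sup>2 * (z - h * k) + ((1 + h) - c\<^sup>2 * (1 - h)) * ((1 + k) - c\<^sup>2 * (1 - k))"
    unfolding inner_add_left inner_add_right inner_scaleR_left inner_scaleR_right uv aa by (simp add: power2_eq_square)
  note this[unfolded u_def v_def]
  then have i: "inner (mob c a x) (mob c a y) =
    (4 * c\<^sup>2 * (z - h * k) + ((1 + h) - c\<^sup>2 * (1 - h)) * ((1 + k) - c\<^sup>2 * (1 - k))) / (mden c a x * mden c a y)"
    unfolding mob_def h_def[symmetric] k_def[symmetric] by simp
  have e: "mden c a x * mden c a y - (4 * c\<^sup>2 * (z - h * k) + ((1 + h) - c\<^sup>2 * (1 - h)) * ((1 + k) - c\<^sup>2 * (1 - k)))
    = 4 * c\<^sup>2 * (1 - z)"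
    unfolding mden_def h_def[symmetric] k_def[symmetric] by (simp add: algebra_simps power2_eq_square)
  have "1 - inner (mob c a x) (mob c a y) = (mden c a x * mden c a y -
     (4 * c\<^sup>2 * (z - h * k) + ((1 + h) - c\<^sup>2 * (1 - h)) * ((1 + k) - c\<^sup>2 * (1 - k)))) / (mden c a x * mden c a y)"
    unfolding i using assms by (simp add: diff_divide_distrib)
  also have "\<dots> = (2 * c / mden c a x) * (2 * c / mden c a y) * (1 - inner x y)"
    unfolding e unfolding z_def by (simp add: power2_eq_square)
  finally show ?thesis .
qed

lemma mob_Sph: "x \<in> Sph \<Longrightarrow> mob c a x \<in> Sph"
  using mob_inner[of x x] mden_pos[of x] by (simp add: norm_eq_1)

lemma mob_a: "mob c a a = a"
  using a by (simp add: mob_def mden_def norm_eq_1)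

text \<open>With \<open>h = inner x a\<close> the ratio \<open>(1 - h) / (1 + h)\<close> is the
  squared radius in the chart. \<open>mob c a\<close> multiplies it by \<open>c\<^sup>2\<close>, and
  \<open>mob (1 / c) a\<close> undoes this.\<close>

lemma mob_inverse:
  assumes x: "mden c a x \<noteq> 0" and h: "mden (1 / c) a (mob c a x) \<noteq> 0"
  shows "mob (1 / c) a (mob c a x) = x"
proof -
  let ?d = "mden c a x" and ?h = "inner x a"
  have hd: "inner (mob c a x) a = ((1 + ?h) - c\<^sup>2 * (1 - ?h)) / ?d" by (rule mob_inner_a[OF x])
  have 1: "1 + inner (mob c a x) a = 2 * (1 + ?h) / ?d"
    unfolding hd using x by (simp add: mden_def field_simps)
  have 2: "1 - inner (mob c a x) a = 2 * c\<^sup>2 * (1 - ?h) / ?d"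
    unfolding hd using x by (simp add: mden_def field_simps)
  have 3: "(1 / c)\<^sup>2 * (1 - inner (mob c a x) a) = 2 * (1 - ?h) / ?d"
    unfolding 2 using c by (simp add: power2_eq_square)
  have 4: "mden (1 / c) a (mob c a x) = 4 / ?d"
    unfolding mden_def[of "1 / c"] 3 1 by (simp add: add_divide_distrib[symmetric])
  have 5: "mob c a x - inner (mob c a x) a *\<^sub>R a = (2 * c / ?d) *\<^sub>R (x - ?h *\<^sub>R a)"
    unfolding hd unfolding mob_def by (simp add: scaleR_add_right)
  have 6: "(1 + inner (mob c a x) a) - (1 / c)\<^sup>2 * (1 - inner (mob c a x) a) = 4 * ?h / ?d"
    unfolding 3 1 by (simp add: diff_divide_distrib[symmetric])
  have "mob (1 / c) a (mob c a x) = (?d / 4) *\<^sub>R ((2 * (1 / c)) *\<^sub>R ((2 * c / ?d) *\<^sub>R (x - ?h *\<^sub>R a)) + (4 * ?h / ?d) *\<^sub>R a)"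
    unfolding mob_def[of "1 / c"] 4 5 6 by simp
  also have "\<dots> = (x - ?h *\<^sub>R a) + ?h *\<^sub>R a"
    using c x by (simp add: scaleR_add_right)
  finally show ?thesis by simp
qed

lemma C1_near_mob_linear:
  assumes L: "bounded_linear L" and La: "\<And>x. inner (L x) a = inner x a"
  shows "C1_near Sph (\<lambda>x. mob c a (L x))"
proof -
  interpret bounded_linear L by fact
  let ?L = "\<lambda>x. (2 * c) *\<^sub>R (L x - inner x a *\<^sub>R a) + ((1 + c\<^sup>2) * inner x a) *\<^sub>R a"
  have "bounded_linear ?L"
    by (intro bounded_linear_intros bounded_linear_scaleR_right[THEN bounded_linear_compose] L)
  moreover have "(1 + c\<^sup>2) + (1 - c\<^sup>2) * inner x a > 0" if "x \<in> Sph" for x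
    using mden_pos[OF that] by (simp add: mden_def algebra_simps)
  ultimately have "C1_near Sph (\<lambda>x. (1 / ((1 + c\<^sup>2) + (1 - c\<^sup>2) * inner x a)) *\<^sub>R (?L x + (1 - c\<^sup>2) *\<^sub>R a))"
    by (rule C1_near_fraction)
  moreover have "(1 / ((1 + c\<^sup>2) + (1 - c\<^sup>2) * inner x a)) *\<^sub>R (?L x + (1 - c\<^sup>2) *\<^sub>R a) = mob c a (L x)" for x
  proof -
    have "((1 + c\<^sup>2) * inner x a) *\<^sub>R a + (1 - c\<^sup>2) *\<^sub>R a = ((1 + inner x a) - c\<^sup>2 * (1 - inner x a)) *\<^sub>R a"
      unfolding scaleR_add_left[symmetric] by (rule arg_cong[where f="\<lambda>t. t *\<^sub>R a"]) (simp add: algebra_simps)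
    moreover have "(1 + c\<^sup>2) + (1 - c\<^sup>2) * inner x a = mden c a (L x)" by (simp add: mden_def La algebra_simps)
    ultimately show ?thesis unfolding mob_def La by (simp only: add.assoc)
  qed
  ultimately show ?thesis by simp
qed

end

section \<open>Rotations in the plane of two orthonormal vectors\<close>

definition rot :: "'a::euclidean_space \<Rightarrow> 'a \<Rightarrow> real \<Rightarrow> 'a \<Rightarrow> 'a" where
  "rot a e t x = x + ((cos t - 1) * inner x a - sin t * inner x e) *\<^sub>R a
     + (sin t * inner x a + (cos t - 1) * inner x e) *\<^sub>R e"

context
  fixes a e :: "'a::euclidean_space"
  assumes a: "norm a = 1" and e: "norm e = 1" and ae: "inner a e = 0"
begin

lemma ae_simps: "inner a a = 1" "inner e e = 1" "inner a e = 0" "inner e a = 0"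
  using a e ae by (auto simp: norm_eq_1 inner_commute)

lemma rot_inner_a: "inner (rot a e t x) a = cos t * inner x a - sin t * inner x e"
  by (simp add: rot_def inner_add_left ae_simps algebra_simps)

lemma rot_inner_e: "inner (rot a e t x) e = sin t * inner x a + cos t * inner x e"
  by (simp add: rot_def inner_add_left ae_simps algebra_simps)

lemma rot_inner_other: "inner a y = 0 \<Longrightarrow> inner e y = 0 \<Longrightarrow> inner (rot a e t x) y = inner x y"
  by (simp add: rot_def inner_add_left)

lemma rot_bounded_linear: "bounded_linear (rot a e t)"
  unfolding rot_def[abs_def] by (intro bounded_linear_intros)

lemma rot_0: "rot a e 0 x = x"
  by (simp add: rot_def)

lemma rot_rot: "rot a e s (rot a e t x) = rot a e (s + t) x"
proof -
  define h k where "h = inner x a" and "k = inner x e"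
  have "rot a e s (rot a e t x) = x
     + (((cos t - 1) * h - sin t * k) + ((cos s - 1) * (cos t * h - sin t * k) - sin s * (sin t * h + cos t * k))) *\<^sub>R a
     + ((sin t * h + (cos t - 1) * k) + (sin s * (cos t * h - sin t * k) + (cos s - 1) * (sin t * h + cos t * k))) *\<^sub>R e"
    unfolding rot_def[of a e s] rot_inner_a rot_inner_e h_def[symmetric] k_def[symmetric]
    unfolding rot_def[of a e t] h_def[symmetric] k_def[symmetric] by (simp only: scaleR_add_left) (simp add: add_ac)
  also have "((cos t - 1) * h - sin t * k) + ((cos s - 1) * (cos t * h - sin t * k) - sin s * (sin t * h + cos t * k))
      = (cos (s + t) - 1) * h - sin (s + t) * k" unfolding cos_add sin_add by (simp add: algebra_simps)
  also have "(sin t * h + (cos t - 1) * k) + (sin s * (cos t * h - sin t * k) + (cos s - 1) * (sin t * h + cos t * k))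
      = sin (s + t) * h + (cos (s + t) - 1) * k" unfolding cos_add sin_add by (simp add: algebra_simps)
  also have "x + ((cos (s + t) - 1) * h - sin (s + t) * k) *\<^sub>R a + (sin (s + t) * h + (cos (s + t) - 1) * k) *\<^sub>R e = rot a e (s + t) x"
    unfolding rot_def[of a e "s + t"] h_def k_def ..
  finally show ?thesis .
qed

lemma rot_inner: "inner (rot a e t x) (rot a e t y) = inner x y"
proof -
  define h k h' k' where "h = inner x a" and "k = inner x e" and "h' = inner y a" and "k' = inner y e"
  define A B A' B' where "A = (cos t - 1) * h - sin t * k" and "B = sin t * h + (cos t - 1) * k"
    and "A' = (cos t - 1) * h' - sin t * k'" and "B' = sin t * h' + (cos t - 1) * k'"
  have v: "inner x a = h" "inner x e = k" "inner a y = h'" "inner e y = k'"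
    by (simp_all add: h_def k_def h'_def k'_def inner_commute)
  have r: "rot a e t x = x + A *\<^sub>R a + B *\<^sub>R e" "rot a e t y = y + A' *\<^sub>R a + B' *\<^sub>R e"
    unfolding rot_def A_def B_def A'_def B'_def h_def k_def h'_def k'_def by (rule refl)+
  have "inner (rot a e t x) (rot a e t y) = inner x y + (A' * h + B' * k + A * h' + B * k' + A * A' + B * B')"
    unfolding r inner_add_left inner_add_right inner_scaleR_left inner_scaleR_right v ae_simps by (simp add: distrib_left mult.commute)
  moreover have "A' * h + B' * k + A * h' + B * k' + A * A' + B * B' = 0"
  proof -
    have s: "sin t * sin t = 1 - cos t * cos t" using sin_cos_squared_add[of t] by (simp add: power2_eq_square)
    have "A' * h + B' * k + A * h' + B * k' + A * A' + B * B' =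
      (h * h' + k * k') * (cos t * cos t + sin t * sin t - 1)"
      unfolding A_def B_def A'_def B'_def by algebra
    then show ?thesis unfolding s by simp
  qed
  ultimately show ?thesis by simp
qed

lemma norm_rot: "norm (rot a e t x) = norm x"
  by (simp add: norm_eq_sqrt_inner rot_inner)

lemma rot_diff: "rot a e t x - rot a e t y = rot a e t (x - y)"
  by (simp add: linear_simps[OF rot_bounded_linear])

lemma norm_rot_diff: "norm (rot a e t x - rot a e t y) = norm (x - y)"
  by (simp add: rot_diff norm_rot)

lemma rot_periodic: "rot a e (t + 2 * pi * of_int i) x = rot a e t x"
proof -
  have "cos (t + 2 * pi * of_int i) = cos t" "sin (t + 2 * pi * of_int i) = sin t"
    by (simp_all add: cos_add sin_add cos_int_2pin sin_int_2pin)
  then show ?thesis by (simp add: rot_def)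
qed

lemma rot_dist:
  assumes "norm x = 1"
  shows "norm (rot a e s x - rot a e t x) \<le> 4 * \<bar>s - t\<bar>"
proof -
  define u where "u = s - t"
  let ?y = "rot a e t x"
  have y: "norm ?y = 1" using assms by (simp add: norm_rot)
  have h: "\<bar>inner ?y a\<bar> \<le> 1" "\<bar>inner ?y e\<bar> \<le> 1"
    using Cauchy_Schwarz_ineq2[of ?y a] Cauchy_Schwarz_ineq2[of ?y e] y a e by auto
  have s: "\<bar>sin u\<bar> \<le> \<bar>u\<bar>" by (rule abs_sin_x_le_abs_x)
  have "\<bar>cos u - 1\<bar> = 2 * \<bar>sin (u / 2)\<bar> * \<bar>sin (u / 2)\<bar>"
    using cos_double_sin[of "u / 2"] by (simp add: power2_eq_square)
  also have "\<dots> \<le> 2 * \<bar>u / 2\<bar> * 1" using abs_sin_x_le_abs_x[of "u / 2"] by (intro mult_mono) auto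
  finally have c: "\<bar>cos u - 1\<bar> \<le> \<bar>u\<bar>" by simp
  have 1: "\<bar>(cos u - 1) * inner ?y a - sin u * inner ?y e\<bar> \<le> 2 * \<bar>u\<bar>"
    using abs_triangle_ineq4[of "(cos u - 1) * inner ?y a" "sin u * inner ?y e"]
      mult_mono[OF c h(1)] mult_mono[OF s h(2)] by (simp add: abs_mult)
  have 2: "\<bar>sin u * inner ?y a + (cos u - 1) * inner ?y e\<bar> \<le> 2 * \<bar>u\<bar>"
    using abs_triangle_ineq[of "sin u * inner ?y a" "(cos u - 1) * inner ?y e"]
      mult_mono[OF c h(2)] mult_mono[OF s h(1)] by (simp add: abs_mult)
  have "rot a e s x - rot a e t x = rot a e u ?y - ?y" by (simp add: u_def rot_rot)
  also have "\<dots> = ((cos u - 1) * inner ?y a - sin u * inner ?y e) *\<^sub>R a + (sin u * inner ?y a + (cos u - 1) * inner ?y e) *\<^sub>R e"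
    unfolding rot_def[of a e u] by simp
  also have "norm \<dots> \<le> \<bar>(cos u - 1) * inner ?y a - sin u * inner ?y e\<bar> + \<bar>sin u * inner ?y a + (cos u - 1) * inner ?y e\<bar>"
    by (rule order_trans[OF norm_triangle_ineq]) (simp add: a e)
  finally show ?thesis using 1 2 by (simp add: u_def)
qed

lemma rot_diffeo: "sphere_diffeo (rot a e t)"
proof -
  have C: "C1_near Sph (rot a e s)" for s
    using C1_near_fraction[OF rot_bounded_linear, of 1 0 a s 0] by simp
  have inv: "rot a e s (rot a e (- s) x) = x" "rot a e (- s) (rot a e s x) = x" for s x
    by (simp_all add: rot_rot rot_0)
  have S: "rot a e s x \<in> Sph" if "x \<in> Sph" for s x using that by (simp add: norm_rot)
  have "rot a e t ` Sph = Sph"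
    using S inv by (metis (no_types, opaque_lifting) image_subsetI image_eqI subsetI subset_antisym)
  then show ?thesis unfolding sphere_diffeo_def using C S inv by blast
qed

end

section \<open>Contraction by means of a potential\<close>

lemma exp_le_quadratic:
  fixes z :: real assumes "\<bar>z\<bar> \<le> 1" shows "exp z \<le> 1 + z + z\<^sup>2"
proof (cases "z \<ge> 0")
  case True
  then show ?thesis using exp_bound[of z] assms by simp
next
  case False
  define y where "y = - z"
  have y: "0 < y" "y \<le> 1" using False assms by (auto simp: y_def)
  have "(1 - y + y\<^sup>2) * (1 + y + y\<^sup>2 / 2) \<ge> 1"
  proof -
    have "(1 - y + y\<^sup>2) * (1 + y + y\<^sup>2 / 2) = 1 + y\<^sup>2 / 2 + y ^ 3 / 2 + y ^ 4 / 2"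
      by (simp add: algebra_simps power2_eq_square power3_eq_cube power4_eq_xxxx add_divide_distrib diff_divide_distrib)
    then show ?thesis using y by simp
  qed
  moreover have "1 + y + y\<^sup>2 / 2 \<le> exp y" using exp_lower_Taylor_quadratic[of y] y by simp
  moreover have "1 - y + y\<^sup>2 \<ge> 0" using y by simp
  ultimately have "1 \<le> (1 - y + y\<^sup>2) * exp y" by (meson mult_left_mono order_trans)
  then have "exp (- y) \<le> 1 - y + y\<^sup>2" by (simp add: exp_minus field_simps)
  then show ?thesis by (simp add: y_def)
qed

lemma exp_mean_le: "exp ((u + v) / 2 :: real) \<le> (exp u + exp v) / 2"
proof -
  have e: "exp u = exp (u / 2) * exp (u / 2)" "exp v = exp (v / 2) * exp (v / 2)"
    "exp ((u + v) / 2) = exp (u / 2) * exp (v / 2)"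
    by (simp_all add: add_divide_distrib flip: exp_add)
  have "0 \<le> (exp (u / 2) - exp (v / 2))\<^sup>2" by simp
  then show ?thesis unfolding e power2_eq_square by (simp add: algebra_simps)
qed

context sphere_ifs
begin

text \<open>The bound \<open>exp z \<le> 1 + z + z\<^sup>2\<close> turns the negative drift into a contraction of small moments.\<close>
lemma potential_contraction:
  fixes \<beta> :: "nat \<Rightarrow> 'a \<Rightarrow> real" and \<psi> :: "'a \<Rightarrow> real"
  assumes \<beta>: "\<And>i x. i \<in> letters \<Longrightarrow> x \<in> Sph \<Longrightarrow> \<bar>\<beta> i x\<bar> \<le> T"
    and \<psi>: "\<And>x. x \<in> Sph \<Longrightarrow> \<bar>\<psi> x\<bar> \<le> T"
    and lip: "\<And>i x y. i \<in> letters \<Longrightarrow> x \<in> Sph \<Longrightarrow> y \<in> Sph \<Longrightarrow>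
      norm ((fs ! i) x - (fs ! i) y) \<le> exp ((\<beta> i x + \<beta> i y) / 2) * norm (x - y)"
    and drift: "\<And>x. x \<in> Sph \<Longrightarrow> (\<Sum>i\<in>letters. p i * (\<beta> i x + \<psi> ((fs ! i) x) - \<psi> x)) \<le> - \<zeta>"
    and \<zeta>: "\<zeta> > 0"
  shows "\<exists>s K r. contracting_ifs fs p s K r"
proof -
  define t where "t i x = \<beta> i x + \<psi> ((fs ! i) x) - \<psi> x" for i x
  have fS: "(fs ! i) x \<in> Sph" if "i \<in> letters" "x \<in> Sph" for i x
    using sphere_diffeoD(3)[OF diffeo] that by simp
  obtain x1 :: 'a where x1: "x1 \<in> Sph" using exists_unit_tangent[OF dim, of 0] by (metis mem_sphere_0)
  have T0: "T \<ge> 0" using \<psi>[OF x1] by simp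
  \<comment> \<open>The three terms of \<open>t\<close> are bounded by \<open>T\<close> each; the
    added 1 makes division by \<open>U\<close> safe.\<close>
  define U where "U = 3 * T + 1"
  have U1: "U \<ge> 1" using T0 by (simp add: U_def)
  have t: "\<bar>t i x\<bar> \<le> U" if "i \<in> letters" "x \<in> Sph" for i x
    using \<beta>[OF that] \<psi>[OF that(2)] \<psi>[OF fS[OF that]] unfolding t_def U_def by linarith
  have \<zeta>U: "\<zeta> \<le> U"
  proof -
    have "\<zeta> \<le> - (\<Sum>i\<in>letters. p i * t i x1)" using drift[OF x1] by (simp add: t_def)
    also have "\<dots> = (\<Sum>i\<in>letters. p i * (- t i x1))" by (simp add: sum_negf)
    also have "\<dots> \<le> (\<Sum>i\<in>letters. p i * U)"
    proof (intro sum_mono mult_left_mono)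
      fix i assume i: "i \<in> letters"
      show "- t i x1 \<le> U" using t[OF i x1] by linarith
      show "0 \<le> p i" using p_pos i by (simp add: less_imp_le)
    qed
    also have "\<dots> = U" using p_sum by (simp flip: sum_distrib_right)
    finally show ?thesis .
  qed
  \<comment> \<open>This makes the quadratic error \<open>s\<^sup>2 * U\<^sup>2\<close> equal to
    \<open>s * \<zeta> / 2\<close>, half of the linear gain \<open>s * \<zeta>\<close>, and keeps
    \<open>s * U \<le> 1\<close>, the range of \<open>exp_le_quadratic\<close>.\<close>
  define s where "s = \<zeta> / (2 * U\<^sup>2)"
  have s: "s > 0" using \<zeta> U1 by (simp add: s_def)
  have sU2: "s * U\<^sup>2 = \<zeta> / 2" using U1 by (simp add: s_def)
  have sU: "s * U \<le> 1"
  proof -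
    have "s * U = \<zeta> / (2 * U)" using U1 by (simp add: s_def power2_eq_square)
    also have "\<dots> \<le> 1" using \<zeta>U U1 \<zeta> by (simp add: divide_le_eq)
    finally show ?thesis .
  qed
  define r where "r = 1 - s * \<zeta> / 2"
  have r1: "r < 1" using s \<zeta> by (simp add: r_def)
  have "s * \<zeta> \<le> s * U" using \<zeta>U s by simp
  then have r0: "r > 0" using sU by (simp add: r_def)
  have expsum: "(\<Sum>i\<in>letters. p i * exp (s * t i x)) \<le> r" if x: "x \<in> Sph" for x
  proof -
    have "(\<Sum>i\<in>letters. p i * exp (s * t i x)) \<le> (\<Sum>i\<in>letters. p i * (1 + s * t i x + s * (\<zeta> / 2)))"
    proof (intro sum_mono mult_left_mono)
      fix i assume i: "i \<in> letters"
      have st: "\<bar>s * t i x\<bar> \<le> s * U" using t[OF i x] s by (simp add: abs_mult)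
      then have "exp (s * t i x) \<le> 1 + s * t i x + (s * t i x)\<^sup>2" using sU by (intro exp_le_quadratic) simp
      also have "(s * t i x)\<^sup>2 \<le> (s * U)\<^sup>2" using st power_mono[of "\<bar>s * t i x\<bar>" "s * U" 2] by simp
      also have "(s * U)\<^sup>2 = s * (s * U\<^sup>2)" by (simp add: power2_eq_square)
      finally show "exp (s * t i x) \<le> 1 + s * t i x + s * (\<zeta> / 2)" using sU2 by simp
      show "0 \<le> p i" using p_pos i by (simp add: less_imp_le)
    qed
    also have "\<dots> = (\<Sum>i\<in>letters. p i) * (1 + s * (\<zeta> / 2)) + s * (\<Sum>i\<in>letters. p i * t i x)"
      by (simp add: sum_distrib_left sum_distrib_right algebra_simps sum.distrib)
    also have "\<dots> \<le> 1 + s * (\<zeta> / 2) + s * (- \<zeta>)"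
      unfolding p_sum mult_1 t_def by (intro add_left_mono mult_left_mono drift[OF x]) (use s in simp)
    also have "\<dots> = r" by (simp add: r_def algebra_simps)
    finally show ?thesis .
  qed
  \<comment> \<open>The weight of a pair averages the potentials of its points, so that
    \<open>norm (x - y) powr s * V x y\<close> contracts in mean in a single step. \<open>V\<close>
    lies between two positive constants, which are paid once at the end.\<close>
  define V where "V x y = exp (s * (\<psi> x + \<psi> y) / 2)" for x y
  have step: "(\<Sum>i\<in>letters. p i * (norm ((fs ! i) x - (fs ! i) y) powr s * V ((fs ! i) x) ((fs ! i) y)))
      \<le> r * (norm (x - y) powr s * V x y)" if x: "x \<in> Sph" and y: "y \<in> Sph" for x y
  proof -
    have "(\<Sum>i\<in>letters. p i * (norm ((fs ! i) x - (fs ! i) y) powr s * V ((fs ! i) x) ((fs ! i) y)))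
       \<le> (\<Sum>i\<in>letters. p i * ((norm (x - y) powr s * V x y) * ((exp (s * t i x) + exp (s * t i y)) / 2)))"
    proof (intro sum_mono mult_left_mono)
      fix i assume i: "i \<in> letters"
      have "norm ((fs ! i) x - (fs ! i) y) powr s \<le> (exp ((\<beta> i x + \<beta> i y) / 2) * norm (x - y)) powr s"
        using s lip[OF i x y] by (intro powr_mono2) auto
      also have "\<dots> = exp (s * (\<beta> i x + \<beta> i y) / 2) * norm (x - y) powr s"
        by (simp add: powr_mult) (simp add: powr_def)
      finally have "norm ((fs ! i) x - (fs ! i) y) powr s * V ((fs ! i) x) ((fs ! i) y)
        \<le> exp (s * (\<beta> i x + \<beta> i y) / 2) * norm (x - y) powr s * V ((fs ! i) x) ((fs ! i) y)"
        by (rule mult_right_mono) (simp add: V_def)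
      also have "\<dots> = norm (x - y) powr s * (exp (s * (\<beta> i x + \<beta> i y) / 2) * V ((fs ! i) x) ((fs ! i) y))" by simp
      also have "exp (s * (\<beta> i x + \<beta> i y) / 2) * V ((fs ! i) x) ((fs ! i) y) = V x y * exp ((s * t i x + s * t i y) / 2)"
        unfolding V_def exp_add[symmetric] t_def by (simp add: algebra_simps add_divide_distrib diff_divide_distrib)
      \<comment> \<open>The exponential of a mean is at most the mean of the exponentials. This
        separates the two points, so the drift at single points suffices.\<close>
      also have "norm (x - y) powr s * (V x y * exp ((s * t i x + s * t i y) / 2))
        \<le> norm (x - y) powr s * (V x y * ((exp (s * t i x) + exp (s * t i y)) / 2))"
        by (intro mult_left_mono exp_mean_le) (simp_all add: V_def)
      finally show "norm ((fs ! i) x - (fs ! i) y) powr s * V ((fs ! i) x) ((fs ! i) y)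
        \<le> (norm (x - y) powr s * V x y) * ((exp (s * t i x) + exp (s * t i y)) / 2)" by (simp only: mult.assoc)
      show "0 \<le> p i" using p_pos i by (simp add: less_imp_le)
    qed
    also have "\<dots> = (norm (x - y) powr s * V x y) *
        (((\<Sum>i\<in>letters. p i * exp (s * t i x)) + (\<Sum>i\<in>letters. p i * exp (s * t i y))) / 2)"
      by (simp add: sum_distrib_left sum_distrib_right sum.distrib[symmetric] sum_divide_distrib algebra_simps add_divide_distrib)
    also have "\<dots> \<le> (norm (x - y) powr s * V x y) * ((r + r) / 2)"
      using expsum[OF x] expsum[OF y] by (intro mult_left_mono) (auto simp: V_def)
    finally show ?thesis by (simp add: mult.commute)
  qed
  have Vb: "exp (- (s * T)) \<le> V x y" "V x y \<le> exp (s * T)" if "x \<in> Sph" "y \<in> Sph" for x y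
  proof -
    have "- (s * T) \<le> s * ((\<psi> x + \<psi> y) / 2)" "s * ((\<psi> x + \<psi> y) / 2) \<le> s * T"
      using mult_left_mono[of "- T" "(\<psi> x + \<psi> y) / 2" s] mult_left_mono[of "(\<psi> x + \<psi> y) / 2" T s]
        \<psi>[OF that(1)] \<psi>[OF that(2)] s by (auto simp: abs_le_iff)
    then show "exp (- (s * T)) \<le> V x y" "V x y \<le> exp (s * T)" unfolding V_def by simp_all
  qed
  have LC: "(\<integral>\<^sup>+\<omega>. ennreal (norm (ifs_iter fs \<omega> n x - ifs_iter fs \<omega> n y) powr s) \<partial>N)
     \<le> ennreal (exp (s * T) * r ^ n * (norm (x - y) powr s * V x y))" if "x \<in> Sph" "y \<in> Sph" for n x y
    using that
  proof (induction n arbitrary: x y)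
    case 0
    have "1 = exp (s * T) * exp (- (s * T))" by (simp flip: exp_add)
    also have "\<dots> \<le> exp (s * T) * V x y" using Vb(1)[OF 0] by (intro mult_left_mono) auto
    finally have "norm (x - y) powr s * 1 \<le> norm (x - y) powr s * (exp (s * T) * V x y)"
      by (intro mult_left_mono) auto
    then have "norm (x - y) powr s \<le> exp (s * T) * (norm (x - y) powr s * V x y)"
      by (simp only: mult_1_right mult.left_commute)
    then show ?case using N.emeasure_space_1 by (simp add: ennreal_leI)
  next
    case (Suc n)
    note xy = Suc.prems
    have [measurable]: "(\<lambda>\<omega>. ifs_iter fs \<omega> (Suc n) x) \<in> borel_measurable N" "(\<lambda>\<omega>. ifs_iter fs \<omega> (Suc n) y) \<in> borel_measurable N"
      using iter_measurable_section xy by blast+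
    have "(\<integral>\<^sup>+\<omega>. ennreal (norm (ifs_iter fs \<omega> (Suc n) x - ifs_iter fs \<omega> (Suc n) y) powr s) \<partial>N) =
       (\<Sum>i\<in>letters. ennreal (p i) * (\<integral>\<^sup>+\<omega>. ennreal (norm (ifs_iter fs (case_nat i \<omega>) (Suc n) x - ifs_iter fs (case_nat i \<omega>) (Suc n) y) powr s) \<partial>N))"
      by (rule nn_integral_N_step) measurable
    also have "\<dots> = (\<Sum>i\<in>letters. ennreal (p i) * (\<integral>\<^sup>+\<omega>. ennreal (norm (ifs_iter fs \<omega> n ((fs ! i) x) - ifs_iter fs \<omega> n ((fs ! i) y)) powr s) \<partial>N))"
      unfolding ifs_iter_shift by simp
    also have "\<dots> \<le> (\<Sum>i\<in>letters. ennreal (p i) * ennreal (exp (s * T) * r ^ n * (norm ((fs ! i) x - (fs ! i) y) powr s * V ((fs ! i) x) ((fs ! i) y))))"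
      by (intro sum_mono mult_left_mono Suc.IH fS xy) auto
    also have "\<dots> = (\<Sum>i\<in>letters. ennreal (p i * (exp (s * T) * r ^ n * (norm ((fs ! i) x - (fs ! i) y) powr s * V ((fs ! i) x) ((fs ! i) y)))))"
      using p_pos by (intro sum.cong refl ennreal_mult''[symmetric]) (use r0 in \<open>auto simp: V_def\<close>)
    also have "\<dots> = ennreal (\<Sum>i\<in>letters. p i * (exp (s * T) * r ^ n * (norm ((fs ! i) x - (fs ! i) y) powr s * V ((fs ! i) x) ((fs ! i) y))))"
      using p_pos r0 by (intro sum_ennreal) (auto simp: V_def less_imp_le)
    also have "(\<Sum>i\<in>letters. p i * (exp (s * T) * r ^ n * (norm ((fs ! i) x - (fs ! i) y) powr s * V ((fs ! i) x) ((fs ! i) y)))) =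
       exp (s * T) * r ^ n * (\<Sum>i\<in>letters. p i * (norm ((fs ! i) x - (fs ! i) y) powr s * V ((fs ! i) x) ((fs ! i) y)))"
      by (simp add: sum_distrib_left mult_ac)
    also have "ennreal \<dots> \<le> ennreal (exp (s * T) * r ^ n * (r * (norm (x - y) powr s * V x y)))"
      using step[OF xy] r0 by (intro ennreal_leI mult_left_mono) auto
    finally show ?case by (simp add: mult_ac)
  qed
  have "contracting_ifs fs p s (exp (s * T) * exp (s * T)) r"
  proof
    show "0 < s" "0 < r" "r < 1" "0 \<le> exp (s * T) * exp (s * T)" using s r0 r1 by auto
    fix n and x y :: 'a assume xy: "x \<in> Sph" "y \<in> Sph"
    note LC[OF xy]
    also have "ennreal (exp (s * T) * r ^ n * (norm (x - y) powr s * V x y)) \<le> ennreal (exp (s * T) * r ^ n * (norm (x - y) powr s * exp (s * T)))"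
      using Vb(2)[OF xy] r0 by (intro ennreal_leI mult_left_mono) auto
    finally show "(\<integral>\<^sup>+\<omega>. ennreal (norm (ifs_iter fs \<omega> n x - ifs_iter fs \<omega> n y) powr s) \<partial>N)
      \<le> ennreal (exp (s * T) * exp (s * T) * r ^ n * norm (x - y) powr s)" by (simp add: mult_ac)
  qed
  then show ?thesis by blast
qed

end

section \<open>The perturbed system contracts\<close>

text \<open>\<open>E\<close> numbers an orthonormal basis of the complement of \<open>a\<close>.
  \<open>Q\<close> passes coordinate \<open>i\<close> on to coordinate \<open>i + 1\<close>, so that
  rotations in the single plane of \<open>a\<close> and \<open>E 0\<close> reach every direction in
  turn.\<close>

locale moebius_frame =
  fixes a :: "'a::euclidean_space" and E :: "nat \<Rightarrow> 'a" and n :: nat and P Q :: "'a \<Rightarrow> 'a" and \<eta> \<theta> :: real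
  assumes a: "norm a = 1"
    and n: "n \<ge> 1"
    and E: "\<And>i. i < n \<Longrightarrow> norm (E i) = 1" "\<And>i. i < n \<Longrightarrow> inner a (E i) = 0"
      "\<And>i j. i < n \<Longrightarrow> j < n \<Longrightarrow> i \<noteq> j \<Longrightarrow> inner (E i) (E j) = 0"
    and span: "\<And>y. (\<And>i. i < n \<Longrightarrow> inner y (E i) = 0) \<Longrightarrow> y = inner y a *\<^sub>R a"
    and P: "bounded_linear P" "P a = a" "\<And>x y. inner (P x) (P y) = inner x y"
    and Q: "bounded_linear Q" "Q a = a" "\<And>x y. inner (Q x) (Q y) = inner x y"
    and PQ: "\<And>x. P (Q x) = x" "\<And>x. Q (P x) = x"
    and QE: "\<And>i x. Suc i < n \<Longrightarrow> inner (Q x) (E (Suc i)) = inner x (E i)"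
    and \<eta>: "0 < \<eta>" "\<eta> \<le> 1 / 16"
begin

text \<open>The fourth power gives \<open>\<rho> x \<le> 4 * \<eta>\<^sup>2\<close> outside the
  \<open>\<eta>\<close>-ball about \<open>- a\<close>. The guaranteed logarithmic contraction there
  is then a fixed fraction of the worst logarithmic expansion \<open>ln (1 / c)\<close>, however
  small \<open>\<eta>\<close> is.\<close>

definition c :: real where "c = \<eta> ^ 4"
abbreviation "R t \<equiv> rot a (E 0) t"
definition f0 :: "'a \<Rightarrow> 'a" where "f0 x = mob c a (P x)"
definition f0inv :: "'a \<Rightarrow> 'a" where "f0inv x = mob (1 / c) a (Q x)"
definition \<rho> :: "'a \<Rightarrow> real" where "\<rho> x = 2 * c / mden c a x"

lemma E0: "norm (E 0) = 1" "inner a (E 0) = 0" using E n by auto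

lemma c: "0 < c" "c \<le> 1"
  using \<eta> by (auto simp: c_def intro!: power_le_one)

lemma Pa: "inner (P x) a = inner x a" using P(3)[of x a] P(2) by simp
lemma Qa: "inner (Q x) a = inner x a" using Q(3)[of x a] Q(2) by simp

lemma P_Sph: "x \<in> Sph \<Longrightarrow> P x \<in> Sph" using P(3)[of x x] by (simp add: norm_eq_sqrt_inner)
lemma Q_Sph: "x \<in> Sph \<Longrightarrow> Q x \<in> Sph" using Q(3)[of x x] by (simp add: norm_eq_sqrt_inner)

lemma mob_commute:
  assumes "bounded_linear L" "L a = a" "\<And>x. inner (L x) a = inner x a"
  shows "L (mob d a x) = mob d a (L x)"
proof -
  interpret bounded_linear L by fact
  show ?thesis unfolding mob_def mden_def assms(3) by (simp add: scaleR add diff assms(2))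
qed

lemma f0_f0inv: "x \<in> Sph \<Longrightarrow> f0 (f0inv x) = x"
proof -
  assume x: "x \<in> Sph"
  have "f0 (f0inv x) = mob c a (mob (1 / c) a (P (Q x)))"
    unfolding f0_def f0inv_def mob_commute[OF P(1,2) Pa] ..
  also have "\<dots> = mob (1 / (1 / c)) a (mob (1 / c) a x)" by (simp add: PQ)
  also have "\<dots> = x"
    using mden_pos[OF a, of "1 / c" x] mob_Sph[OF a, of "1 / c" x] mden_pos[OF a, of c "mob (1/c) a x"] c x
    by (intro mob_inverse[OF a]) auto
  finally show ?thesis .
qed

lemma f0inv_f0: "x \<in> Sph \<Longrightarrow> f0inv (f0 x) = x"
proof -
  assume x: "x \<in> Sph"
  have "f0inv (f0 x) = mob (1 / c) a (mob c a (Q (P x)))"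
    unfolding f0_def f0inv_def mob_commute[OF Q(1,2) Qa] ..
  also have "\<dots> = mob (1 / c) a (mob c a x)" by (simp add: PQ)
  also have "\<dots> = x"
    using mden_pos[OF a, of "c" x] mob_Sph[OF a, of "c" x] mden_pos[OF a, of "1 / c" "mob c a x"] c x
    by (intro mob_inverse[OF a]) auto
  finally show ?thesis .
qed

lemma f0_Sph: "x \<in> Sph \<Longrightarrow> f0 x \<in> Sph"
  unfolding f0_def using mob_Sph[OF a c(1) P_Sph] .

lemma f0inv_Sph: "x \<in> Sph \<Longrightarrow> f0inv x \<in> Sph"
  unfolding f0inv_def using mob_Sph[OF a _ Q_Sph, of "1 / c"] c by simp

lemma f0_a: "f0 a = a"
  unfolding f0_def P(2) by (rule mob_a[OF a c(1)])

lemma f0_diffeo: "sphere_diffeo f0"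
proof -
  have "C1_near Sph f0" unfolding f0_def[abs_def] by (rule C1_near_mob_linear[OF a c(1) P(1) Pa])
  moreover have "C1_near Sph f0inv" unfolding f0inv_def[abs_def]
    by (rule C1_near_mob_linear[OF a _ Q(1) Qa]) (use c in simp)
  moreover have "f0 ` Sph = Sph"
    using f0_Sph f0inv_Sph f0_f0inv by (metis (no_types, opaque_lifting) image_subsetI image_eqI subsetI subset_antisym)
  ultimately show ?thesis unfolding sphere_diffeo_def using f0inv_Sph f0_f0inv f0inv_f0 by blast
qed

lemma R_diffeo: "sphere_diffeo (R t)"
  by (rule rot_diffeo[OF a E0])

lemma R_Sph: "x \<in> Sph \<Longrightarrow> R t x \<in> Sph"
  using norm_rot[OF a E0] by simp

lemma norm_Sph_diff:
  fixes x y :: 'a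
  assumes "x \<in> Sph" "y \<in> Sph" shows "(norm (x - y))\<^sup>2 = 2 * (1 - inner x y)"
proof -
  have "inner x x = 1" "inner y y = 1" using assms by (auto simp: norm_eq_1)
  then show ?thesis unfolding power2_norm_eq_inner
    by (simp add: inner_diff_left inner_diff_right inner_commute[of y x])
qed

lemma mden_bounds:
  assumes "x \<in> Sph" shows "2 * c\<^sup>2 \<le> mden c a x" "mden c a x \<le> 2" "1 + inner x a \<le> mden c a x"
proof -
  have h: "\<bar>inner x a\<bar> \<le> 1" by (rule Sph_inner_bound[OF a c(1) assms])
  have c2: "c\<^sup>2 \<le> 1" "0 \<le> c\<^sup>2" using c by (auto intro: power_le_one)
  have "c\<^sup>2 * (1 + inner x a) \<le> 1 * (1 + inner x a)" by (rule mult_right_mono) (use h c2 in auto)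
  moreover have "c\<^sup>2 * (1 - inner x a) \<le> 1 * (1 - inner x a)" by (rule mult_right_mono) (use h c2 in auto)
  moreover have "0 \<le> c\<^sup>2 * (1 - inner x a)" by (rule mult_nonneg_nonneg) (use h c2 in auto)
  ultimately show "2 * c\<^sup>2 \<le> mden c a x" "mden c a x \<le> 2" "1 + inner x a \<le> mden c a x"
    unfolding mden_def by (auto simp: algebra_simps)
qed

lemma \<rho>_bounds: assumes "x \<in> Sph" shows "c \<le> \<rho> x" "\<rho> x \<le> 1 / c" "0 < \<rho> x"
proof -
  have d: "mden c a x > 0" by (rule mden_pos[OF a c(1) assms])
  have "c * mden c a x \<le> c * 2" using mden_bounds[OF assms] c by (intro mult_left_mono) auto
  then show "c \<le> \<rho> x" unfolding \<rho>_def using d by (simp add: le_divide_eq mult.commute)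
  show "\<rho> x \<le> 1 / c" unfolding \<rho>_def using d c mden_bounds(1)[OF assms]
    by (simp add: divide_le_eq field_simps power2_eq_square)
  show "0 < \<rho> x" unfolding \<rho>_def using d c by simp
qed

lemma \<rho>_a: "\<rho> a = c"
  using a by (simp add: \<rho>_def mden_def norm_eq_1)

lemma \<rho>_far: assumes x: "x \<in> Sph" "norm (x + a) \<ge> \<eta>" shows "\<rho> x \<le> 4 * \<eta>\<^sup>2"
proof -
  have aS: "- a \<in> Sph" using a by simp
  have "\<eta>\<^sup>2 \<le> (norm (x - (- a)))\<^sup>2" using x \<eta> by (intro power_mono) auto
  then have h: "\<eta>\<^sup>2 / 2 \<le> 1 + inner x a" unfolding norm_Sph_diff[OF x(1) aS] by simp
  then have m: "\<eta>\<^sup>2 / 2 \<le> mden c a x" using mden_bounds(3)[OF x(1)] by simp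
  have "\<eta>\<^sup>2 > 0" using \<eta> by simp
  then have "\<rho> x \<le> 2 * c / (\<eta>\<^sup>2 / 2)" unfolding \<rho>_def using m c mden_pos[OF a c(1) x(1)] by (intro divide_left_mono mult_pos_pos) auto
  also have "\<dots> = 4 * \<eta>\<^sup>2" using \<eta> by (simp add: c_def power2_eq_square power4_eq_xxxx)
  finally show ?thesis .
qed

lemma f0_dist:
  assumes "x \<in> Sph" "y \<in> Sph"
  shows "norm (f0 x - f0 y) = sqrt (\<rho> x * \<rho> y) * norm (x - y)"
proof -
  have d: "mden c a (P x) \<noteq> 0" "mden c a (P y) \<noteq> 0"
    using mden_pos[OF a c(1) P_Sph] assms by (metis less_irrefl)+
  have md: "mden c a (P z) = mden c a z" for z by (simp add: mden_def Pa)
  have "(norm (f0 x - f0 y))\<^sup>2 = 2 * (1 - inner (f0 x) (f0 y))" by (rule norm_Sph_diff[OF f0_Sph f0_Sph]) fact+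
  also have "\<dots> = 2 * (\<rho> x * \<rho> y * (1 - inner x y))"
    unfolding f0_def mob_inner[OF a c(1) d] P(3) md \<rho>_def ..
  also have "\<dots> = (sqrt (\<rho> x * \<rho> y) * norm (x - y))\<^sup>2"
    unfolding power_mult_distrib norm_Sph_diff[OF assms] using \<rho>_bounds(3)[OF assms(1)] \<rho>_bounds(3)[OF assms(2)] by simp
  finally show ?thesis by (rule power2_eq_imp_eq) (use \<rho>_bounds(3)[OF assms(1)] \<rho>_bounds(3)[OF assms(2)] in simp_all)
qed

lemma f0_bi_Lipschitz:
  assumes "x \<in> Sph" "y \<in> Sph"
  shows "norm (f0 x - f0 y) \<le> 1 / c * norm (x - y)" "c * norm (x - y) \<le> norm (f0 x - f0 y)"
proof -
  have "sqrt (\<rho> x * \<rho> y) \<le> sqrt ((1 / c)\<^sup>2)" unfolding power2_eq_square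
    using \<rho>_bounds[OF assms(1)] \<rho>_bounds[OF assms(2)] c by (intro real_sqrt_le_mono mult_mono) auto
  then show "norm (f0 x - f0 y) \<le> 1 / c * norm (x - y)"
    unfolding f0_dist[OF assms] using c by (intro mult_right_mono) auto
  have "sqrt (c\<^sup>2) \<le> sqrt (\<rho> x * \<rho> y)" unfolding power2_eq_square
    using \<rho>_bounds[OF assms(1)] \<rho>_bounds[OF assms(2)] c by (intro real_sqrt_le_mono mult_mono) auto
  then show "c * norm (x - y) \<le> norm (f0 x - f0 y)"
    unfolding f0_dist[OF assms] using c by (intro mult_right_mono) auto
qed

text \<open>The distance to the fixed point \<open>a\<close> is multiplied by the geometric mean of
  \<open>\<rho> x\<close> and \<open>\<rho> a = c\<close>, both of which are small.\<close>

lemma f0_far_near_a: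
  assumes x: "x \<in> Sph" "norm (x + a) \<ge> \<eta>" shows "norm (f0 x - a) \<le> \<eta> / 4 * norm (x - a)"
proof -
  have aS: "a \<in> Sph" using a by simp
  have "norm (f0 x - f0 a) = sqrt (\<rho> x * c) * norm (x - a)" using f0_dist[OF x(1) aS] by (simp add: \<rho>_a)
  also have "sqrt (\<rho> x * c) \<le> sqrt ((\<eta> / 4)\<^sup>2)"
  proof (rule real_sqrt_le_mono)
    have "\<rho> x * c \<le> 4 * \<eta>\<^sup>2 * \<eta> ^ 4" unfolding c_def using \<rho>_far[OF x] \<eta> by (intro mult_right_mono) auto
    also have "\<dots> = 4 * \<eta> ^ 4 * \<eta>\<^sup>2" by (simp add: mult_ac)
    also have "\<dots> \<le> (1 / 16) * \<eta>\<^sup>2"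
      using power_mono[OF \<eta>(2), of 4] \<eta>(1) by (intro mult_right_mono) (auto simp: power_divide)
    finally show "\<rho> x * c \<le> (\<eta> / 4)\<^sup>2" by (simp add: power_divide)
  qed
  finally show ?thesis using \<eta> f0_a by (simp add: mult_right_mono)
qed

text \<open>The logarithmic scale of \<open>f0\<close>: even when perturbed it expands by at most
  \<open>exp A\<close>, and outside the \<open>\<eta>\<close>-ball about \<open>- a\<close> by at
  most \<open>exp (- A / 4)\<close>. The 2 in \<open>2 / c\<close> and the 8 in
  \<open>8 * \<eta>\<^sup>2\<close> double the factors of \<open>f0\<close> to leave room for
  \<open>\<epsilon>\<close>.\<close>

definition A :: real where "A = ln (2 / c)"

lemma A: "A > 0" "exp A = 2 / c" "8 * \<eta>\<^sup>2 \<le> exp (- A / 4)"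
proof -
  show "exp A = 2 / c" using c by (simp add: A_def)
  have "2 / c > 1" using c by (simp add: less_divide_eq)
  then show "A > 0" unfolding A_def by (rule ln_gt_zero)
  have "\<eta> ^ 4 \<le> (1 / 16) ^ 4" using \<eta> by (intro power_mono) auto
  then have "8192 * \<eta> ^ 4 \<le> 1" by (simp add: power_divide)
  then have "8192 * \<eta> ^ 4 * \<eta> ^ 4 \<le> 1 * \<eta> ^ 4" using \<eta> by (intro mult_right_mono) auto
  moreover have "(8 * \<eta>\<^sup>2) ^ 4 = 4096 * (\<eta> ^ 4 * \<eta> ^ 4)"
    by (simp add: power_mult_distrib flip: power_mult power_add)
  ultimately have "(8 * \<eta>\<^sup>2) ^ 4 \<le> c / 2" unfolding c_def by linarith
  also have "c / 2 = exp (- A)" using \<open>exp A = 2 / c\<close> by (simp add: exp_minus)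
  also have "\<dots> = exp (- A / 4) ^ 4" by (simp flip: exp_of_nat_mult)
  finally show "8 * \<eta>\<^sup>2 \<le> exp (- A / 4)" by (rule power_le_imp_le_base[of _ 3, simplified]) simp
qed

end

text \<open>\<open>J\<close> is the number of rotations over which the potential looks ahead; longer
  runs are too unlikely to matter. Within them \<open>- a\<close> does not return near itself and
  \<open>a\<close> does not come near \<open>- a\<close>, with a margin \<open>16 * \<eta>\<close>
  well above the radii \<open>\<eta> + j * \<epsilon> \<le> 2 * \<eta>\<close> used below.\<close>

locale perturbed_system = moebius_frame a E n P Q \<eta> \<theta> + sphere_ifs fs p
  for a :: "'a::euclidean_space" and E n P Q \<eta> \<theta> and fs :: "('a \<Rightarrow> 'a) list" and p +
  fixes J :: nat and \<epsilon> :: real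
  assumes two: "length fs \<ge> 2"
    and close0: "lip_close \<epsilon> f0 (fs ! 0)"
    and close1: "\<And>i. 1 \<le> i \<Longrightarrow> i < length fs \<Longrightarrow> lip_close \<epsilon> (R \<theta>) (fs ! i)"
    and J: "J \<ge> 1" "(1 - p 0) ^ (J - 1) \<le> 1 / 16"
    and away_b: "\<And>j. 1 \<le> j \<Longrightarrow> j \<le> J \<Longrightarrow> norm (R (real j * \<theta>) (- a) + a) \<ge> 16 * \<eta>"
    and away_a: "\<And>j. j \<le> J \<Longrightarrow> norm (R (real j * \<theta>) a + a) \<ge> 16 * \<eta>"
    and \<epsilon>: "0 < \<epsilon>" "\<epsilon> \<le> 4 * \<eta>\<^sup>2" "\<epsilon> \<le> \<eta> / 2" "real J * \<epsilon> \<le> \<eta>" "\<epsilon> \<le> A * p 0 / 16"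
begin

lemma fS: "i < length fs \<Longrightarrow> x \<in> Sph \<Longrightarrow> (fs ! i) x \<in> Sph"
  using sphere_diffeoD(3)[OF diffeo] by blast

text \<open>By the inequality of arithmetic and geometric means the error \<open>\<epsilon>\<close>
  can be moved into each factor under the root. The bound keeps its product form, so its logarithm
  is still a mean of two one-point terms.\<close>

lemma g0_Lipschitz:
  assumes "x \<in> Sph" "y \<in> Sph"
  shows "norm ((fs ! 0) x - (fs ! 0) y) \<le> sqrt ((\<rho> x + \<epsilon>) * (\<rho> y + \<epsilon>)) * norm (x - y)"
proof -
  have "(fs ! 0) x - (fs ! 0) y = (f0 x - f0 y) - ((f0 x - (fs ! 0) x) - (f0 y - (fs ! 0) y))" by simp
  then have "norm ((fs ! 0) x - (fs ! 0) y) \<le> norm (f0 x - f0 y) + norm ((f0 x - (fs ! 0) x) - (f0 y - (fs ! 0) y))"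
    using norm_triangle_ineq4 by metis
  also have "\<dots> \<le> sqrt (\<rho> x * \<rho> y) * norm (x - y) + \<epsilon> * norm (x - y)"
    using close0 assms unfolding lip_close_def f0_dist[OF assms] by (intro add_mono) auto
  also have "\<dots> = (sqrt (\<rho> x * \<rho> y) + \<epsilon>) * norm (x - y)" by (simp add: distrib_right)
  also have "\<dots> \<le> sqrt ((\<rho> x + \<epsilon>) * (\<rho> y + \<epsilon>)) * norm (x - y)"
  proof (intro mult_right_mono real_le_rsqrt)
    have r: "\<rho> x \<ge> 0" "\<rho> y \<ge> 0" using \<rho>_bounds(3) assms by (auto intro: less_imp_le)
    have "2 * sqrt (\<rho> x * \<rho> y) \<le> \<rho> x + \<rho> y" using arith_geo_mean_sqrt[OF r] by simp
    then have "2 * sqrt (\<rho> x * \<rho> y) * \<epsilon> \<le> (\<rho> x + \<rho> y) * \<epsilon>" using \<epsilon> by (intro mult_right_mono) auto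
    moreover have "(sqrt (\<rho> x * \<rho> y))\<^sup>2 = \<rho> x * \<rho> y" using r by simp
    ultimately show "(sqrt (\<rho> x * \<rho> y) + \<epsilon>)\<^sup>2 \<le> (\<rho> x + \<epsilon>) * (\<rho> y + \<epsilon>)"
      by (simp add: power2_sum algebra_simps power2_eq_square[of \<epsilon>])
  qed simp
  finally show ?thesis .
qed

lemma g1_Lipschitz:
  assumes "1 \<le> i" "i < length fs" "x \<in> Sph" "y \<in> Sph"
  shows "norm ((fs ! i) x - (fs ! i) y) \<le> (1 + \<epsilon>) * norm (x - y)"
proof -
  have "(fs ! i) x - (fs ! i) y = (R \<theta> x - R \<theta> y) - ((R \<theta> x - (fs ! i) x) - (R \<theta> y - (fs ! i) y))" by simp
  then have "norm ((fs ! i) x - (fs ! i) y) \<le> norm (R \<theta> x - R \<theta> y) + norm ((R \<theta> x - (fs ! i) x) - (R \<theta> y - (fs ! i) y))"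
    using norm_triangle_ineq4 by metis
  also have "\<dots> \<le> norm (x - y) + \<epsilon> * norm (x - y)"
    using close1[OF assms(1,2)] assms(3,4) unfolding lip_close_def norm_rot_diff[OF a E0] by (intro add_mono) auto
  finally show ?thesis by (simp add: distrib_right)
qed

lemma g0_far_near_a:
  assumes x: "x \<in> Sph" "norm (x + a) \<ge> \<eta>" shows "norm ((fs ! 0) x - a) \<le> \<eta>"
proof -
  have "norm (x - a) \<le> 2" using norm_triangle_ineq4[of x a] x a by simp
  then have "norm (f0 x - a) \<le> \<eta> / 4 * 2" using f0_far_near_a[OF x] \<eta> mult_left_mono[of "norm (x - a)" 2 "\<eta> / 4"] by linarith
  moreover have "norm (f0 x - (fs ! 0) x) \<le> \<epsilon>" using close0 x by (simp add: lip_close_def)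
  moreover have "norm ((fs ! 0) x - a) \<le> norm (f0 x - a) + norm (f0 x - (fs ! 0) x)"
    using norm_triangle_ineq4[of "f0 x - a" "f0 x - (fs ! 0) x"] by simp
  ultimately show ?thesis using \<epsilon> by simp
qed

definition q :: real where "q = 1 - p 0"

lemma p0: "0 < p 0" "p 0 < 1" "0 < q" "q < 1"
proof -
  show "0 < p 0" by (rule p_pos) (use two in linarith)
  have "p 0 + p 1 = (\<Sum>i\<in>{0, 1}. p i)" by simp
  also have "\<dots> \<le> (\<Sum>i\<in>letters. p i)" using two p_pos by (intro sum_mono2) (auto intro: less_imp_le)
  finally have "p 0 + p 1 \<le> 1" using p_sum by simp
  moreover have "p 1 > 0" by (rule p_pos) (use two in linarith)
  ultimately show "p 0 < 1" by simp
  then show "0 < q" "q < 1" using \<open>0 < p 0\<close> by (auto simp: q_def)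
qed

text \<open>The radius grows by \<open>\<epsilon>\<close> with each rotation still to come, which is
  what one perturbed rotation can lose; this is what makes \<open>visits_shift\<close> true.\<close>

definition visits :: "nat \<Rightarrow> 'a \<Rightarrow> real" where
  "visits j x = of_bool (norm (R (real j * \<theta>) x + a) < \<eta> + real j * \<epsilon>)"

definition \<beta> :: "nat \<Rightarrow> 'a \<Rightarrow> real" where
  "\<beta> i x = (if i = 0 then (if norm (x + a) < \<eta> then A else - A / 4) else \<epsilon>)"

text \<open>The potential penalises the points that a short run of rotations carries close to \<open>- a\<close>, the
  only place where \<open>fs ! 0\<close> expands.\<close>
definition \<psi> :: "'a \<Rightarrow> real" where
  "\<psi> x = A * (2 * p 0 / q) * (\<Sum>j<J. q ^ j * visits j x)"

lemma visits_bounds: "0 \<le> visits j x" "visits j x \<le> 1" by (auto simp: visits_def)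

lemma visits_shift:
  assumes i: "1 \<le> i" "i < length fs" and x: "x \<in> Sph"
  shows "visits j ((fs ! i) x) \<le> visits (Suc j) x"
proof -
  have "norm (R (real (Suc j) * \<theta>) x + a) \<le> norm (R (real j * \<theta>) ((fs ! i) x) + a) + \<epsilon>"
  proof -
    have "R (real (Suc j) * \<theta>) x + a = (R (real j * \<theta>) (R \<theta> x) - R (real j * \<theta>) ((fs ! i) x)) + (R (real j * \<theta>) ((fs ! i) x) + a)"
      by (simp add: rot_rot[OF a E0] algebra_simps)
    then have "norm (R (real (Suc j) * \<theta>) x + a) \<le> norm (R (real j * \<theta>) (R \<theta> x) - R (real j * \<theta>) ((fs ! i) x)) + norm (R (real j * \<theta>) ((fs ! i) x) + a)"
      using norm_triangle_ineq by metis
    also have "norm (R (real j * \<theta>) (R \<theta> x) - R (real j * \<theta>) ((fs ! i) x)) \<le> \<epsilon>"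
      unfolding norm_rot_diff[OF a E0] using close1[OF i] x by (simp add: lip_close_def)
    finally show ?thesis by simp
  qed
  then show ?thesis by (auto simp: visits_def algebra_simps)
qed

text \<open>With geometric weights one rotation shifts the sum: the term of index 0 drops out and
  the new last term is small by the choice of \<open>J\<close>. Thus a point close to
  \<open>- a\<close> is rewarded whenever a rotation is applied.\<close>

lemma \<psi>_rotation:
  assumes i: "1 \<le> i" "i < length fs" and x: "x \<in> Sph"
  shows "q * \<psi> ((fs ! i) x) \<le> \<psi> x - A * (2 * p 0 / q) * visits 0 x + A * p 0 / 8"
proof -
  let ?G = "A * (2 * p 0 / q)"
  have G: "?G \<ge> 0" using A p0 by simp
  have "q * \<psi> ((fs ! i) x) = ?G * (\<Sum>j<J. q ^ Suc j * visits j ((fs ! i) x))"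
    unfolding \<psi>_def by (simp add: sum_distrib_left mult_ac)
  also have "\<dots> \<le> ?G * (\<Sum>j<J. q ^ Suc j * visits (Suc j) x)"
    using p0 by (intro mult_left_mono G sum_mono visits_shift i x) auto
  also have "(\<Sum>j<J. q ^ Suc j * visits (Suc j) x) = (\<Sum>j<Suc J. q ^ j * visits j x) - visits 0 x"
    by (subst sum.lessThan_Suc_shift) simp
  also have "\<dots> = (\<Sum>j<J. q ^ j * visits j x) + q ^ J * visits J x - visits 0 x" by simp
  also have "?G * \<dots> = \<psi> x - ?G * visits 0 x + ?G * (q ^ J * visits J x)" unfolding \<psi>_def by (simp add: algebra_simps)
  also have "?G * (q ^ J * visits J x) \<le> ?G * (q ^ J * 1)" using p0 visits_bounds by (intro mult_left_mono G) auto
  also have "q ^ J = q * q ^ (J - 1)" using J(1) by (cases J) auto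
  also have "?G * (q * q ^ (J - 1) * 1) = A * (2 * p 0) * q ^ (J - 1)" using p0 by simp
  also have "\<dots> \<le> A * (2 * p 0) * (1 / 16)" using J(2) A p0 by (intro mult_left_mono) (auto simp: q_def)
  finally show ?thesis by simp
qed

text \<open>A point outside the ball is sent close to \<open>a\<close>, whose rotations avoid
  \<open>- a\<close>, so the potential vanishes. A point of the ball may be sent anywhere, but at
  most one \<open>j < J\<close> brings its image close to \<open>- a\<close>, because
  \<open>- a\<close> itself does not return; so the weighted sum is at most 1.\<close>

lemma \<psi>_contraction:
  assumes x: "x \<in> Sph"
  shows "\<psi> ((fs ! 0) x) \<le> A * (2 * p 0 / q) * of_bool (norm (x + a) < \<eta>)"
proof -
  let ?G = "A * (2 * p 0 / q)" and ?y = "(fs ! 0) x"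
  have y: "?y \<in> Sph" by (rule fS[OF _ x]) (use two in linarith)
  have G: "?G \<ge> 0" using A p0 by simp
  have J\<epsilon>: "real j * \<epsilon> \<le> \<eta>" if "j \<le> J" for j
  proof -
    have "real j * \<epsilon> \<le> real J * \<epsilon>" using that \<epsilon>(1) by (intro mult_right_mono) auto
    then show ?thesis using \<epsilon>(4) by linarith
  qed
  show ?thesis
  proof (cases "norm (x + a) < \<eta>")
    case False
    then have ya: "norm (?y - a) \<le> \<eta>" using g0_far_near_a[OF x] by simp
    have "visits j ?y = 0" if "j < J" for j
    proof -
      have "R (real j * \<theta>) a + a = (R (real j * \<theta>) ?y + a) - (R (real j * \<theta>) ?y - R (real j * \<theta>) a)" by simp
      then have "norm (R (real j * \<theta>) a + a) \<le> norm (R (real j * \<theta>) ?y + a) + norm (R (real j * \<theta>) ?y - R (real j * \<theta>) a)"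
        using norm_triangle_ineq4 by metis
      then have "16 * \<eta> \<le> norm (R (real j * \<theta>) ?y + a) + \<eta>"
        using away_a[of j] that ya norm_rot_diff[OF a E0, of "real j * \<theta>" ?y a] by linarith
      then show ?thesis using J\<epsilon>[of j] that \<eta> by (simp add: visits_def)
    qed
    then show ?thesis by (simp add: \<psi>_def False)
  next
    case True
    have uniq: "i = j" if ij: "i < J" "j < J" "visits i ?y \<noteq> 0" "visits j ?y \<noteq> 0" for i j
    proof -
      have False if ij: "i < j" "j < J" "visits i ?y \<noteq> 0" "visits j ?y \<noteq> 0" for i j
      proof -
        let ?d = "real (j - i) * \<theta>"
        have e: "R (real j * \<theta>) ?y = R ?d (R (real i * \<theta>) ?y)"
          using ij by (simp add: rot_rot[OF a E0] of_nat_diff algebra_simps)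
        have "R ?d (- a) + a = (R (real j * \<theta>) ?y + a) - (R ?d (R (real i * \<theta>) ?y) - R ?d (- a))"
          unfolding e by simp
        then have "norm (R ?d (- a) + a) \<le> norm (R (real j * \<theta>) ?y + a) + norm (R ?d (R (real i * \<theta>) ?y) - R ?d (- a))"
          using norm_triangle_ineq4 by metis
        also have "norm (R ?d (R (real i * \<theta>) ?y) - R ?d (- a)) = norm (R (real i * \<theta>) ?y + a)"
          unfolding norm_rot_diff[OF a E0] by simp
        finally have "16 * \<eta> \<le> norm (R (real j * \<theta>) ?y + a) + norm (R (real i * \<theta>) ?y + a)"
          using away_b[of "j - i"] ij by linarith
        moreover have "norm (R (real j * \<theta>) ?y + a) < \<eta> + real j * \<epsilon>" "norm (R (real i * \<theta>) ?y + a) < \<eta> + real i * \<epsilon>"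
          using ij by (auto simp: visits_def)
        ultimately show False using J\<epsilon>[of i] J\<epsilon>[of j] ij \<eta> by linarith
      qed
      then show ?thesis using ij by (metis linorder_neqE_nat)
    qed
    have "(\<Sum>j<J. q ^ j * visits j ?y) \<le> 1"
    proof (cases "\<exists>j<J. visits j ?y \<noteq> 0")
      case True
      then obtain j where j: "j < J" "visits j ?y \<noteq> 0" by blast
      have "(\<Sum>i<J. q ^ i * visits i ?y) = (\<Sum>i<J. if i = j then q ^ j * visits j ?y else 0)"
        using uniq j by (intro sum.cong refl) auto
      also have "\<dots> = q ^ j * visits j ?y" using j by simp
      also have "\<dots> \<le> 1 * 1" using p0 visits_bounds by (intro mult_mono power_le_one) auto
      finally show ?thesis by simp
    next
      case False
      then have "(\<Sum>j<J. q ^ j * visits j ?y) = 0" by (intro sum.neutral) auto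
      then show ?thesis by simp
    qed
    then have "\<psi> ?y \<le> ?G * 1" unfolding \<psi>_def by (intro mult_left_mono G)
    then show ?thesis using True by simp
  qed
qed

theorem contracting: "\<exists>s K r. contracting_ifs fs p s K r"
proof (rule potential_contraction)
  let ?T = "A + A * (2 * p 0 / q) * real J + \<epsilon>"
  have G: "A * (2 * p 0 / q) \<ge> 0" using A p0 by simp
  then have GJ: "A * (2 * p 0 / q) * real J \<ge> 0" by (rule mult_nonneg_nonneg) simp
  show "\<bar>\<beta> i x\<bar> \<le> ?T" for i x using A \<epsilon> GJ unfolding \<beta>_def by auto
  show "\<bar>\<psi> x\<bar> \<le> ?T" for x
  proof -
    have "(\<Sum>j<J. q ^ j * visits j x) \<le> (\<Sum>j<J. 1 * 1)"
      using p0 visits_bounds by (intro sum_mono mult_mono power_le_one) auto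
    then have "\<psi> x \<le> A * (2 * p 0 / q) * real J" unfolding \<psi>_def using G by (intro mult_left_mono) auto
    moreover have "\<psi> x \<ge> 0" unfolding \<psi>_def using p0 visits_bounds by (intro mult_nonneg_nonneg[OF G] sum_nonneg) auto
    ultimately show ?thesis using A \<epsilon> by simp
  qed
  show "norm ((fs ! i) x - (fs ! i) y) \<le> exp ((\<beta> i x + \<beta> i y) / 2) * norm (x - y)"
    if i: "i \<in> letters" and x: "x \<in> Sph" and y: "y \<in> Sph" for i x y
  proof (cases "i = 0")
    case False
    have "norm ((fs ! i) x - (fs ! i) y) \<le> (1 + \<epsilon>) * norm (x - y)" using g1_Lipschitz[of i x y] False i x y by simp
    also have "\<dots> \<le> exp \<epsilon> * norm (x - y)" by (intro mult_right_mono exp_ge_add_one_self) simp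
    finally show ?thesis using False by (simp add: \<beta>_def)
  next
    case True
    have r: "\<rho> z + \<epsilon> \<le> exp (\<beta> 0 z)" if "z \<in> Sph" for z
    proof (cases "norm (z + a) < \<eta>")
      case near: True
      have "4 * \<eta>\<^sup>2 \<le> 4 * (1 / 16)\<^sup>2" using \<eta> by (intro mult_left_mono power_mono) auto
      then have "\<epsilon> \<le> 1" using \<epsilon> by (simp add: power2_eq_square)
      moreover have "1 \<le> 1 / c" using c by simp
      ultimately have "\<rho> z + \<epsilon> \<le> 2 / c" using \<rho>_bounds(2)[OF that] by simp
      then show ?thesis using near A by (simp add: \<beta>_def)
    next
      case far: False
      then have "\<rho> z + \<epsilon> \<le> 8 * \<eta>\<^sup>2" using \<rho>_far[OF that] \<epsilon> by simp
      then show ?thesis using far A(3) by (simp add: \<beta>_def)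
    qed
    have "norm ((fs ! 0) x - (fs ! 0) y) \<le> sqrt ((\<rho> x + \<epsilon>) * (\<rho> y + \<epsilon>)) * norm (x - y)" by (rule g0_Lipschitz[OF x y])
    also have "\<dots> \<le> sqrt (exp (\<beta> 0 x) * exp (\<beta> 0 y)) * norm (x - y)"
      using r[OF x] r[OF y] \<rho>_bounds(3)[OF x] \<rho>_bounds(3)[OF y] \<epsilon> by (intro mult_right_mono real_sqrt_le_mono mult_mono) auto
    also have "sqrt (exp (\<beta> 0 x) * exp (\<beta> 0 y)) = exp ((\<beta> 0 x + \<beta> 0 y) / 2)"
      by (rule real_sqrt_unique) (simp_all add: power2_eq_square flip: exp_add)
    finally show ?thesis using True by simp
  qed
  \<comment> \<open>Outside the ball the gain \<open>A * p 0 / 4\<close> from \<open>fs ! 0\<close>,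
    less \<open>A * p 0 / 8\<close> for the cut-off at \<open>J\<close> and
    \<open>A * p 0 / 16\<close> for the perturbed rotations, leaves \<open>A * p 0 / 16\<close>.
    Inside it the expansion costs \<open>A * p 0\<close> and the potential returns
    \<open>2 * A * p 0\<close>, which explains the factor 2 in \<open>\<psi>\<close>.\<close>
  show "A * p 0 / 16 > 0" using A p0 by simp
  fix x :: 'a assume x: "x \<in> Sph"
  let ?I = "letters - {0}" and ?G = "A * (2 * p 0 / q)"
  have sp: "(\<Sum>i\<in>letters. F i) = F 0 + (\<Sum>i\<in>?I. F i)" for F :: "nat \<Rightarrow> real"
    using two by (subst sum.remove[of _ 0]) auto
  have sq: "(\<Sum>i\<in>?I. p i) = q" using sp[of p] p_sum by (simp add: q_def)
  \<comment> \<open>All rotations share this bound on the new potential. Multiplied by their total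
    probability \<open>q\<close> it gives back \<open>\<psi> x\<close>, so the potential itself
    cancels from the drift.\<close>
  define \<Psi> where "\<Psi> = (\<psi> x - ?G * visits 0 x + A * p 0 / 8) / q"
  have 1: "(\<Sum>i\<in>?I. p i * (\<beta> i x + \<psi> ((fs ! i) x) - \<psi> x)) \<le> (\<Sum>i\<in>?I. p i * (\<epsilon> + \<Psi> - \<psi> x))"
  proof (intro sum_mono mult_left_mono)
    fix i assume i: "i \<in> ?I"
    have "q * \<psi> ((fs ! i) x) \<le> \<psi> x - ?G * visits 0 x + A * p 0 / 8" by (rule \<psi>_rotation[OF _ _ x]) (use i in auto)
    then have "\<psi> ((fs ! i) x) \<le> \<Psi>" unfolding \<Psi>_def using p0 by (simp add: le_divide_eq mult.commute)
    then show "\<beta> i x + \<psi> ((fs ! i) x) - \<psi> x \<le> \<epsilon> + \<Psi> - \<psi> x" using i by (simp add: \<beta>_def)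
    show "0 \<le> p i" using i p_pos by (auto intro: less_imp_le)
  qed
  also have "\<dots> = q * (\<epsilon> + \<Psi> - \<psi> x)" unfolding sq[symmetric] by (simp add: sum_distrib_right)
  also have "\<dots> = q * \<epsilon> + q * \<Psi> - q * \<psi> x" by (simp add: algebra_simps)
  also have "q * \<Psi> = \<psi> x - ?G * visits 0 x + A * p 0 / 8" unfolding \<Psi>_def using p0 by simp
  finally have 2: "(\<Sum>i\<in>letters. p i * (\<beta> i x + \<psi> ((fs ! i) x) - \<psi> x)) \<le>
     p 0 * (\<beta> 0 x + \<psi> ((fs ! 0) x) - \<psi> x) + (q * \<epsilon> + (\<psi> x - ?G * visits 0 x + A * p 0 / 8) - q * \<psi> x)"
    unfolding sp[of "\<lambda>i. p i * (\<beta> i x + \<psi> ((fs ! i) x) - \<psi> x)"] by simp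
  have vis0: "visits 0 x = of_bool (norm (x + a) < \<eta>)" by (simp add: visits_def rot_0[OF a E0])
  have "p 0 * \<psi> ((fs ! 0) x) \<le> p 0 * (?G * visits 0 x)"
    unfolding vis0 using p0 by (intro mult_left_mono \<psi>_contraction x) auto
  moreover define \<Gamma> where "\<Gamma> = ?G * visits 0 x"
  ultimately have 3: "p 0 * \<psi> ((fs ! 0) x) \<le> p 0 * \<Gamma>" by simp
  have "(1 - p 0) * \<Gamma> = \<Gamma> - p 0 * \<Gamma>" "q * \<psi> x = \<psi> x - p 0 * \<psi> x"
    "p 0 * (\<beta> 0 x + \<psi> ((fs ! 0) x) - \<psi> x) = p 0 * \<beta> 0 x + p 0 * \<psi> ((fs ! 0) x) - p 0 * \<psi> x"
    by (simp_all add: q_def algebra_simps)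
  with 2[folded \<Gamma>_def] 3 have 3: "(\<Sum>i\<in>letters. p i * (\<beta> i x + \<psi> ((fs ! i) x) - \<psi> x)) \<le>
     p 0 * \<beta> 0 x + q * \<epsilon> - (1 - p 0) * (?G * visits 0 x) + A * p 0 / 8"
    unfolding \<Gamma>_def[symmetric] by linarith
  have "(1 - p 0) * (?G * visits 0 x) = 2 * (A * p 0) * visits 0 x" using p0 by (simp add: q_def)
  moreover have "q * \<epsilon> \<le> 1 * \<epsilon>" using p0 \<epsilon> by (intro mult_right_mono) auto
  ultimately have 4: "(\<Sum>i\<in>letters. p i * (\<beta> i x + \<psi> ((fs ! i) x) - \<psi> x)) \<le>
     p 0 * \<beta> 0 x + A * p 0 / 16 - 2 * (A * p 0) * visits 0 x + A * p 0 / 8" using 3 \<epsilon> by linarith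
  have Ap: "A * p 0 > 0" using A p0 by simp
  show "(\<Sum>i\<in>letters. p i * (\<beta> i x + \<psi> ((fs ! i) x) - \<psi> x)) \<le> - (A * p 0 / 16)"
  proof (cases "norm (x + a) < \<eta>")
    case True
    then show ?thesis using 4 Ap by (simp add: vis0 \<beta>_def mult.commute)
  next
    case False
    then show ?thesis using 4 Ap by (simp add: vis0 \<beta>_def mult.commute)
  qed
qed

end

section \<open>Reaching the pole\<close>

text \<open>Words that approximate one target after another, each starting where the previous one
  ended, are concatenated to a single dense orbit.\<close>

lemma (in sphere_ifs) reach_imp_minimal:
  assumes reach: "\<And>x y e. x \<in> Sph \<Longrightarrow> y \<in> Sph \<Longrightarrow> 0 < e \<Longrightarrow> \<exists>w. set w \<subseteq> letters \<and> norm (word fs w x - y) < e"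
  shows "minimal_ifs fs"
  unfolding minimal_ifs_def
proof
  fix x :: 'a assume x: "x \<in> Sph"
  obtain D :: "'a set" where D: "countable D" "D \<subseteq> Sph" "Sph \<subseteq> closure D" by (rule separable)
  have "D \<noteq> {}" using D(3) x by auto
  then have rng: "range (from_nat_into D) = D" using D(1) by (rule range_from_nat_into)
  \<comment> \<open>Decoding pairs lists each point of \<open>D\<close> infinitely often, hence with
    arbitrarily small tolerance \<open>1 / (n + 1)\<close>.\<close>
  define tgt where "tgt n = from_nat_into D (fst (prod_decode n))" for n
  have tgt: "tgt n \<in> Sph" for n using rng D(2) unfolding tgt_def by blast
  have "letters \<noteq> {}" using p_sum by auto
  then have 0: "0 \<in> letters" by auto
  \<comment> \<open>A preliminary letter 0 keeps the words nonempty, so that their concatenation is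
    infinite.\<close>
  have "\<exists>w. set w \<subseteq> letters \<and> w \<noteq> [] \<and> norm (word fs w z - tgt n) < 1 / real (Suc n)" if z: "z \<in> Sph" for z n
  proof -
    have "(fs ! 0) z \<in> Sph" using sphere_diffeoD(3)[OF diffeo] 0 z by blast
    then obtain w where "set w \<subseteq> letters" "norm (word fs w ((fs ! 0) z) - tgt n) < 1 / real (Suc n)"
      using reach[OF _ tgt[of n], of "(fs ! 0) z" "1 / real (Suc n)"] by auto
    then show ?thesis using 0 by (intro exI[of _ "0 # w"]) auto
  qed
  then obtain W where W: "\<And>z n. z \<in> Sph \<Longrightarrow> set (W z n) \<subseteq> letters \<and> W z n \<noteq> [] \<and> norm (word fs (W z n) z - tgt n) < 1 / real (Suc n)"
    by metis
  define u where "u = rec_nat [] (\<lambda>n v. v @ W (word fs v x) n)"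
  have u0: "u 0 = []" and uS: "u (Suc n) = u n @ W (word fs (u n) x) n" for n by (auto simp: u_def)
  have uL: "set (u n) \<subseteq> letters" for n
  proof (induction n)
    case (Suc n)
    show ?case using Suc W[OF word_Sph[OF Suc x], of n] by (simp add: uS)
  qed (simp add: u0)
  have len: "n \<le> length (u n)" for n
  proof (induction n)
    case (Suc n)
    have "W (word fs (u n) x) n \<noteq> []" using W[OF word_Sph[OF uL x]] by blast
    then have "length (W (word fs (u n) x) n) \<ge> 1" by (cases "W (word fs (u n) x) n") auto
    then show ?case using Suc by (simp add: uS)
  qed simp
  have pre: "i < length (u m) \<Longrightarrow> i < length (u (m + d)) \<and> u (m + d) ! i = u m ! i" for i m d
    by (induction d) (auto simp: uS nth_append)
  \<comment> \<open>Position \<open>i\<close> is final from \<open>u (Suc i)\<close> on, whose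
    length is at least \<open>i + 1\<close>.\<close>
  define \<omega> where "\<omega> i = u (Suc i) ! i" for i
  have \<omega>: "\<omega> i = u m ! i" if "i < length (u m)" for i m
  proof -
    have "i < length (u (Suc i))" using len[of "Suc i"] by simp
    then show ?thesis using pre[of i "Suc i" m] pre[OF that, of "Suc i"] by (simp add: \<omega>_def add.commute)
  qed
  have iter: "ifs_iter fs \<omega> (length (u m)) x = word fs (u m) x" for m
    unfolding ifs_iter_word using \<omega>[of _ m] by (intro arg_cong[where f="\<lambda>w. word fs w x"] nth_equalityI) auto
  show "\<exists>\<omega>. (\<forall>j. \<omega> j < length fs) \<and> Sph \<subseteq> closure (range (\<lambda>j. ifs_iter fs \<omega> j x))"
  proof (intro exI conjI allI subsetI)
    fix j
    have "j < length (u (Suc j))" using len[of "Suc j"] by simp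
    then have "\<omega> j \<in> set (u (Suc j))" by (simp add: \<omega>_def)
    then show "\<omega> j < length fs" using uL by blast
  next
    fix y :: 'a assume "y \<in> Sph"
    show "y \<in> closure (range (\<lambda>j. ifs_iter fs \<omega> j x))"
      unfolding closure_approachable
    proof (intro allI impI)
      fix e :: real assume e: "0 < e"
      have "y \<in> closure D" using D(3) \<open>y \<in> Sph\<close> by blast
      then obtain d where d: "d \<in> D" "dist d y < e / 2" unfolding closure_approachable using e by (meson half_gt_zero)
      have "d \<in> range (from_nat_into D)" using d(1) rng by simp
      then obtain i where i: "from_nat_into D i = d" by auto
      obtain k :: nat where k: "1 / real (Suc k) < e / 2" using e nat_approx_posE half_gt_zero by metis
      define l where "l = prod_encode (i, k)"
      have tl: "tgt l = d" by (simp add: tgt_def l_def i)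
      have "k \<le> l" unfolding l_def by (rule le_prod_encode_2)
      then have "1 / real (Suc l) \<le> 1 / real (Suc k)" by (simp add: frac_le)
      moreover have "norm (word fs (u (Suc l)) x - d) < 1 / real (Suc l)"
        using W[OF word_Sph[OF uL x], of l l] by (simp add: uS tl)
      ultimately have "dist (word fs (u (Suc l)) x) d < e / 2" using k by (simp add: dist_norm)
      then have "dist (word fs (u (Suc l)) x) y < e" using d(2) dist_triangle_half_r[of d _ e y] by (metis dist_commute)
      then show "\<exists>z\<in>range (\<lambda>j. ifs_iter fs \<omega> j x). dist z y < e" using iter[of "Suc l"] by (metis rangeI)
    qed
  qed
qed

definition blocks :: "nat list \<Rightarrow> nat list" where
  "blocks js = concat (map (\<lambda>j. 0 # replicate j 1) js)"

lemma blocks_simps [simp]: "blocks [] = []" "blocks (j # js) = 0 # replicate j 1 @ blocks js"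
  by (simp_all add: blocks_def)

lemma set_blocks: "set (blocks js) \<subseteq> {0, 1}"
  by (induction js) auto

lemma length_blocks: "(\<And>j. j \<in> set js \<Longrightarrow> j \<le> b) \<Longrightarrow> length (blocks js) \<le> length js * Suc b"
proof (induction js)
  case (Cons j js)
  have "j \<le> b" "length (blocks js) \<le> length js * Suc b" using Cons by auto
  then show ?case by simp
qed simp

section \<open>Unperturbed words that lead from and to the pole\<close>

context moebius_frame
begin

lemma norm_R_a_add: "norm (R t a + a) = sqrt (2 * (1 + cos t))"
proof -
  have "(norm (R t a - (- a)))\<^sup>2 = 2 * (1 - inner (R t a) (- a))"
    using a R_Sph[of a t] by (intro norm_Sph_diff) auto
  also have "inner (R t a) (- a) = - cos t"
    using rot_inner_a[OF a E0, of t a] a E0 by (simp add: norm_eq_1)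
  finally show ?thesis by (simp add: real_sqrt_unique[symmetric])
qed

text \<open>The idealised form of a word of blocks, with arbitrary real angles in place of multiples
  of \<open>\<theta>\<close>.\<close>

definition rot_chain :: "real list \<Rightarrow> 'a \<Rightarrow> 'a" where
  "rot_chain ts = fold (\<lambda>t x. R t (f0 x)) ts"

lemma rot_chain_simps [simp]: "rot_chain [] x = x" "rot_chain (t # ts) x = rot_chain ts (R t (f0 x))" "rot_chain (us @ ts) x = rot_chain ts (rot_chain us x)"
  by (simp_all add: rot_chain_def)

lemma rot_chain_Lipschitz:
  "x \<in> Sph \<Longrightarrow> y \<in> Sph \<Longrightarrow> norm (rot_chain ts x - rot_chain ts y) \<le> (1 / c) ^ length ts * norm (x - y)"
proof (induction ts arbitrary: x y)
  case (Cons t ts)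
  have "norm (rot_chain (t # ts) x - rot_chain (t # ts) y) \<le> (1 / c) ^ length ts * norm (R t (f0 x) - R t (f0 y))"
    unfolding rot_chain_simps by (rule Cons.IH[OF R_Sph[OF f0_Sph] R_Sph[OF f0_Sph]]) (rule Cons.prems)+
  also have "\<dots> \<le> (1 / c) ^ length ts * (1 / c * norm (x - y))"
    unfolding norm_rot_diff[OF a E0] using c by (intro mult_left_mono f0_bi_Lipschitz Cons.prems) auto
  finally show ?case by simp
qed simp

text \<open>Earlier errors are magnified by at most \<open>1 / c\<close> per step; the base
  \<open>1 + 1 / c\<close> also absorbs the new error committed at each step.\<close>

lemma rot_chain_close:
  assumes "list_all2 (\<lambda>t s. \<forall>x\<in>Sph. norm (R t x - R s x) \<le> \<kappa>) ts ss" "x \<in> Sph" "0 \<le> \<kappa>"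
  shows "norm (rot_chain ts x - rot_chain ss x) \<le> \<kappa> * (1 + 1 / c) ^ length ts"
  using assms
proof (induction ts ss arbitrary: x rule: list_all2_induct)
  case (Cons t ts s ss)
  let ?u = "R t (f0 x)" and ?v = "R s (f0 x)"
  have S: "?u \<in> Sph" "?v \<in> Sph" "f0 x \<in> Sph" using R_Sph f0_Sph Cons.prems by auto
  have 1: "norm (rot_chain ts ?u - rot_chain ts ?v) \<le> (1 / c) ^ length ts * norm (?u - ?v)" by (rule rot_chain_Lipschitz[OF S(1,2)])
  have 2: "norm (rot_chain ts ?v - rot_chain ss ?v) \<le> \<kappa> * (1 + 1 / c) ^ length ts" by (rule Cons.IH[OF S(2) Cons.prems(2)])
  have "norm (rot_chain (t # ts) x - rot_chain (s # ss) x) \<le> (1 / c) ^ length ts * norm (?u - ?v) + \<kappa> * (1 + 1 / c) ^ length ts"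
    unfolding rot_chain_simps using norm_triangle_ineq[of "rot_chain ts ?u - rot_chain ts ?v" "rot_chain ts ?v - rot_chain ss ?v"] 1 2 by simp
  also have "\<dots> \<le> (1 + 1 / c) ^ length ts * (1 / c * \<kappa>) + \<kappa> * (1 + 1 / c) ^ length ts"
  proof (intro add_right_mono mult_mono power_mono)
    have "norm (?u - ?v) \<le> 1 * \<kappa>" using Cons.hyps(1) S(3) by simp
    also have "\<dots> \<le> 1 / c * \<kappa>" using c Cons.prems by (intro mult_right_mono) auto
    finally show "norm (?u - ?v) \<le> 1 / c * \<kappa>" .
  qed (use c in auto)
  also have "\<dots> = \<kappa> * (1 + 1 / c) ^ length (t # ts)" by (simp add: algebra_simps)
  finally show ?case .
qed simp

text \<open>Going backwards, a rotation removes the \<open>E 0\<close>-coordinate of a point and the inverse of \<open>f0\<close>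
  shifts the vanishing coordinates, so that \<open>n\<close> steps lead to the pole \<open>a\<close>.\<close>
lemma reach_pole:
  assumes "y \<in> Sph" "1 \<le> r" "r \<le> n" "\<And>i. 1 \<le> i \<Longrightarrow> i \<le> n - r \<Longrightarrow> inner y (E i) = 0"
  shows "\<exists>ts. length ts = r \<and> rot_chain ts a = y \<and> (1 - inner y a \<le> (c\<^sup>2 / 2) ^ (r - 1) \<longrightarrow> (\<forall>t\<in>set ts. 0 \<le> cos t))"
  using assms
proof (induction r arbitrary: y)
  case (Suc r)
  note y = Suc.prems(1)
  define h u where "h = inner y a" and "u = inner y (E 0)"
  define b where "b = cmod (Complex h u)"
  have b0: "b \<ge> 0" by (simp add: b_def)
  \<comment> \<open>Polar coordinates of the projection to the rotation plane. If the projection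
    vanishes the angle 0 serves, having positive cosine.\<close>
  obtain t where t: "h = b * cos t" "u = b * sin t" "h \<ge> 0 \<Longrightarrow> cos t \<ge> 0"
  proof (cases "b = 0")
    case True
    then show ?thesis using that[of 0] by (simp add: b_def complex_eq_iff)
  next
    case False
    define t where "t = Arg (Complex h u)"
    have "rcis b t = Complex h u" unfolding b_def t_def by (rule rcis_cmod_Arg)
    then have "h = b * cos t" "u = b * sin t" by (auto simp: complex_eq_iff rcis_def)
    moreover have "cos t \<ge> 0" if "h \<ge> 0" using that calculation(1) False b0 by (simp add: zero_le_mult_iff)
    ultimately show ?thesis using that by blast
  qed
  define y1 where "y1 = R (- t) y"
  have y1S: "y1 \<in> Sph" unfolding y1_def by (rule R_Sph[OF y])
  have cs: "cos t * cos t + sin t * sin t = 1" using sin_cos_squared_add[of t] by (simp add: power2_eq_square)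
  have y1a: "inner y1 a = b"
  proof -
    have "inner y1 a = b * (cos t * cos t + sin t * sin t)"
      unfolding y1_def rot_inner_a[OF a E0] h_def[symmetric] u_def[symmetric] t(1,2) cos_minus sin_minus by algebra
    then show ?thesis unfolding cs by simp
  qed
  have y1e: "inner y1 (E 0) = 0"
    unfolding y1_def rot_inner_e[OF a E0] h_def[symmetric] u_def[symmetric] t(1,2) by simp
  have y1i: "inner y1 (E i) = 0" if "i \<le> n - Suc r" for i
  proof (cases "i = 0")
    case False
    then have i: "1 \<le> i" "i < n" using that Suc.prems by auto
    have "inner y1 (E i) = inner y (E i)"
      unfolding y1_def by (rule rot_inner_other[OF a E0]) (use E i n in auto)
    then show ?thesis using Suc.prems(4)[OF i(1) that] by simp
  qed (use y1e in simp)
  have yy1: "y = R t y1" unfolding y1_def by (simp add: rot_rot[OF a E0] rot_0[OF a E0])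
  have pos: "cos t \<ge> 0" if "1 - h \<le> (c\<^sup>2 / 2) ^ r"
  proof -
    have "(c\<^sup>2 / 2) ^ r \<le> 1" using c by (intro power_le_one) (auto simp: power_le_one intro: order_trans[of _ 1])
    then show ?thesis using that by (intro t(3)) simp
  qed
  show ?case
  proof (cases "r = 0")
    case True
    have "y1 = b *\<^sub>R a" using span[of y1] y1i True y1a by simp
    moreover have "b = 1" using y1S calculation a b0 by simp
    ultimately have "y1 = a" by simp
    then have "rot_chain [t] a = y" using yy1 f0_a by simp
    then show ?thesis using True pos by (intro exI[of _ "[t]"]) (simp add: h_def)
  next
    case False
    define y2 where "y2 = f0inv y1"
    have y2S: "y2 \<in> Sph" unfolding y2_def by (rule f0inv_Sph[OF y1S])
    have ic: "1 / c > 0" using c by simp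
    have md: "mden (1 / c) a (Q y1) > 0" by (rule mden_pos[OF a ic Q_Sph[OF y1S]])
    have y2i: "inner y2 (E i) = 0" if i: "1 \<le> i" "i \<le> n - r" for i
    proof -
      obtain i' where i': "i = Suc i'" using i by (cases i) auto
      have "Suc i' < n" using i i' False Suc.prems by auto
      then have "inner (Q y1) (E i) = inner y1 (E i')" "inner a (E i) = 0" using QE E(2) i' by auto
      moreover have "inner y1 (E i') = 0" using y1i[of i'] i i' Suc.prems by simp
      ultimately show ?thesis unfolding y2_def f0inv_def mob_def by (simp add: inner_add_left inner_diff_left)
    qed
    obtain ts where ts: "length ts = r" "rot_chain ts a = y2" "1 - inner y2 a \<le> (c\<^sup>2 / 2) ^ (r - 1) \<longrightarrow> (\<forall>t\<in>set ts. 0 \<le> cos t)"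
      using Suc.IH[OF y2S _ _ y2i] False Suc.prems by auto
    have "rot_chain (ts @ [t]) a = y" using ts(2) yy1 f0_f0inv[OF y1S] by (simp add: y2_def)
    \<comment> \<open>A backward step increases \<open>1 - inner y a\<close> at most by the factor
      \<open>2 / c\<^sup>2\<close>, so the threshold \<open>(c\<^sup>2 / 2) ^ r\<close> becomes
      \<open>(c\<^sup>2 / 2) ^ (r - 1)\<close>, as the shorter chain requires. Nonnegative cosines
      keep the rotated pole away from \<open>- a\<close>.\<close>
    moreover have "\<forall>t\<in>set (ts @ [t]). 0 \<le> cos t" if near: "1 - h \<le> (c\<^sup>2 / 2) ^ r"
    proof -
      have "h \<le> b" unfolding t(1) using b0 by (simp add: mult_left_le)
      have b1: "b \<le> 1" using Sph_inner_bound[OF a c(1) y1S] y1a by simp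
      have m: "mden (1 / c) a (Q y1) = (1 + b) + (1 / c)\<^sup>2 * (1 - b)" unfolding mden_def Qa y1a ..
      have m1: "mden (1 / c) a (Q y1) \<ge> 1" unfolding m using b0 b1 by simp
      have "1 - inner y2 a = 2 * (1 / c)\<^sup>2 * (1 - b) / mden (1 / c) a (Q y1)"
        unfolding y2_def f0inv_def using md by (subst mob_inner_a[OF a ic]) (simp_all add: Qa y1a m field_simps)
      also have "\<dots> \<le> 2 * (1 / c)\<^sup>2 * (1 - b) / 1" using m1 b1 by (intro divide_left_mono) auto
      also have "\<dots> \<le> 2 * (1 / c)\<^sup>2 * (c\<^sup>2 / 2) ^ r" using near \<open>h \<le> b\<close> by simp (intro mult_left_mono, auto)
      also have "\<dots> = (c\<^sup>2 / 2) ^ (r - 1)" using False c by (cases r) (auto simp: power_divide)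
      finally show ?thesis using ts(3) pos[OF near] by auto
    qed
    ultimately show ?thesis using ts(1) by (intro exI[of _ "ts @ [t]"]) (simp add: h_def)
  qed
qed simp

text \<open>The bound \<open>b\<close> must not depend on \<open>t\<close>: Kronecker's theorem is
  applied to the finitely many multiples of \<open>1 / N\<close>, and an arbitrary angle is rounded
  to one of them.\<close>

lemma rot_approx:
  assumes irr: "\<theta> / (2 * pi) \<notin> \<rat>" and \<kappa>: "0 < \<kappa>"
  shows "\<exists>b. \<forall>t. \<exists>j\<le>b. \<forall>x\<in>Sph. norm (R (real j * \<theta>) x - R t x) \<le> \<kappa>"
proof -
  \<comment> \<open>Grid width and Kronecker error contribute \<open>d\<close> each. The full angle
    \<open>2 * pi\<close> and the constant 4 of \<open>rot_dist\<close> turn this into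
    \<open>4 * (2 * pi * (2 * d)) = \<kappa>\<close>.\<close>
  define d where "d = \<kappa> / (16 * pi)"
  have d: "d > 0" using \<kappa> by (simp add: d_def)
  obtain N :: nat where N: "N > 0" "1 / real N < d"
    using d by (metis gr_zeroI inverse_eq_divide real_arch_inverse)
  have "\<exists>k. \<bar>frac (real k * (\<theta> / (2 * pi))) - real l / real N\<bar> < d" if "l \<le> N" for l
    using Kronecker_approx_1_explicit[OF irr, of "real l / real N" d] that N d by (metis divide_le_eq_1_pos of_nat_0_le_iff of_nat_0_less_iff of_nat_le_iff zero_le_divide_iff)
  then obtain k where k: "\<And>l. l \<le> N \<Longrightarrow> \<bar>frac (real (k l) * (\<theta> / (2 * pi))) - real l / real N\<bar> < d" by metis
  define b where "b = (\<Sum>l\<le>N. k l)"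
  have kb: "k l \<le> b" if "l \<le> N" for l unfolding b_def using that by (intro member_le_sum) auto
  have fr: "R s x = R (2 * pi * frac (s / (2 * pi))) x" for s and x :: 'a
  proof -
    have "s = 2 * pi * frac (s / (2 * pi)) + 2 * pi * of_int \<lfloor>s / (2 * pi)\<rfloor>"
      unfolding frac_def by (simp add: algebra_simps)
    then show ?thesis using rot_periodic[OF a E0] by metis
  qed
  have "\<exists>j\<le>b. \<forall>x\<in>Sph. norm (R (real j * \<theta>) x - R t x) \<le> \<kappa>" for t
  proof -
    define \<alpha> where "\<alpha> = frac (t / (2 * pi))"
    have \<alpha>: "0 \<le> \<alpha>" "\<alpha> < 1" by (simp_all add: \<alpha>_def frac_lt_1)
    define l where "l = nat \<lfloor>\<alpha> * real N\<rfloor>"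
    have l: "real l \<le> \<alpha> * real N" "\<alpha> * real N < real l + 1" using \<alpha> by (auto simp: l_def)
    have "\<alpha> * real N \<le> 1 * real N" using \<alpha> by (intro mult_right_mono) auto
    then have lN: "l \<le> N" using l(1) by linarith
    have "real l / real N \<le> \<alpha>" "\<alpha> \<le> (real l + 1) / real N"
      using l N by (simp_all add: divide_le_eq le_divide_eq)
    then have "\<bar>real l / real N - \<alpha>\<bar> \<le> 1 / real N" by (simp add: add_divide_distrib abs_le_iff)
    then have "\<bar>frac (real (k l) * (\<theta> / (2 * pi))) - \<alpha>\<bar> \<le> 2 * d" using k[OF lN] N by linarith
    then have "4 * \<bar>2 * pi * frac (real (k l) * (\<theta> / (2 * pi))) - 2 * pi * \<alpha>\<bar> \<le> 4 * (2 * pi * (2 * d))"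
      by (simp add: abs_mult flip: right_diff_distrib)
    also have "\<dots> = \<kappa>" by (simp add: d_def)
    finally have *: "4 * \<bar>2 * pi * frac (real (k l) * (\<theta> / (2 * pi))) - 2 * pi * \<alpha>\<bar> \<le> \<kappa>" .
    have "norm (R (real (k l) * \<theta>) x - R t x) \<le> \<kappa>" if "x \<in> Sph" for x
    proof -
      have "norm (R (2 * pi * frac (real (k l) * \<theta> / (2 * pi))) x - R (2 * pi * frac (t / (2 * pi))) x) \<le> \<kappa>"
        by (rule order_trans[OF rot_dist[OF a E0]]) (use * that in \<open>auto simp: \<alpha>_def\<close>)
      then show ?thesis using fr[of "real (k l) * \<theta>" x] fr[of t x] by simp
    qed
    then show ?thesis using kb[OF lN] by blast
  qed
  then show ?thesis by blast
qed

abbreviation "base \<equiv> [f0, R \<theta>]"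

lemma word_base_replicate: "word base (replicate j 1) x = R (real j * \<theta>) x"
  by (induction j arbitrary: x) (auto simp: rot_0[OF a E0] rot_rot[OF a E0] algebra_simps)

lemma word_base_blocks: "word base (blocks js) x = rot_chain (map (\<lambda>j. real j * \<theta>) js) x"
  by (induction js arbitrary: x) (auto simp: word_base_replicate simp del: One_nat_def)

lemma base_bi_Lipschitz:
  assumes i: "i \<in> {0, 1}" and x: "x \<in> Sph" and y: "y \<in> Sph"
  shows "(base ! i) x \<in> Sph" "norm ((base ! i) x - (base ! i) y) \<le> 1 / c * norm (x - y)"
    "c * norm (x - y) \<le> norm ((base ! i) x - (base ! i) y)"
proof -
  have "1 * norm (x - y) \<le> 1 / c * norm (x - y)" by (rule mult_right_mono) (use c in auto)
  moreover have "c * norm (x - y) \<le> 1 * norm (x - y)" by (rule mult_right_mono) (use c in auto)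
  ultimately show "(base ! i) x \<in> Sph" "norm ((base ! i) x - (base ! i) y) \<le> 1 / c * norm (x - y)"
    "c * norm (x - y) \<le> norm ((base ! i) x - (base ! i) y)"
    using i f0_Sph[OF x] R_Sph[OF x] f0_bi_Lipschitz[OF x y] norm_rot_diff[OF a E0, of \<theta> x y] by auto
qed

lemma word_base_expand:
  "set w \<subseteq> {0, 1} \<Longrightarrow> x \<in> Sph \<Longrightarrow> y \<in> Sph \<Longrightarrow> c ^ length w * norm (x - y) \<le> norm (word base w x - word base w y)"
proof (induction w arbitrary: x y)
  case (Cons i w)
  then have i: "i \<in> {0, 1}" by auto
  have "c ^ length (i # w) * norm (x - y) = c ^ length w * (c * norm (x - y))" by simp
  also have "\<dots> \<le> c ^ length w * norm ((base ! i) x - (base ! i) y)"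
    using c by (intro mult_left_mono base_bi_Lipschitz[OF i] Cons.prems) auto
  also have "\<dots> \<le> norm (word base w ((base ! i) x) - word base w ((base ! i) y))"
    using Cons by (intro Cons.IH base_bi_Lipschitz[OF i]) auto
  finally show ?case by (simp only: word_simps comp_apply)
qed simp

lemma rot_chain_expand:
  "x \<in> Sph \<Longrightarrow> y \<in> Sph \<Longrightarrow> c ^ length ts * norm (x - y) \<le> norm (rot_chain ts x - rot_chain ts y)"
proof (induction ts arbitrary: x y)
  case (Cons t ts)
  have "c ^ length (t # ts) * norm (x - y) = c ^ length ts * (c * norm (x - y))" by simp
  also have "\<dots> \<le> c ^ length ts * norm (R t (f0 x) - R t (f0 y))"
    unfolding norm_rot_diff[OF a E0] using c by (intro mult_left_mono f0_bi_Lipschitz Cons.prems) auto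
  also have "\<dots> \<le> norm (rot_chain (t # ts) x - rot_chain (t # ts) y)"
    unfolding rot_chain_simps by (rule Cons.IH[OF R_Sph[OF f0_Sph] R_Sph[OF f0_Sph]]) (rule Cons.prems)+
  finally show ?case .
qed simp

lemma rot_chain_surj: "y \<in> Sph \<Longrightarrow> \<exists>x\<in>Sph. rot_chain ts x = y"
proof (induction ts arbitrary: y)
  case (Cons t ts)
  then obtain x where x: "x \<in> Sph" "rot_chain ts x = y" by blast
  have "R (- t) x \<in> Sph" by (rule R_Sph[OF x(1)])
  then have "rot_chain (t # ts) (f0inv (R (- t) x)) = y"
    using x by (simp add: f0_f0inv rot_rot[OF a E0] rot_0[OF a E0])
  then show ?case using f0inv_Sph[OF \<open>R (- t) x \<in> Sph\<close>] by blast
qed auto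

text \<open>With angles rounded to multiples of \<open>\<theta>\<close>, the target is reached from
  \<open>a\<close> only approximately. Moving the start instead of the end makes the hit exact: the
  words are onto and shrink distances by no more than \<open>c ^ n\<close>, so a suitable start lies
  close to \<open>a\<close>. Exact hits with uniformly bounded exponents are what survives
  perturbation.\<close>

lemma blocks_certificate:
  assumes irr: "\<theta> / (2 * pi) \<notin> \<rat>" and \<sigma>: "0 < \<sigma>"
  shows "\<exists>b. \<forall>y\<in>Sph. \<exists>js. length js = n \<and> (\<forall>j\<in>set js. j \<le> b)
     \<and> (\<exists>x\<in>Sph. norm (x - a) < \<sigma> \<and> word base (blocks js) x = y)
     \<and> (1 - inner y a \<le> (c\<^sup>2 / 2) ^ (n - 1) \<longrightarrow> (\<forall>j\<in>set js. norm (R (real j * \<theta>) a + a) \<ge> 1))"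
proof -
  \<comment> \<open>The second term makes the forward error
    \<open>\<kappa> * (1 + 1 / c) ^ n\<close> at most \<open>c ^ n * (\<sigma> / 2)\<close>, which
    pulls back to \<open>\<sigma> / 2\<close>. The first serves the last clause:
    \<open>cos t \<ge> 0\<close> gives distance at least \<open>5 / 4\<close> from
    \<open>- a\<close>, of which \<open>1 / 4\<close> may be lost.\<close>
  define \<kappa> where "\<kappa> = min (1 / 4) (\<sigma> / 2 * c ^ n / (1 + 1 / c) ^ n)"
  have \<kappa>: "0 < \<kappa>" "\<kappa> \<le> 1 / 4" "\<kappa> \<le> \<sigma> / 2 * c ^ n / (1 + 1 / c) ^ n"
    using \<sigma> c by (auto simp: \<kappa>_def intro!: divide_pos_pos mult_pos_pos zero_less_power add_pos_pos)
  obtain b where b: "\<And>t. \<exists>j\<le>b. \<forall>x\<in>Sph. norm (R (real j * \<theta>) x - R t x) \<le> \<kappa>"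
    using rot_approx[OF irr \<kappa>(1)] by blast
  then obtain k where k: "\<And>t. k t \<le> b" "\<And>t x. x \<in> Sph \<Longrightarrow> norm (R (real (k t) * \<theta>) x - R t x) \<le> \<kappa>" by metis
  have aS: "a \<in> Sph" using a by simp
  show ?thesis
  proof (intro exI[of _ b] ballI)
    fix y :: 'a assume y: "y \<in> Sph"
    obtain ts where ts: "length ts = n" "rot_chain ts a = y" "1 - inner y a \<le> (c\<^sup>2 / 2) ^ (n - 1) \<longrightarrow> (\<forall>t\<in>set ts. 0 \<le> cos t)"
      using reach_pole[OF y n] by auto
    define js where "js = map k ts"
    let ?ss = "map (\<lambda>j. real j * \<theta>) js"
    obtain x where x: "x \<in> Sph" "rot_chain ?ss x = y" using rot_chain_surj[OF y] by blast
    have "norm (rot_chain ts a - rot_chain ?ss a) \<le> \<kappa> * (1 + 1 / c) ^ length ts"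
    proof (rule rot_chain_close[OF _ aS])
      show "list_all2 (\<lambda>t s. \<forall>x\<in>Sph. norm (R t x - R s x) \<le> \<kappa>) ts ?ss"
        unfolding js_def list_all2_map2 using k(2) by (auto simp: list_all2_same norm_minus_commute)
    qed (use \<kappa> in simp)
    moreover have "c ^ n * norm (x - a) \<le> norm (rot_chain ?ss x - rot_chain ?ss a)"
      using rot_chain_expand[OF x(1) aS, of ?ss] ts(1) by (simp add: js_def)
    ultimately have "c ^ n * norm (x - a) \<le> \<kappa> * (1 + 1 / c) ^ n" using ts x by simp
    also have "\<dots> \<le> (\<sigma> / 2 * c ^ n / (1 + 1 / c) ^ n) * (1 + 1 / c) ^ n"
      using c by (intro mult_right_mono \<kappa>(3)) auto
    also have "\<dots> = c ^ n * (\<sigma> / 2)"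
    proof -
      have "(1 + 1 / c) ^ n > 0" using c by (intro zero_less_power add_pos_pos) auto
      moreover have "(\<sigma> / 2 * c ^ n / B) * B = c ^ n * (\<sigma> / 2)" if "B > 0" for B :: real using that by simp
      ultimately show ?thesis by blast
    qed
    finally have "norm (x - a) \<le> \<sigma> / 2" using c by simp
    then have xa: "norm (x - a) < \<sigma>" using \<sigma> by simp
    have "norm (R (real j * \<theta>) a + a) \<ge> 1" if near: "1 - inner y a \<le> (c\<^sup>2 / 2) ^ (n - 1)" and j: "j \<in> set js" for j
    proof -
      obtain t where t: "t \<in> set ts" "j = k t" using j by (auto simp: js_def)
      have "(5 / 4) ^ 2 \<le> 2 * (1 + cos t)" using ts(3) near t(1) by (simp add: power2_eq_square)
      then have "5 / 4 \<le> norm (R t a + a)" unfolding norm_R_a_add by (rule real_le_rsqrt)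
      moreover have "R t a + a = (R (real j * \<theta>) a + a) - (R (real j * \<theta>) a - R t a)" by simp
      then have "norm (R t a + a) \<le> norm (R (real j * \<theta>) a + a) + norm (R (real j * \<theta>) a - R t a)"
        using norm_triangle_ineq4 by metis
      ultimately show ?thesis using k(2)[OF aS, of t] t(2) \<kappa>(2) by simp
    qed
    moreover have "\<forall>j\<in>set js. j \<le> b" using k(1) by (simp add: js_def)
    ultimately show "\<exists>js. length js = n \<and> (\<forall>j\<in>set js. j \<le> b)
     \<and> (\<exists>x\<in>Sph. norm (x - a) < \<sigma> \<and> word base (blocks js) x = y)
     \<and> (1 - inner y a \<le> (c\<^sup>2 / 2) ^ (n - 1) \<longrightarrow> (\<forall>j\<in>set js. norm (R (real j * \<theta>) a + a) \<ge> 1))"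
      using ts(1) x xa by (intro exI[of _ js]) (auto simp: word_base_blocks js_def simp del: mem_sphere_0)
  qed
qed

text \<open>Away from \<open>- a\<close> each \<open>f0\<close> halves the distance to
  \<open>a\<close>, and a point close to \<open>- a\<close> is first rotated out of the ball. Hence
  one length bound serves all starting points.\<close>

lemma approach_pole:
  assumes away: "norm (R \<theta> (- a) + a) \<ge> 16 * \<eta>" and \<sigma>: "0 < \<sigma>"
  shows "\<exists>L. \<forall>x\<in>Sph. \<exists>w. set w \<subseteq> {0, 1} \<and> length w \<le> L \<and> norm (word base w x - a) < \<sigma>"
proof -
  have step: "norm (f0 x - a) \<le> 1 / 2 * norm (x - a) \<and> norm (f0 x + a) \<ge> \<eta>"
    if x: "x \<in> Sph" "norm (x + a) \<ge> \<eta>" for x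
  proof
    have "\<eta> / 4 * norm (x - a) \<le> 1 / 2 * norm (x - a)" using \<eta> by (intro mult_right_mono) auto
    then show xa: "norm (f0 x - a) \<le> 1 / 2 * norm (x - a)" using f0_far_near_a[OF x] by linarith
    have "norm (x - a) \<le> 2" using norm_triangle_ineq4[of x a] x a by simp
    moreover have "norm (2 *\<^sub>R a) \<le> norm (f0 x + a) + norm (f0 x - a)"
      using norm_triangle_ineq4[of "f0 x + a" "f0 x - a"] by (simp add: scaleR_2)
    ultimately show "norm (f0 x + a) \<ge> \<eta>" using xa a \<eta> by simp
  qed
  have far': "norm (word base (replicate k 0) x - a) \<le> (1 / 2) ^ k * norm (x - a)"
    if "x \<in> Sph" "norm (x + a) \<ge> \<eta>" for x k
    using that
  proof (induction k arbitrary: x)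
    case (Suc k)
    have "norm (word base (replicate k 0) (f0 x) - a) \<le> (1 / 2) ^ k * norm (f0 x - a)"
      by (rule Suc.IH[OF f0_Sph[OF Suc.prems(1)]]) (use step[OF Suc.prems] in blast)
    also have "\<dots> \<le> (1 / 2) ^ k * (1 / 2 * norm (x - a))"
      using step[OF Suc.prems] by (intro mult_left_mono) auto
    finally show ?case by simp
  qed simp
  have far: "norm (word base (replicate k 0) x - a) \<le> (1 / 2) ^ k * 2"
    if x: "x \<in> Sph" "norm (x + a) \<ge> \<eta>" for x k
  proof -
    have "norm (x - a) \<le> 2" using norm_triangle_ineq4[of x a] x a by simp
    then have "(1 / 2) ^ k * norm (x - a) \<le> (1 / 2) ^ k * 2" by (intro mult_left_mono) auto
    then show ?thesis using far'[OF x, of k] by linarith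
  qed
  obtain k where k: "(1 / 2) ^ k < \<sigma> / 2" using real_arch_pow_inv[of "\<sigma> / 2" "1 / 2"] \<sigma> by auto
  have "\<exists>w. set w \<subseteq> {0, 1} \<and> length w \<le> Suc k \<and> norm (word base w x - a) < \<sigma>" if x: "x \<in> Sph" for x
  proof (cases "norm (x + a) \<ge> \<eta>")
    case True
    then have "norm (word base (replicate k 0) x - a) < \<sigma>" using far[OF x, of k] k by simp
    then show ?thesis by (intro exI[of _ "replicate k 0"]) auto
  next
    case False
    have "norm (R \<theta> (- a) + a) \<le> norm (R \<theta> x + a) + norm (R \<theta> x - R \<theta> (- a))"
      using norm_triangle_ineq4[of "R \<theta> x + a" "R \<theta> x - R \<theta> (- a)"] by (simp add: add.commute)
    then have "norm (R \<theta> x + a) \<ge> \<eta>" using away False \<eta> unfolding norm_rot_diff[OF a E0] by simp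
    then have "norm (word base (replicate k 0) (R \<theta> x) - a) < \<sigma>" using far[OF R_Sph[OF x], of \<theta> k] k by simp
    then show ?thesis by (intro exI[of _ "1 # replicate k 0"]) auto
  qed
  then show ?thesis by blast
qed

end

section \<open>Robust minimality\<close>

context perturbed_system
begin

lemma word_perturbation:
  assumes "set w \<subseteq> {0, 1}" "x \<in> Sph"
  shows "norm (word base w x - word fs w x) \<le> (1 + 1 / c) ^ length w * \<epsilon>" "word base w x \<in> Sph" "word fs w x \<in> Sph"
proof -
  have "norm (word base w x - word fs w x) \<le> (1 + 1 / c) ^ length w * \<epsilon> \<and> word base w x \<in> Sph \<and> word fs w x \<in> Sph"
    using assms
  proof (induction w rule: rev_induct)
    case Nil
    then show ?case using \<epsilon> by simp
  next
    case (snoc i w)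
    let ?u = "word base w x" and ?v = "word fs w x"
    have i: "i \<in> {0, 1}" "i < length fs" using snoc two by auto
    have IH: "norm (?u - ?v) \<le> (1 + 1 / c) ^ length w * \<epsilon>" "?u \<in> Sph" "?v \<in> Sph" using snoc by auto
    have "lip_close \<epsilon> (base ! i) (fs ! i)" using i close0 close1[of 1] by auto
    then have 1: "norm ((base ! i) ?v - (fs ! i) ?v) \<le> \<epsilon>" using IH(3) by (simp add: lip_close_def)
    have "norm ((base ! i) ?u - (base ! i) ?v) \<le> 1 / c * norm (?u - ?v)" by (rule base_bi_Lipschitz(2)[OF i(1) IH(2,3)])
    also have "\<dots> \<le> 1 / c * ((1 + 1 / c) ^ length w * \<epsilon>)" using c by (intro mult_left_mono IH) auto
    finally have 2: "norm ((base ! i) ?u - (base ! i) ?v) \<le> 1 / c * ((1 + 1 / c) ^ length w * \<epsilon>)" .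
    have "1 * \<epsilon> \<le> (1 + 1 / c) ^ length w * \<epsilon>" using c \<epsilon> by (intro mult_right_mono one_le_power) auto
    then have "1 / c * ((1 + 1 / c) ^ length w * \<epsilon>) + \<epsilon> \<le> (1 + 1 / c) ^ length (w @ [i]) * \<epsilon>" by (simp add: algebra_simps)
    moreover have "norm ((base ! i) ?u - (fs ! i) ?v) \<le> norm ((base ! i) ?u - (base ! i) ?v) + norm ((base ! i) ?v - (fs ! i) ?v)"
      using norm_triangle_ineq[of "(base ! i) ?u - (base ! i) ?v" "(base ! i) ?v - (fs ! i) ?v"] by simp
    ultimately have "norm ((base ! i) ?u - (fs ! i) ?v) \<le> (1 + 1 / c) ^ length (w @ [i]) * \<epsilon>" using 1 2 by linarith
    then show ?case using base_bi_Lipschitz(1)[OF i(1) IH(2,2)] fS[OF i(2) IH(3)] by simp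
  qed
  then show "norm (word base w x - word fs w x) \<le> (1 + 1 / c) ^ length w * \<epsilon>" "word base w x \<in> Sph" "word fs w x \<in> Sph"
    by auto
qed

definition far_region :: "'a set" where "far_region = {x \<in> Sph. norm (x + a) \<ge> \<eta>}"

lemma near_a_Dom:
  assumes "x \<in> Sph" "norm (x - a) \<le> 1" shows "x \<in> far_region"
proof -
  have "norm (2 *\<^sub>R a) \<le> norm (x + a) + norm (x - a)"
    using norm_triangle_ineq4[of "x + a" "x - a"] by (simp add: scaleR_2)
  then show ?thesis using assms a \<eta> by (simp add: far_region_def)
qed

text \<open>Unperturbed facts enter through words of length at most \<open>L\<close>, uniformly over
  the sphere. So one smallness condition on \<open>\<epsilon>\<close> keeps all word errors below
  \<open>\<sigma> / 4\<close>, even after pulling them back through a word, which costs a factor of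
  up to \<open>1 / c ^ L\<close>.\<close>

context
  fixes b L :: nat and \<sigma> :: real
  assumes cert: "\<And>y. y \<in> Sph \<Longrightarrow> \<exists>js. length js = n \<and> (\<forall>j\<in>set js. j \<le> b)
      \<and> (\<exists>x\<in>Sph. norm (x - a) < \<sigma> / 2 \<and> word base (blocks js) x = y)
      \<and> (1 - inner y a \<le> (c\<^sup>2 / 2) ^ (n - 1) \<longrightarrow> (\<forall>j\<in>set js. norm (R (real j * \<theta>) a + a) \<ge> 1))"
    and appr: "\<And>x. x \<in> Sph \<Longrightarrow> \<exists>w. set w \<subseteq> {0, 1} \<and> length w \<le> L \<and> norm (word base w x - a) < \<sigma> / 2"
    and bL: "n * Suc b \<le> L"
    and \<sigma>: "0 < \<sigma>" "\<sigma> \<le> 1 / 2" "\<sigma>\<^sup>2 / 2 \<le> (c\<^sup>2 / 2) ^ (n - 1)"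
    and small: "(1 + 1 / c) ^ L * \<epsilon> \<le> c ^ L * (\<sigma> / 4)" "real L * \<epsilon> \<le> 1 / 2"
begin

lemma word_perturbation_small:
  assumes "set w \<subseteq> {0, 1}" "length w \<le> L" "x \<in> Sph"
  shows "norm (word base w x - word fs w x) \<le> c ^ length w * (\<sigma> / 4)" "norm (word base w x - word fs w x) \<le> \<sigma> / 4"
proof -
  have "norm (word base w x - word fs w x) \<le> (1 + 1 / c) ^ length w * \<epsilon>" by (rule word_perturbation(1)[OF assms(1,3)])
  also have "\<dots> \<le> (1 + 1 / c) ^ L * \<epsilon>" using c \<epsilon> assms(2) by (intro mult_right_mono power_increasing) auto
  also have "\<dots> \<le> c ^ L * (\<sigma> / 4)" by (rule small)
  also have "\<dots> \<le> c ^ length w * (\<sigma> / 4)" using c \<sigma> assms(2) by (intro mult_right_mono power_decreasing) auto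
  finally show 1: "norm (word base w x - word fs w x) \<le> c ^ length w * (\<sigma> / 4)" .
  have "c ^ length w * (\<sigma> / 4) \<le> 1 * (\<sigma> / 4)" using c \<sigma> by (intro mult_right_mono power_le_one) auto
  then show "norm (word base w x - word fs w x) \<le> \<sigma> / 4" using 1 by simp
qed

text \<open>Exact hits persist. The perturbed word is still onto, and the unperturbed word takes the
  new preimage \<open>z\<close> to within the word error of the target; as that word shrinks
  distances by no more than \<open>c ^ length w\<close>, \<open>z\<close> is close to
  \<open>x\<close>.\<close>

lemma perturbed_preimage:
  assumes "set w \<subseteq> {0, 1}" "length w \<le> L" "x \<in> Sph" "norm (x - a) < \<sigma> / 2"
  shows "\<exists>z\<in>Sph. norm (z - a) < \<sigma> \<and> word fs w z = word base w x"
proof -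
  have wl: "set w \<subseteq> letters" using assms(1) two by (auto simp: subset_iff)
  obtain z where z: "z \<in> Sph" "word fs w z = word base w x"
    using word_C1(2)[OF wl] word_perturbation(2)[OF assms(1,3)] by (metis imageE)
  have "c ^ length w * norm (z - x) \<le> norm (word base w z - word base w x)" by (rule word_base_expand[OF assms(1) z(1) assms(3)])
  also have "\<dots> \<le> c ^ length w * (\<sigma> / 4)" using word_perturbation_small(1)[OF assms(1,2) z(1)] z(2) by simp
  finally have "norm (z - x) \<le> \<sigma> / 4" using c by simp
  moreover have "norm (z - a) \<le> norm (z - x) + norm (x - a)" using norm_triangle_ineq[of "z - x" "x - a"] by simp
  ultimately have "norm (z - a) < \<sigma>" using assms(4) \<sigma> by linarith
  then show ?thesis using z by blast
qed

lemma rotation_run_Lipschitz: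
  assumes "x \<in> Sph" "y \<in> Sph"
  shows "norm (word fs (replicate j 1) x - word fs (replicate j 1) y) \<le> (1 + \<epsilon>) ^ j * norm (x - y)"
  using assms
proof (induction j arbitrary: x y)
  case (Suc j)
  let ?x = "(fs ! 1) x" and ?y = "(fs ! 1) y"
  have S: "?x \<in> Sph" "?y \<in> Sph" using fS[of 1] two Suc.prems by auto
  have "norm (word fs (replicate j 1) ?x - word fs (replicate j 1) ?y) \<le> (1 + \<epsilon>) ^ j * norm (?x - ?y)"
    by (rule Suc.IH[OF S])
  also have "\<dots> \<le> (1 + \<epsilon>) ^ j * ((1 + \<epsilon>) * norm (x - y))"
    using g1_Lipschitz[of 1 x y] two Suc.prems \<epsilon> by (intro mult_left_mono) auto
  finally show ?case by (simp add: mult_ac)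
qed simp

text \<open>On \<open>far_region\<close> the map \<open>fs ! 0\<close> contracts by
  \<open>1 / 4\<close> and lands within \<open>\<eta>\<close> of \<open>a\<close>. The rotations
  that follow expand by at most \<open>exp (1 / 2) \<le> 2\<close> and end near the rotated pole,
  which is far from \<open>- a\<close> by assumption.\<close>

lemma block_contraction:
  assumes j: "j \<le> b" "norm (R (real j * \<theta>) a + a) \<ge> 1" and x: "x \<in> far_region" and y: "y \<in> far_region"
  shows "word fs (0 # replicate j 1) x \<in> far_region"
    "norm (word fs (0 # replicate j 1) x - word fs (0 # replicate j 1) y) \<le> 1 / 2 * norm (x - y)"
proof -
  have Suc_b: "Suc b \<le> L" using bL n by (cases n) auto
  then have jL: "j \<le> L" using j by simp
  let ?z = "(fs ! 0) x" and ?w = "replicate j 1"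
  have xS: "x \<in> Sph" "norm (x + a) \<ge> \<eta>" "y \<in> Sph" "norm (y + a) \<ge> \<eta>" using x y by (auto simp: far_region_def)
  have len: "0 < length fs" using two by linarith
  have zS: "?z \<in> Sph" "(fs ! 0) y \<in> Sph" using fS[OF len] xS by auto
  have za: "norm (?z - a) \<le> \<eta>" by (rule g0_far_near_a[OF xS(1,2)])
  have w: "set ?w \<subseteq> {0, 1}" "length ?w \<le> L" using jL by auto
  have 1: "norm (R (real j * \<theta>) ?z - word fs ?w ?z) \<le> \<sigma> / 4"
    using word_perturbation_small(2)[OF w zS(1)] by (simp only: word_base_replicate)
  have "R (real j * \<theta>) a + a = (word fs ?w ?z + a) + (R (real j * \<theta>) ?z - word fs ?w ?z) + (R (real j * \<theta>) a - R (real j * \<theta>) ?z)" by simp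
  then have "norm (R (real j * \<theta>) a + a) \<le> norm (word fs ?w ?z + a) + norm (R (real j * \<theta>) ?z - word fs ?w ?z) + norm (R (real j * \<theta>) a - R (real j * \<theta>) ?z)"
    by (metis (no_types, lifting) add_right_mono norm_triangle_ineq order_trans)
  then have "norm (word fs ?w ?z + a) \<ge> \<eta>"
    using j(2) 1 za \<sigma> \<eta> unfolding norm_rot_diff[OF a E0] by (simp add: norm_minus_commute)
  then show "word fs (0 # replicate j 1) x \<in> far_region"
    using word_perturbation(3)[OF w(1) zS(1)] by (simp add: far_region_def)
  have "norm (word fs ?w ?z - word fs ?w ((fs ! 0) y)) \<le> (1 + \<epsilon>) ^ j * norm (?z - (fs ! 0) y)"
    by (rule rotation_run_Lipschitz[OF zS])
  also have "\<dots> \<le> 2 * (1 / 4 * norm (x - y))"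
  proof (intro mult_mono)
    have "(1 + \<epsilon>) ^ j \<le> exp \<epsilon> ^ j" using \<epsilon> by (intro power_mono exp_ge_add_one_self) auto
    also have "\<dots> = exp (real j * \<epsilon>)" by (simp add: exp_of_nat_mult)
    also have "\<dots> \<le> exp (1 / 2)"
    proof -
      have "real j * \<epsilon> \<le> real L * \<epsilon>" using jL \<epsilon>(1) by (intro mult_right_mono) auto
      then show ?thesis using small(2) by simp
    qed
    also have "\<dots> \<le> 2" using exp_bound_half[of "1 / 2 :: real"] by simp
    finally show "(1 + \<epsilon>) ^ j \<le> 2" .
    have e2: "4 * \<eta>\<^sup>2 \<le> 1 / 64" using power_mono[OF \<eta>(2), of 2] \<eta>(1) by (simp add: power_divide)
    have r: "0 \<le> \<rho> x + \<epsilon>" "\<rho> x + \<epsilon> \<le> 1 / 4" "0 \<le> \<rho> y + \<epsilon>" "\<rho> y + \<epsilon> \<le> 1 / 4"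
      using \<rho>_far[OF xS(1,2)] \<rho>_far[OF xS(3,4)] \<rho>_bounds(3)[OF xS(1)] \<rho>_bounds(3)[OF xS(3)] \<epsilon>(1,2) e2 by linarith+
    have "sqrt ((\<rho> x + \<epsilon>) * (\<rho> y + \<epsilon>)) \<le> sqrt (1 / 4 * (1 / 4))"
      using r by (intro real_sqrt_le_mono mult_mono) auto
    also have "\<dots> = 1 / 4" by (rule real_sqrt_unique) (auto simp: power2_eq_square)
    finally have "sqrt ((\<rho> x + \<epsilon>) * (\<rho> y + \<epsilon>)) * norm (x - y) \<le> 1 / 4 * norm (x - y)" by (rule mult_right_mono) simp
    then show "norm (?z - (fs ! 0) y) \<le> 1 / 4 * norm (x - y)" using g0_Lipschitz[OF xS(1,3)] by linarith
  qed auto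
  finally show "norm (word fs (0 # replicate j 1) x - word fs (0 # replicate j 1) y) \<le> 1 / 2 * norm (x - y)" by simp
qed

lemma blocks_contraction:
  assumes "\<forall>j\<in>set js. j \<le> b \<and> norm (R (real j * \<theta>) a + a) \<ge> 1" "x \<in> far_region" "y \<in> far_region"
  shows "word fs (blocks js) x \<in> far_region \<and> norm (word fs (blocks js) x - word fs (blocks js) y) \<le> (1 / 2) ^ length js * norm (x - y)"
  using assms
proof (induction js arbitrary: x y)
  case (Cons j js)
  let ?B = "word fs (0 # replicate j 1)"
  have j: "j \<le> b" "norm (R (real j * \<theta>) a + a) \<ge> 1" using Cons.prems by auto
  have D: "?B x \<in> far_region" "?B y \<in> far_region" by (rule block_contraction(1)[OF j]; fact Cons.prems)+
  have "norm (word fs (blocks js) (?B x) - word fs (blocks js) (?B y)) \<le> (1 / 2) ^ length js * norm (?B x - ?B y)"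
    using Cons.IH[OF _ D] Cons.prems by simp
  also have "\<dots> \<le> (1 / 2) ^ length js * (1 / 2 * norm (x - y))"
    by (intro mult_left_mono block_contraction(2)[OF j] Cons.prems) auto
  finally have "norm (word fs (blocks js) (?B x) - word fs (blocks js) (?B y)) \<le> (1 / 2) ^ length (j # js) * norm (x - y)" by simp
  moreover have "word fs (blocks js) (?B x) \<in> far_region" using Cons.IH[OF _ D] Cons.prems by simp
  moreover have "word fs (blocks (j # js)) z = word fs (blocks js) (?B z)" for z
    by (simp only: blocks_simps append_Cons[symmetric] word_simps(3) comp_apply)
  ultimately show ?case by (simp only:)
qed simp

text \<open>The blending mechanism: a target in the \<open>\<sigma>\<close>-ball about
  \<open>a\<close> is the exact image of a point \<open>y'\<close> of the same ball under a block
  word that contracts \<open>far_region\<close> into itself. So the target can be pulled back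
  \<open>M\<close> times, and each time the image of \<open>far_region\<close> around it shrinks at
  least by half.\<close>

lemma approach_near_pole:
  assumes "y \<in> Sph" "norm (y - a) \<le> \<sigma>"
  shows "\<exists>w. set w \<subseteq> {0, 1} \<and> (\<forall>z\<in>far_region. word fs w z \<in> far_region \<and> norm (word fs w z - y) \<le> (1 / 2) ^ M * 2)"
  using assms
proof (induction M arbitrary: y)
  case 0
  have "norm (z - y) \<le> 2" if "z \<in> far_region" for z using norm_triangle_ineq4[of z y] that 0 by (simp add: far_region_def)
  then show ?case by (intro exI[of _ "[]"]) simp
next
  case (Suc M)
  have "2 * (1 - inner y a) \<le> \<sigma>\<^sup>2"
    using norm_Sph_diff[OF Suc.prems(1), of a] a power_mono[OF Suc.prems(2), of 2] by simp
  \<comment> \<open>The condition on \<open>\<sigma>\<close> puts the whole ball below the height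
    threshold of \<open>cert\<close>, so the rotations in the blocks keep \<open>a\<close> away from
    \<open>- a\<close>.\<close>
  then have near: "1 - inner y a \<le> (c\<^sup>2 / 2) ^ (n - 1)" using \<sigma>(3) by simp
  obtain js x where js: "length js = n" "\<forall>j\<in>set js. j \<le> b" "\<forall>j\<in>set js. norm (R (real j * \<theta>) a + a) \<ge> 1"
    and x: "x \<in> Sph" "norm (x - a) < \<sigma> / 2" "word base (blocks js) x = y"
    using cert[OF Suc.prems(1)] near by blast
  have "length (blocks js) \<le> length js * Suc b" by (rule length_blocks) (use js in blast)
  then have len: "length (blocks js) \<le> L" using js(1) bL by simp
  obtain y' where y': "y' \<in> Sph" "norm (y' - a) < \<sigma>" "word fs (blocks js) y' = y"
    using perturbed_preimage[OF set_blocks len x(1,2)] x(3) by blast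
  have y'D: "y' \<in> far_region" using near_a_Dom[OF y'(1)] y'(2) \<sigma> by simp
  obtain w where w: "set w \<subseteq> {0, 1}" "\<And>z. z \<in> far_region \<Longrightarrow> word fs w z \<in> far_region \<and> norm (word fs w z - y') \<le> (1 / 2) ^ M * 2"
    using Suc.IH[OF y'(1)] y'(2) by (meson less_imp_le)
  have "word fs (w @ blocks js) z \<in> far_region \<and> norm (word fs (w @ blocks js) z - y) \<le> (1 / 2) ^ Suc M * 2" if z: "z \<in> far_region" for z
  proof -
    have jj: "\<forall>j\<in>set js. j \<le> b \<and> norm (R (real j * \<theta>) a + a) \<ge> 1" using js by blast
    have B: "word fs (blocks js) (word fs w z) \<in> far_region"
      "norm (word fs (blocks js) (word fs w z) - word fs (blocks js) y') \<le> (1 / 2) ^ n * norm (word fs w z - y')"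
      using blocks_contraction[OF jj _ y'D, of "word fs w z"] w(2)[OF z] js(1) by auto
    have "(1 / 2 :: real) ^ n \<le> (1 / 2) ^ 1" using n by (intro power_decreasing) auto
    then have "(1 / 2) ^ n * norm (word fs w z - y') \<le> 1 / 2 * ((1 / 2) ^ M * 2)"
      using w(2)[OF z] by (intro mult_mono) auto
    then show ?thesis using B y'(3) by simp
  qed
  moreover have "set (w @ blocks js) \<subseteq> {0, 1}" using w(1) set_blocks by auto
  ultimately show ?case by blast
qed

text \<open>\<open>w1\<close> takes \<open>x\<close> close to \<open>a\<close>, \<open>w2\<close>
  takes it as close as desired to a point \<open>y'\<close> near \<open>a\<close>, and a block word
  takes \<open>y'\<close> exactly to \<open>y\<close>. The block word is fixed before the precision
  of \<open>w2\<close>, so plain continuity suffices.\<close>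

theorem minimal: "minimal_ifs fs"
proof (rule reach_imp_minimal)
  fix x y :: 'a and e :: real assume x: "x \<in> Sph" and y: "y \<in> Sph" and e: "0 < e"
  have sub: "{0, 1} \<subseteq> letters" using two by auto
  obtain js x1 where js: "length js = n" "\<forall>j\<in>set js. j \<le> b"
    and x1: "x1 \<in> Sph" "norm (x1 - a) < \<sigma> / 2" "word base (blocks js) x1 = y"
    using cert[OF y] by blast
  have "length (blocks js) \<le> length js * Suc b" by (rule length_blocks) (use js in blast)
  then have len: "length (blocks js) \<le> L" using js(1) bL by simp
  obtain y' where y': "y' \<in> Sph" "norm (y' - a) < \<sigma>" "word fs (blocks js) y' = y"
    using perturbed_preimage[OF set_blocks len x1(1,2)] x1(3) by blast
  obtain w1 where w1: "set w1 \<subseteq> {0, 1}" "length w1 \<le> L" "norm (word base w1 x - a) < \<sigma> / 2" using appr[OF x] by blast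
  let ?x = "word fs w1 x"
  have xS: "?x \<in> Sph" by (rule word_perturbation(3)[OF w1(1) x])
  have "norm (?x - a) \<le> norm (word base w1 x - a) + norm (word base w1 x - ?x)"
    using norm_triangle_ineq4[of "word base w1 x - a" "word base w1 x - ?x"] by simp
  then have xD: "?x \<in> far_region" using word_perturbation_small(2)[OF w1(1,2) x] w1(3) \<sigma> by (intro near_a_Dom[OF xS]) simp
  have bl: "set (blocks js) \<subseteq> letters" using set_blocks sub by blast
  obtain F' where "C1_on_Sph (word fs (blocks js)) F'" using word_C1(1)[OF bl] by blast
  then have "continuous_on Sph (word fs (blocks js))" by (rule C1_on_Sph_continuous)
  then obtain d where d: "d > 0" "\<And>z. z \<in> Sph \<Longrightarrow> dist z y' < d \<Longrightarrow> dist (word fs (blocks js) z) (word fs (blocks js) y') < e"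
    using y'(1) e unfolding continuous_on_iff by blast
  obtain M where M: "(1 / 2) ^ M < d / 2" using real_arch_pow_inv[of "d / 2" "1 / 2"] d(1) by auto
  obtain w2 where w2: "set w2 \<subseteq> {0, 1}" "\<And>z. z \<in> far_region \<Longrightarrow> word fs w2 z \<in> far_region \<and> norm (word fs w2 z - y') \<le> (1 / 2) ^ M * 2"
    using approach_near_pole[OF y'(1), of M] y'(2) by (meson less_imp_le)
  have "word fs w2 ?x \<in> Sph" "dist (word fs w2 ?x) y' < d"
    using w2(2)[OF xD] M by (auto simp: far_region_def dist_norm)
  then have "norm (word fs (w1 @ w2 @ blocks js) x - y) < e" using d(2)[of "word fs w2 ?x"] y'(3) by (simp add: dist_norm)
  moreover have "set (w1 @ w2 @ blocks js) \<subseteq> letters" using w1(1) w2(1) bl sub by auto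
  ultimately show "\<exists>w. set w \<subseteq> letters \<and> norm (word fs w x - y) < e" by blast
qed

end

lemma all_properties:
  assumes "minimal_ifs fs"
  shows "minimal_ifs fs \<and> (\<exists>m. stationary fs p m \<and> full_support m \<and> neg_lyap fs p m \<and> delta_conditionals fs p m)"
proof -
  obtain s K r where "contracting_ifs fs p s K r" using contracting by blast
  then interpret c: contracting_ifs fs p s K r .
  show ?thesis using assms c.stationary_m c.full_support_m c.neg_lyap_m c.delta_conditionals_m by blast
qed

end

section \<open>The open set\<close>

text \<open>The frame is chosen before \<open>\<eta>\<close>, because \<open>\<eta>\<close> will
  depend on the orbits of \<open>a\<close> and \<open>- a\<close> under rotations in the plane of
  \<open>a\<close> and \<open>E 0\<close>.\<close>

lemma ex_moebius_frame:
  assumes dim: "DIM('a::euclidean_space) \<ge> 2"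
  shows "\<exists>(a :: 'a) E n P Q. \<forall>\<eta>. 0 < \<eta> \<and> \<eta> \<le> 1 / 16 \<longrightarrow> moebius_frame a E n P Q \<eta>"
proof -
  obtain a :: 'a where a: "a \<in> Basis" using nonempty_Basis by blast
  define n where "n = card (Basis - {a})"
  have n: "n \<ge> 1" using dim a by (simp add: n_def)
  obtain E where E: "bij_betw E {0..<n} (Basis - {a})"
    using ex_bij_betw_nat_finite[of "Basis - {a}"] unfolding n_def by auto
  have EB: "E i \<in> Basis" "E i \<noteq> a" if "i < n" for i
    using bij_betwE[OF E] that by auto
  have Einj: "E i = E j \<longleftrightarrow> i = j" if "i < n" "j < n" for i j
    using E that by (auto simp: bij_betw_def inj_on_def)
  have Esurj: "\<exists>i<n. x = E i" if "x \<in> Basis" "x \<noteq> a" for x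
    using E that unfolding bij_betw_def by (metis DiffI atLeastLessThan_iff imageE singletonD)
  define ix where "ix = inv_into {0..<n} E"
  have ix: "ix (E i) = i" if "i < n" for i
    unfolding ix_def using E that by (intro inv_into_f_f) (auto simp: bij_betw_def)
  define \<pi> where "\<pi> x = (if x = a then a else E (Suc (ix x) mod n))" for x
  have \<pi>E: "\<pi> (E i) = E (Suc i mod n)" if "i < n" for i using EB[OF that] ix[OF that] by (simp add: \<pi>_def)
  have \<pi>a: "\<pi> a = a" by (simp add: \<pi>_def)
  have \<pi>in: "\<pi> x \<in> Basis" if "x \<in> Basis" for x
    using EB(1)[of "Suc (ix x) mod n"] n a by (simp add: \<pi>_def)
  have Suc_mod: "i = j" if "i < n" "j < n" "Suc i mod n = Suc j mod n" for i j
    using that by (metis Suc_inject Suc_lessI mod_less mod_self nat.distinct(1))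
  have \<pi>inj: "inj_on \<pi> Basis"
  proof (rule inj_onI)
    fix x y assume x: "x \<in> Basis" and y: "y \<in> Basis" and eq: "\<pi> x = \<pi> y"
    have mn: "k mod n < n" for k using n by simp
    have ne: "\<pi> z \<noteq> a" if "z \<in> Basis" "z \<noteq> a" for z using EB(2)[OF mn] that by (simp add: \<pi>_def)
    show "x = y"
    proof (cases "x = a \<or> y = a")
      case True
      then show ?thesis using eq ne x y \<pi>a by metis
    next
      case False
      then obtain i j where ij: "i < n" "x = E i" "j < n" "y = E j" using Esurj x y by metis
      have "Suc i mod n = Suc j mod n" using eq \<pi>E ij Einj[OF mn mn] by metis
      then show ?thesis using Suc_mod ij by metis
    qed
  qed
  have \<pi>bij: "bij_betw \<pi> Basis Basis"
    unfolding bij_betw_def using \<pi>inj endo_inj_surj[OF finite_Basis _ \<pi>inj] \<pi>in by blast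
  define \<pi>' where "\<pi>' = inv_into Basis \<pi>"
  have \<pi>'bij: "bij_betw \<pi>' Basis Basis" unfolding \<pi>'_def by (rule bij_betw_inv_into[OF \<pi>bij])
  have \<pi>\<pi>': "\<pi> (\<pi>' x) = x" "\<pi>' (\<pi> x) = x" if "x \<in> Basis" for x
    using that \<pi>bij unfolding \<pi>'_def by (simp_all add: bij_betw_inv_into_right bij_betw_inv_into_left)
  have \<pi>'a: "\<pi>' a = a" using \<pi>\<pi>'(2)[OF a] \<pi>a by simp
  have \<pi>'in: "\<pi>' x \<in> Basis" if "x \<in> Basis" for x using \<pi>'bij that by (auto simp: bij_betw_def)
  \<comment> \<open>The forward shift \<open>\<pi>\<close> serves for \<open>Q\<close>, as
    \<open>QE\<close> demands, and its inverse for \<open>P\<close>.\<close>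
  have "moebius_frame a E n (perm_map \<pi>') (perm_map \<pi>) \<eta>" if "0 < \<eta>" "\<eta> \<le> 1 / 16" for \<eta>
  proof (rule moebius_frame.intro)
    show "norm a = 1" using a by simp
    show "1 \<le> n" by (rule n)
    show "norm (E i) = 1" "inner a (E i) = 0" if "i < n" for i
      using EB[OF that] a by (auto simp: inner_Basis)
    show "inner (E i) (E j) = 0" if "i < n" "j < n" "i \<noteq> j" for i j
      using EB[of i] EB[of j] Einj[of i j] that by (auto simp: inner_Basis)
    show "y = inner y a *\<^sub>R a" if y: "\<And>i. i < n \<Longrightarrow> inner y (E i) = 0" for y :: 'a
    proof (rule euclidean_eqI)
      fix x :: 'a assume x: "x \<in> Basis"
      show "inner y x = inner (inner y a *\<^sub>R a) x"
      proof (cases "x = a")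
        case True
        then show ?thesis using a by simp
      next
        case False
        then show ?thesis using Esurj[OF x False] y x a by (auto simp: inner_Basis)
      qed
    qed
    show "bounded_linear (perm_map \<pi>')" "bounded_linear (perm_map \<pi>)" by (rule perm_map_bounded_linear)+
    show "perm_map \<pi>' a = a" "perm_map \<pi> a = a" by (simp_all add: perm_map_Basis[OF a] \<pi>a \<pi>'a)
    show "inner (perm_map \<pi>' x) (perm_map \<pi>' y) = inner x y" "inner (perm_map \<pi> x) (perm_map \<pi> y) = inner x y" for x y :: 'a
      by (rule perm_map_inner[OF \<pi>'bij], rule perm_map_inner[OF \<pi>bij])
    show "perm_map \<pi>' (perm_map \<pi> x) = x" "perm_map \<pi> (perm_map \<pi>' x) = x" for x :: 'a
      by (rule perm_map_perm_map, (erule \<pi>in \<pi>'in \<pi>\<pi>')+)+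
    show "inner (perm_map \<pi> x) (E (Suc i)) = inner x (E i)" if "Suc i < n" for i and x :: 'a
    proof -
      have "E (Suc i) = perm_map \<pi> (E i)" using that \<pi>E[of i] perm_map_Basis[OF EB(1)[of i], of \<pi>] by simp
      then show ?thesis by (simp only: perm_map_inner[OF \<pi>bij])
    qed
    show "0 < \<eta>" "\<eta> \<le> 1 / 16" by fact+
  qed
  then show ?thesis by blast
qed

text \<open>A return of \<open>- a\<close> would make the cosine of a multiple of
  \<open>\<theta>\<close> equal to 1, and so would, at twice the time, an arrival of
  \<open>a\<close> at \<open>- a\<close>. Either makes \<open>\<theta> / (2 * pi)\<close>
  rational.\<close>

lemma irrational_rotation:
  fixes a e :: "'a::euclidean_space"
  assumes ae: "norm a = 1" "norm e = 1" "inner a e = 0" and irr: "\<theta> / (2 * pi) \<notin> \<rat>" and j: "j \<ge> 1"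
  shows "rot a e (real j * \<theta>) (- a) + a \<noteq> 0" "rot a e (real j * \<theta>) a + a \<noteq> 0"
proof -
  let ?t = "real j * \<theta>"
  have no: False if k: "k \<ge> 1" "cos (real k * \<theta>) = 1" for k :: nat
  proof -
    obtain i :: int where "real k * \<theta> = of_int i * 2 * pi" using k(2) unfolding cos_one_2pi_int by blast
    then have "\<theta> / (2 * pi) = of_int i / real k" using k(1) by (simp add: field_simps)
    then show False using irr by (metis Rats_divide Rats_of_int Rats_of_nat)
  qed
  have aa: "inner a a = 1" using ae by (simp add: norm_eq_1)
  have ip: "inner (rot a e ?t a) a = cos ?t"
    using rot_inner_a[OF ae, of ?t a] ae aa by simp
  have neg: "rot a e ?t (- a) = - rot a e ?t a"
    using linear_simps(4)[OF rot_bounded_linear[OF ae]] by simp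
  show "rot a e ?t (- a) + a \<noteq> 0"
  proof
    assume "rot a e ?t (- a) + a = 0"
    then have "rot a e ?t a = a" unfolding neg by (simp add: add_eq_0_iff)
    then have "cos ?t = 1" using ip aa by simp
    then show False using no[OF j] by blast
  qed
  show "rot a e ?t a + a \<noteq> 0"
  proof
    assume "rot a e ?t a + a = 0"
    then have "rot a e ?t a = - a" by (simp add: add_eq_0_iff2)
    then have "cos ?t = -1" using ip aa by simp
    then have "cos (2 * ?t) = 1" by (simp add: cos_double_cos)
    then show False using no[of "2 * j"] j by (simp add: mult.assoc)
  qed
qed

theorem theorem3p3:
  fixes k :: nat and p :: "nat \<Rightarrow> real"
  assumes "k \<ge> 2" and "DIM('a::euclidean_space) \<ge> 2"
    and "\<forall>i<k. 0 < p i \<and> p i < 1" and "(\<Sum>i<k. p i) = 1"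
  shows "\<exists>U :: ('a \<Rightarrow> 'a) list set. U \<noteq> {} \<and> c1_open_ifs k U \<and>
     (\<forall>fs\<in>U. minimal_ifs fs \<and>
        (\<exists>m. stationary fs p m \<and> full_support m \<and> neg_lyap fs p m \<and> delta_conditionals fs p m))"
proof -
  have p0: "0 < p 0" "p 0 < 1" using assms by auto
  obtain a :: 'a and E n P Q where frame: "\<And>\<eta>. 0 < \<eta> \<Longrightarrow> \<eta> \<le> 1 / 16 \<Longrightarrow> moebius_frame a E n P Q \<eta>"
    using ex_moebius_frame[OF assms(2)] by blast
  \<comment> \<open>A preliminary instance with the admissible value \<open>1 / 16\<close> gives
    access to the facts about \<open>a\<close> and \<open>E 0\<close> before \<open>\<eta>\<close>
    is chosen.\<close>
  interpret base: moebius_frame a E n P Q "1 / 16" "\<theta>" for \<theta> by (rule frame) auto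
  obtain \<alpha> :: real where \<alpha>: "\<alpha> \<notin> \<rat>"
    using uncountable_UNIV_real countable_rat by (metis UNIV_eq_I)
  define \<theta> where "\<theta> = 2 * pi * \<alpha>"
  have irr: "\<theta> / (2 * pi) \<notin> \<rat>" using \<alpha> by (simp add: \<theta>_def)
  obtain J' where "(1 - p 0) ^ J' < 1 / 16" using real_arch_pow_inv[of "1 / 16" "1 - p 0"] p0 by auto
  then obtain J where J: "J \<ge> 1" "(1 - p 0) ^ (J - 1) \<le> 1 / 16"
    by (metis diff_Suc_1 le_add1 less_imp_le plus_1_eq_Suc)
  let ?R = "rot a (E 0)"
  define V where "V = (\<lambda>j. norm (?R (real j * \<theta>) (- a) + a)) ` {1..J} \<union> (\<lambda>j. norm (?R (real j * \<theta>) a + a)) ` {0..J}"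
  have Vpos: "v > 0" if "v \<in> V" for v
  proof -
    have "?R 0 a + a \<noteq> 0" using base.a by (auto simp: rot_def simp flip: scaleR_2)
    then have "?R (real j * \<theta>) a + a \<noteq> 0" for j
      using irrational_rotation(2)[OF base.a base.E0 irr, of j] by (cases "j = 0") auto
    then show ?thesis using that irrational_rotation(1)[OF base.a base.E0 irr] unfolding V_def by auto
  qed
  have Vfin: "finite V" "V \<noteq> {}" by (auto simp: V_def)
  define \<eta> where "\<eta> = min (1 / 16) (Min V / 16)"
  have "Min V > 0" using Vfin Vpos by simp
  then have \<eta>: "0 < \<eta>" "\<eta> \<le> 1 / 16" "16 * \<eta> \<le> Min V" by (auto simp: \<eta>_def)
  have \<eta>V: "16 * \<eta> \<le> v" if "v \<in> V" for v using \<eta>(3) Min_le[OF Vfin(1) that] by linarith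
  have away_b: "norm (?R (real j * \<theta>) (- a) + a) \<ge> 16 * \<eta>" if "1 \<le> j" "j \<le> J" for j
    using that by (intro \<eta>V) (auto simp: V_def)
  have away_a: "norm (?R (real j * \<theta>) a + a) \<ge> 16 * \<eta>" if "j \<le> J" for j
    using that by (intro \<eta>V) (auto simp: V_def)
  interpret mf: moebius_frame a E n P Q \<eta> \<theta> by (rule frame[OF \<eta>(1,2)])
  let ?c = mf.c
  define Y where "Y = (?c\<^sup>2 / 2) ^ (n - 1)"
  have Y: "0 < Y" using mf.c by (simp add: Y_def)
  define \<sigma> where "\<sigma> = min (1 / 2) Y"
  have \<sigma>: "0 < \<sigma>" "\<sigma> \<le> 1 / 2" "\<sigma> \<le> Y" using Y by (auto simp: \<sigma>_def)
  have \<sigma>2: "\<sigma>\<^sup>2 / 2 \<le> Y"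
  proof -
    have "\<sigma> * \<sigma> \<le> \<sigma> * 1" using \<sigma> by (intro mult_left_mono) auto
    then show ?thesis unfolding power2_eq_square using \<sigma> by linarith
  qed
  obtain b where b: "\<forall>y\<in>Sph. \<exists>js. length js = n \<and> (\<forall>j\<in>set js. j \<le> b)
      \<and> (\<exists>x\<in>Sph. norm (x - a) < \<sigma> / 2 \<and> word mf.base (blocks js) x = y)
      \<and> (1 - inner y a \<le> (?c\<^sup>2 / 2) ^ (n - 1) \<longrightarrow> (\<forall>j\<in>set js. norm (?R (real j * \<theta>) a + a) \<ge> 1))"
    using mf.blocks_certificate[OF irr half_gt_zero[OF \<sigma>(1)]] by blast
  obtain L1 where L1: "\<forall>x\<in>Sph. \<exists>w. set w \<subseteq> {0, 1} \<and> length w \<le> L1 \<and> norm (word mf.base w x - a) < \<sigma> / 2"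
    using mf.approach_pole[of "\<sigma> / 2"] away_b[of 1] J \<sigma> by auto
  define L where "L = max L1 (n * Suc b)"
  have L: "L1 \<le> L" "n * Suc b \<le> L" by (auto simp: L_def)
  have B: "0 < (1 + 1 / ?c) ^ L" using mf.c by (intro zero_less_power add_pos_pos) auto
  \<comment> \<open>In order, the bounds serve the contraction factor of \<open>fs ! 0\<close>, its
    landing near \<open>a\<close>, the errors over \<open>J\<close> rotations, the drift, the errors
    of words up to length \<open>L\<close>, and the expansion of a run of rotations.\<close>
  define \<epsilon> where "\<epsilon> = Min {4 * \<eta>\<^sup>2, \<eta> / 2, \<eta> / real J, mf.A * p 0 / 16, ?c ^ L * (\<sigma> / 4) / (1 + 1 / ?c) ^ L, 1 / (2 * real (Suc L))}"
  have \<epsilon>pos: "0 < \<epsilon>"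
    unfolding \<epsilon>_def using \<eta> J p0 mf.A mf.c \<sigma> B by (subst Min_gr_iff) (auto intro!: mult_pos_pos divide_pos_pos)
  have \<epsilon>: "\<epsilon> \<le> 4 * \<eta>\<^sup>2" "\<epsilon> \<le> \<eta> / 2" "\<epsilon> \<le> \<eta> / real J" "\<epsilon> \<le> mf.A * p 0 / 16"
    "\<epsilon> \<le> ?c ^ L * (\<sigma> / 4) / (1 + 1 / ?c) ^ L" "\<epsilon> \<le> 1 / (2 * real (Suc L))"
    unfolding \<epsilon>_def by (rule Min_le; simp)+
  have J\<epsilon>: "real J * \<epsilon> \<le> \<eta>" using \<epsilon>(3) J(1) by (simp add: field_simps)
  have small1: "(1 + 1 / ?c) ^ L * \<epsilon> \<le> ?c ^ L * (\<sigma> / 4)" using \<epsilon>(5) B by (subst (asm) le_divide_eq) (simp add: mult.commute)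
  have small2: "real L * \<epsilon> \<le> 1 / 2"
  proof -
    have "real L * \<epsilon> \<le> real (Suc L) * (1 / (2 * real (Suc L)))" using \<epsilon>(6) \<epsilon>pos by (intro mult_mono) auto
    moreover have "x * (1 / (2 * x)) = 1 / 2" if "x > 0" for x :: real using that by simp
    from this[of "real (Suc L)"] have "real (Suc L) * (1 / (2 * real (Suc L))) = 1 / 2" by linarith
    ultimately show ?thesis by linarith
  qed
  define fs0 where "fs0 = mf.f0 # replicate (k - 1) (?R \<theta>)"
  have fs0: "length fs0 = k" "fs0 ! 0 = mf.f0" "\<And>i. 1 \<le> i \<Longrightarrow> i < k \<Longrightarrow> fs0 ! i = ?R \<theta>"
    using assms(1) by (auto simp: fs0_def nth_Cons')
  have fs0_diffeo: "sphere_diffeo (fs0 ! i)" if "i < k" for i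
    using that fs0(2,3) mf.f0_diffeo mf.R_diffeo by (cases "i = 0") auto
  \<comment> \<open>The strict inequality \<open>d < \<epsilon>\<close> leaves the room
    \<open>\<epsilon> - d\<close>, of which a perturbation of size
    \<open>(\<epsilon> - d) / 4\<close> in \<open>c1_dist\<close> uses at most one half. Openness is
    then the triangle inequality for \<open>lip_close\<close>.\<close>
  define U where "U = {gs. length gs = k \<and> (\<forall>i<k. sphere_diffeo (gs ! i)) \<and> (\<exists>d<\<epsilon>. \<forall>i<k. lip_close d (fs0 ! i) (gs ! i))}"
  have "fs0 \<in> U" unfolding U_def using fs0(1) fs0_diffeo \<epsilon>pos lip_close_refl by blast
  moreover have "c1_open_ifs k U"
    unfolding c1_open_ifs_def
  proof (intro conjI ballI)
    fix gs assume gs: "gs \<in> U"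
    then show "length gs = k" "\<forall>i<k. sphere_diffeo (gs ! i)" by (auto simp: U_def)
    from gs obtain d where d: "d < \<epsilon>" "\<And>i. i < k \<Longrightarrow> lip_close d (fs0 ! i) (gs ! i)" by (auto simp: U_def)
    show "\<exists>e>0. \<forall>hs. length hs = k \<and> (\<forall>i<k. sphere_diffeo (hs ! i) \<and> c1_dist (gs ! i) (hs ! i) < e) \<longrightarrow> hs \<in> U"
    proof (intro exI[of _ "(\<epsilon> - d) / 4"] conjI allI impI)
      show "(\<epsilon> - d) / 4 > 0" using d by simp
      fix hs assume hs: "length hs = k \<and> (\<forall>i<k. sphere_diffeo (hs ! i) \<and> c1_dist (gs ! i) (hs ! i) < (\<epsilon> - d) / 4)"
      have "lip_close (d + 2 * ((\<epsilon> - d) / 4)) (fs0 ! i) (hs ! i)" if i: "i < k" for i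
      proof (rule lip_close_trans[OF d(2)[OF i] c1_dist_lip_close[OF assms(2)]])
        show "C1_near Sph (gs ! i)" "C1_near Sph (hs ! i)" "c1_dist (gs ! i) (hs ! i) < (\<epsilon> - d) / 4"
          using i hs gs sphere_diffeoD(5) by (auto simp: U_def)
      qed
      moreover have "d + 2 * ((\<epsilon> - d) / 4) < \<epsilon>" using d(1) by (simp add: field_simps)
      ultimately show "hs \<in> U" unfolding U_def using hs by blast
    qed
  qed
  moreover have "minimal_ifs gs \<and> (\<exists>m. stationary gs p m \<and> full_support m \<and> neg_lyap gs p m \<and> delta_conditionals gs p m)"
    if gs: "gs \<in> U" for gs
  proof -
    have len: "length gs = k" and df: "\<And>i. i < k \<Longrightarrow> sphere_diffeo (gs ! i)" using gs by (auto simp: U_def)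
    have cl: "lip_close \<epsilon> (fs0 ! i) (gs ! i)" if "i < k" for i
      using gs that lip_close_mono less_imp_le unfolding U_def by blast
    interpret ps: perturbed_system a E n P Q \<eta> \<theta> gs p J \<epsilon>
    proof
      show "DIM('a) \<ge> 2" by (rule assms(2))
      show "sphere_diffeo (gs ! i)" "0 < p i" if "i < length gs" for i using df that len assms(3) by auto
      show "(\<Sum>i<length gs. p i) = 1" using len assms(4) by simp
      show "2 \<le> length gs" using len assms(1) by simp
      show "lip_close \<epsilon> mf.f0 (gs ! 0)" using cl[of 0] fs0(2) assms(1) by simp
      show "lip_close \<epsilon> (?R \<theta>) (gs ! i)" if "1 \<le> i" "i < length gs" for i using cl[of i] fs0(3)[of i] that len by simp
    qed (fact J away_b away_a \<epsilon>pos \<epsilon> J\<epsilon>)+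
    have "minimal_ifs gs"
    proof (rule ps.minimal[of b \<sigma> L])
      show "\<exists>w. set w \<subseteq> {0, 1} \<and> length w \<le> L \<and> norm (word mf.base w x - a) < \<sigma> / 2" if "x \<in> Sph" for x
        using L1 that L(1) by (meson order_trans)
      show "\<sigma>\<^sup>2 / 2 \<le> (?c\<^sup>2 / 2) ^ (n - 1)" using \<sigma>2 by (simp add: Y_def)
    qed (use b L(2) \<sigma> small1 small2 in blast)+
    then show ?thesis by (rule ps.all_properties)
  qed
  ultimately show ?thesis by blast
qed

end
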